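(* Let $N\geq4$ and let $f$ satisfy $(f1)$ and $(f2)$. The ground state energies of the radial and the $\Gamma_\infty$-invariant solutions of $-\Delta u=f(u)$, $u\in D_0^{1,2}(\Omega_R)$, satisfy $$\sup_{R>0}c_R^{\Gamma_\infty}=\sup_{R>0}c_R^{O(N)}=\infty.$$
   Context: For $R>0$, $\Omega_R:=\{x\in\mathbb{R}^N:|x|>R\}$, and $2^*:=\frac{2N}{N-2}$. Assumptions on $f$, with $F(s):=\int_0^s f(t)\,\mathrm{d}t$: $(f1)$ $f\in\mathcal{C}^1[0,\infty)$ and there are constants $A_1>0$ and $2<p<2^*<q$ such that, for $m=-1,0,1$, $|f^{(m)}(s)|\leq A_1|s|^{p-(m+1)}$ if $|s|\geq 1$ and $|f^{(m)}(s)|\leq A_1|s|^{q-(m+1)}$ if $|s|\leq 1$, where $f^{(-1)}:=F$, $f^{(0)}:=f$, $f^{(1)}:=f'$. $(f2)$ There is a constant $\theta>2$ such that $0\leq\theta F(s)\leq f(s)s<f'(s)s^2$ for all $s>0$. The function $f$ is extended to $\mathbb{R}$ by $f(s):=-f(-s)$ for $s<0$. $D^{1,2}(\mathbb{R}^N):=\{u\in L^{2^*}(\mathbb{R}^N):\nabla u\in L^2(\mathbb{R}^N,\mathbb{R}^N)\}$ with norm $\|u\|:=(\int_{\mathbb{R}^N}|\nabla u|^2)^{1/2}$, and $D_0^{1,2}(\Omega_R)$ is the closure of $\mathcal{C}_c^\infty(\Omega_R)$ in $D^{1,2}(\mathbb{R}^N)$. The energy functional is $J(u):=\frac12\|u\|^2-\int_{\mathbb{R}^N}F(u)$.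 We identify $\mathbb{R}^N\equiv\mathbb{C}\times\mathbb{R}^{N-2}$, $x=(z,y)$. Let $\mathbb{S}^1$ be the group of unit complex numbers and $\Gamma_\infty:=\mathbb{S}^1\times O(N-2)$, acting on $\mathbb{R}^N$ by $(\alpha,\beta)(z,y):=(\alpha z,\beta y)$. For a closed subgroup $G$ of $O(N)$, $u$ is $G$-invariant if $u(gx)=u(x)$ for all $g\in G$, $x\in\mathbb{R}^N$; $D_0^{1,2}(\Omega_R)^G$ is the subspace of $G$-invariant functions in $D_0^{1,2}(\Omega_R)$; $$\mathcal{N}_R^G:=\{u\in D_0^{1,2}(\Omega_R)^G:u\neq0,\ J'(u)u=0\},\qquad c_R^G:=\inf_{u\in\mathcal{N}_R^G}J(u).$$ *)

theory Defs
  imports "HOL-Analysis.Analysis"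
begin

(* Euclidean N-space is a type 'a :: euclidean_space, with N = DIM('a).
   Elements of Lebesgue and Sobolev spaces are represented by functions 'a \<Rightarrow> real; every notion below
   depends only on the class modulo Lebesgue null sets. *)

definition crit_exp :: "nat \<Rightarrow> real" where
  "crit_exp N = 2 * real N / (real N - 2)"

definition ext_domain :: "real \<Rightarrow> 'a::euclidean_space set" where
  "ext_domain R = {x. norm x > R}"

definition primitive :: "(real \<Rightarrow> real) \<Rightarrow> real \<Rightarrow> real" where
  "primitive f s = (LBINT t=ereal 0..ereal s. f t)"

(* In f1 and f2 only the values on [0,\<infinity>) matter; there f' is determined by f (one-sided at 0). *)

definition f1 :: "nat \<Rightarrow> (real \<Rightarrow> real) \<Rightarrow> (real \<Rightarrow> real) \<Rightarrow> bool" where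
  "f1 N f f' \<longleftrightarrow>
     (\<forall>s\<ge>0. (f has_real_derivative f' s) (at s within {0..})) \<and> continuous_on {0..} f' \<and>
     (\<exists>A p q. A > 0 \<and> 2 < p \<and> p < crit_exp N \<and> crit_exp N < q \<and>
        (\<forall>s\<ge>1. \<bar>primitive f s\<bar> \<le> A * s powr p
              \<and> \<bar>f s\<bar> \<le> A * s powr (p - 1)
              \<and> \<bar>f' s\<bar> \<le> A * s powr (p - 2)) \<and>
        (\<forall>s\<in>{0..1}. \<bar>primitive f s\<bar> \<le> A * s powr q
              \<and> \<bar>f s\<bar> \<le> A * s powr (q - 1)
              \<and> \<bar>f' s\<bar> \<le> A * s powr (q - 2)))"

definition f2 :: "(real \<Rightarrow> real) \<Rightarrow> (real \<Rightarrow> real) \<Rightarrow> bool" where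
  "f2 f f' \<longleftrightarrow>
     (\<exists>\<theta>>2. \<forall>s>0. 0 \<le> \<theta> * primitive f s \<and> \<theta> * primitive f s \<le> f s * s \<and> f s * s < f' s * s\<^sup>2)"

definition odd_ext :: "(real \<Rightarrow> real) \<Rightarrow> real \<Rightarrow> real" where
  "odd_ext f s = (if s \<ge> 0 then f s else - f (- s))"

definition dir_deriv :: "'a::euclidean_space \<Rightarrow> ('a \<Rightarrow> real) \<Rightarrow> 'a \<Rightarrow> real" where
  "dir_deriv b \<phi> x = frechet_derivative \<phi> (at x) b"

(* C^\<infinity>: all iterated partial derivatives exist and are (Frechet) differentiable, hence continuous. *)
definition smooth :: "('a::euclidean_space \<Rightarrow> real) \<Rightarrow> bool" where
  "smooth \<phi> \<longleftrightarrow> (\<forall>bs. set bs \<subseteq> Basis \<longrightarrow> foldr dir_deriv bs \<phi> differentiable_on UNIV)"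

definition test_functions :: "'a::euclidean_space set \<Rightarrow> ('a \<Rightarrow> real) set" where
  "test_functions S =
     {\<phi>. smooth \<phi> \<and> compact (closure (support_on UNIV \<phi>)) \<and> closure (support_on UNIV \<phi>) \<subseteq> S}"

definition locally_integrable :: "('a::euclidean_space \<Rightarrow> 'b::euclidean_space) \<Rightarrow> bool" where
  "locally_integrable u \<longleftrightarrow> (\<forall>K. compact K \<longrightarrow> set_integrable lebesgue K u)"

definition has_weak_gradient ::
    "('a::euclidean_space \<Rightarrow> real) \<Rightarrow> ('a \<Rightarrow> 'a) \<Rightarrow> bool" where
  "has_weak_gradient u g \<longleftrightarrow> locally_integrable u \<and> locally_integrable g \<and>
     (\<forall>\<phi>\<in>test_functions UNIV. \<forall>b\<in>Basis.
        (\<integral>x. u x * dir_deriv b \<phi> x \<partial>lebesgue) = - (\<integral>x. (g x \<bullet> b) * \<phi> x \<partial>lebesgue))"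

(* Weak gradients are unique up to null sets, so the choice of representative is immaterial. *)
definition weak_gradient :: "('a::euclidean_space \<Rightarrow> real) \<Rightarrow> 'a \<Rightarrow> 'a" where
  "weak_gradient u = (SOME g. has_weak_gradient u g)"

definition D12 :: "('a::euclidean_space \<Rightarrow> real) set" where
  "D12 = {u. u \<in> borel_measurable lebesgue \<and>
             integrable lebesgue (\<lambda>x. \<bar>u x\<bar> powr crit_exp DIM('a)) \<and>
             (\<exists>g. has_weak_gradient u g \<and> integrable lebesgue (\<lambda>x. (norm (g x))\<^sup>2))}"

definition D12_norm :: "('a::euclidean_space \<Rightarrow> real) \<Rightarrow> real" where
  "D12_norm u = sqrt (\<integral>x. (norm (weak_gradient u x))\<^sup>2 \<partial>lebesgue)"

definition D12_0 :: "'a::euclidean_space set \<Rightarrow> ('a \<Rightarrow> real) set" where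
  "D12_0 S = {u \<in> D12. \<forall>\<epsilon>>0. \<exists>\<phi>\<in>test_functions S. D12_norm (\<lambda>x. u x - \<phi> x) < \<epsilon>}"

definition invariant :: "('a::euclidean_space \<Rightarrow> 'a) set \<Rightarrow> ('a \<Rightarrow> real) \<Rightarrow> bool" where
  "invariant G u \<longleftrightarrow> (\<forall>g\<in>G. AE x in lebesgue. u (g x) = u x)"

definition energy :: "(real \<Rightarrow> real) \<Rightarrow> ('a::euclidean_space \<Rightarrow> real) \<Rightarrow> real" where
  "energy f u = 1 / 2 * (D12_norm u)\<^sup>2 - (\<integral>x. primitive f (u x) \<partial>lebesgue)"

(* L is the Frechet derivative at u of the functional E on the normed space D12. *)
definition has_D12_derivative ::
    "(('a::euclidean_space \<Rightarrow> real) \<Rightarrow> real) \<Rightarrow> (('a \<Rightarrow> real) \<Rightarrow> real) \<Rightarrow> ('a \<Rightarrow> real) \<Rightarrow> bool" where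
  "has_D12_derivative E L u \<longleftrightarrow>
     (\<forall>v\<in>D12. \<forall>w\<in>D12. \<forall>a b. L (\<lambda>x. a * v x + b * w x) = a * L v + b * L w) \<and>
     (\<exists>C. \<forall>v\<in>D12. \<bar>L v\<bar> \<le> C * D12_norm v) \<and>
     (\<forall>\<epsilon>>0. \<exists>\<delta>>0. \<forall>v\<in>D12. D12_norm v < \<delta> \<longrightarrow>
        \<bar>E (\<lambda>x. u x + v x) - E u - L v\<bar> \<le> \<epsilon> * D12_norm v)"

definition nehari ::
    "(real \<Rightarrow> real) \<Rightarrow> real \<Rightarrow> ('a::euclidean_space \<Rightarrow> 'a) set \<Rightarrow> ('a \<Rightarrow> real) set" where
  "nehari f R G = {u \<in> D12_0 (ext_domain R). invariant G u \<and> \<not> (AE x in lebesgue. u x = 0) \<and>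
                     (\<exists>L. has_D12_derivative (energy f) L u \<and> L u = 0)}"

definition ground_energy ::
    "(real \<Rightarrow> real) \<Rightarrow> real \<Rightarrow> ('a::euclidean_space \<Rightarrow> 'a) set \<Rightarrow> ereal" where
  "ground_energy f R G = (INF u\<in>nehari f R G. ereal (energy f u))"

definition orth_group :: "('a::euclidean_space \<Rightarrow> 'a) set" where
  "orth_group = {g. orthogonal_transformation g}"

(* The product type carries the Euclidean norm, so it is R^N with N = CARD('m) + 2. *)
definition Gamma_inf :: "(complex \<times> (real^'m) \<Rightarrow> complex \<times> (real^'m)) set" where
  "Gamma_inf = {(\<lambda>(z, y). (\<alpha> * z, \<beta> y)) | \<alpha> \<beta>. norm \<alpha> = 1 \<and> orthogonal_transformation \<beta>}"

end

theory Submission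
  imports Defs
begin

text \<open>
  A function \<open>u\<close> with weak gradient in \<open>L\<^sup>2\<close> satisfies \<open>\<parallel>u(\<cdot> + \<xi>) - u\<parallel>\<^sub>2 \<le> |\<xi>| \<parallel>u\<parallel>\<close>. If every ball
  of radius \<open>h\<close> about a point of \<open>{|u| > t}\<close> meets \<open>{|u| > t/2}\<close> in at most half of its volume, then
  integrating this over \<open>|\<xi>| < h\<close> gives \<open>|{|u| > t}| \<le> 8 h\<^sup>2 \<parallel>u\<parallel>\<^sup>2 / t\<^sup>2\<close>. This estimate is used twice.
  Choosing \<open>h\<close> such that the ball has volume \<open>2 |{|u| > t/2}|\<close> yields the weak-type Sobolev inequality.
  If \<open>u\<close> is invariant under \<open>\<Gamma>\<^sub>\<infinity>\<close> and vanishes on a large ball, then, since \<open>N \<ge> 4\<close>, every point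
  outside that ball has many well separated images under \<open>\<Gamma>\<^sub>\<infinity>\<close>, so the hypothesis holds for a
  fixed small \<open>h\<close>. As \<open>p < 2* < q\<close>, summing over dyadic levels shows that \<open>\<integral> F(2u)\<close> is at most
  \<open>\<parallel>u\<parallel>\<^sup>2 / 2\<close> once \<open>\<parallel>u\<parallel>\<^sup>2 \<le> K\<close> and \<open>R\<close> is large. On the Nehari set, however, \<open>\<parallel>u\<parallel>\<^sup>2 \<le> \<integral> F(2u)\<close>;
  hence \<open>\<parallel>u\<parallel>\<^sup>2 > K\<close> there, and \<open>J u \<ge> (1/2 - 1/\<theta>) \<parallel>u\<parallel>\<^sup>2\<close>.
\<close>

text \<open>The smallness has to be proportional to \<open>(D12_norm u)\<^sup>2\<close>; an absolute
  bound would not contradict the Nehari identity for functions of small norm. Levels up to d and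
  levels above 1/d satisfy such a bound by the weak Sobolev inequality alone: it yields the power
  \<open>crit_exp N / 2\<close> of the squared norm, this power exceeds 1, the norm is bounded
  through K, and the remaining factor tends to 0 with d. Symmetry and large R enter for the levels
  in between, where the measure of {|u| > d} is again bounded linearly in the squared norm. The
  condition N >= 4 makes O(N - 2) act on spheres of dimension at least 1, so that points with z = 0
  also have arbitrarily many images; for N = 3 such a point has only two. The weak Sobolev
  inequality has a second task. Membership in \<open>D12_0\<close> means approximation in the
  gradient norm, and the inequality turns this into vanishing on the ball.\<close>

subsection \<open>Smooth bumps\<close>

text \<open>The powers of s in the denominator make the span of this family closed under
  differentiation, so smoothness follows from first derivatives alone.\<close>

definition flat_exp :: "nat \<Rightarrow> real \<Rightarrow> real" where
  "flat_exp k s = (if s > 0 then exp (- (1 / s)) / s ^ k else 0)"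

lemma flat_exp_tendsto_0: "(flat_exp k \<longlongrightarrow> 0) (at_right 0)"
proof -
  have "((\<lambda>s::real. inverse s ^ k / exp (inverse s)) \<longlongrightarrow> 0) (at_right 0)"
    by (rule filterlim_compose[OF tendsto_power_div_exp_0 filterlim_inverse_at_top_right])
  moreover have "\<forall>\<^sub>F s in at_right 0. inverse s ^ k / exp (inverse s) = flat_exp k s"
    by (rule eventually_at_right_less[THEN eventually_mono])
      (simp add: flat_exp_def exp_minus field_simps power_inverse)
  ultimately show ?thesis
    by (rule Lim_transform_eventually)
qed

lemma flat_exp_deriv:
  "(flat_exp k has_real_derivative (flat_exp (k + 2) s - real k * flat_exp (k + 1) s)) (at s)"
proof (cases s "0::real" rule: linorder_cases)
  case less
  have "((\<lambda>s. 0) has_real_derivative 0) (at s)" by simp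
  then have "(flat_exp k has_real_derivative 0) (at s)"
    by (rule has_field_derivative_transform_within_open[of _ _ _ "{..<0}"])
      (use less in \<open>auto simp: flat_exp_def\<close>)
  then show ?thesis using less by (simp add: flat_exp_def)
next
  case equal
  have "((\<lambda>h. (flat_exp k (0 + h) - flat_exp k 0) / h) \<longlongrightarrow> 0) (at 0)"
  proof (rule filterlim_split_at)
    \<comment> \<open>To the right of 0 the difference quotient is
      \<open>flat_exp (Suc k) h\<close>, whose limit is already known.\<close>
    show "((\<lambda>h. (flat_exp k (0 + h) - flat_exp k 0) / h) \<longlongrightarrow> 0) (at_right 0)"
      by (rule Lim_transform_eventually[OF flat_exp_tendsto_0[of "Suc k"]],
          rule eventually_at_right_less[THEN eventually_mono])
        (simp add: flat_exp_def field_simps)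
    show "((\<lambda>h. (flat_exp k (0 + h) - flat_exp k 0) / h) \<longlongrightarrow> 0) (at_left 0)"
      by (rule Lim_transform_eventually[OF tendsto_const])
        (simp add: flat_exp_def eventually_at_filter)
  qed
  then show ?thesis using equal by (simp add: flat_exp_def DERIV_def)
next
  case greater
  have "((\<lambda>s. exp (- (1 / s)) / s ^ k) has_real_derivative 
      (flat_exp (k + 2) s - real k * flat_exp (k + 1) s)) (at s)"
  proof -
    \<comment> \<open>Differentiating \<open>s ^ k\<close> produces the truncated exponent
      \<open>k - Suc 0\<close>; for k = 0 both sides are 0.\<close>
    have "real k * s ^ (k - Suc 0) * s = real k * s ^ k"
      by (cases k) auto
    then show ?thesis
      using greater
      by (auto intro!: derivative_eq_intros simp: flat_exp_def divide_simps power_add power2_eq_square)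
        (simp add: algebra_simps)
  qed
  then show ?thesis
    by (rule has_field_derivative_transform_within_open[of _ _ _ "{0<..}"])
      (use greater in \<open>auto simp: flat_exp_def\<close>)
qed

text \<open>Smoothness asks for all iterated partial derivatives. This algebra is closed under
  \<open>dir_deriv\<close>, so differentiability of its members is enough. Linear functions belong
  to it because the chain rule for \<open>x \<bullet> x\<close> produces the factor
  \<open>x \<bullet> b\<close>; together with the constants they also generate the polynomials of
  the Stone-Weierstrass theorem.\<close>

inductive_set bump_alg :: "('a::euclidean_space \<Rightarrow> real) set" where
  linear: "bounded_linear f \<Longrightarrow> f \<in> bump_alg"
| const: "(\<lambda>x. c) \<in> bump_alg"
| flat: "(\<lambda>x. flat_exp k (c - x \<bullet> x)) \<in> bump_alg"
| add: "\<phi> \<in> bump_alg \<Longrightarrow> \<psi> \<in> bump_alg \<Longrightarrow> (\<lambda>x. \<phi> x + \<psi> x) \<in> bump_alg"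
| mult: "\<phi> \<in> bump_alg \<Longrightarrow> \<psi> \<in> bump_alg \<Longrightarrow> (\<lambda>x. \<phi> x * \<psi> x) \<in> bump_alg"

lemma real_polynomial_bump_alg: "real_polynomial_function p \<Longrightarrow> p \<in> bump_alg"
  by (induction rule: real_polynomial_function.induct) (auto intro: bump_alg.intros)

lemma bump_alg_derivative:
  assumes "\<phi> \<in> bump_alg"
  shows "\<exists>D. (\<forall>x. (\<phi> has_derivative D x) (at x)) \<and> (\<forall>b. (\<lambda>x. D x b) \<in> bump_alg)"
  using assms
proof (induction rule: bump_alg.induct)
  case (linear f)
  then show ?case
    by (intro exI[of _ "\<lambda>x. f"]) (auto intro: bump_alg.intros bounded_linear_imp_has_derivative)
next
  case (const c)
  then show ?case
    by (intro exI[of _ "\<lambda>x. \<lambda>b. 0"]) (auto intro: bump_alg.intros)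
next
  case (flat k c)
  let ?d = "\<lambda>x. flat_exp (k + 2) (c - x \<bullet> x) + (- real k) * flat_exp (k + 1) (c - x \<bullet> x)"
  have D: "((\<lambda>x. flat_exp k (c - x \<bullet> x)) has_derivative (\<lambda>b. ?d x * ((-2) * (x \<bullet> b)))) (at x)" for x :: 'a
  proof -
    have 1: "((\<lambda>x. c - x \<bullet> x) has_derivative (\<lambda>b. - 2 * (x \<bullet> b))) (at x)"
      by (auto intro!: derivative_eq_intros simp: inner_commute)
    have 2: "(flat_exp k has_derivative (*) (?d x)) (at (c - x \<bullet> x))"
      using flat_exp_deriv[of k "c - x \<bullet> x"] by (simp add: has_field_derivative_def)
    show ?thesis
      using has_derivative_compose[OF 1 2] by simp
  qed
  show ?case
    by (intro exI[of _ "\<lambda>x b. ?d x * ((-2) * (x \<bullet> b))"] conjI allI D)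
      (intro bump_alg.intros bounded_linear_inner_left)
next
  case (add \<phi> \<psi>)
  then obtain D E where "\<forall>x. (\<phi> has_derivative D x) (at x)" "\<forall>b. (\<lambda>x. D x b) \<in> bump_alg"
    "\<forall>x. (\<psi> has_derivative E x) (at x)" "\<forall>b. (\<lambda>x. E x b) \<in> bump_alg" by metis
  then show ?case
    by (intro exI[of _ "\<lambda>x b. D x b + E x b"]) (auto intro: bump_alg.intros has_derivative_add)
next
  case (mult \<phi> \<psi>)
  then obtain D E where "\<forall>x. (\<phi> has_derivative D x) (at x)" "\<forall>b. (\<lambda>x. D x b) \<in> bump_alg"
    "\<forall>x. (\<psi> has_derivative E x) (at x)" "\<forall>b. (\<lambda>x. E x b) \<in> bump_alg" by metis
  with mult.hyps show ?case
    by (intro exI[of _ "\<lambda>x b. \<phi> x * E x b + D x b * \<psi> x"])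
       (auto intro!: has_derivative_mult bump_alg.add intro: bump_alg.mult)
qed

lemma bump_alg_dir_deriv:
  assumes "\<phi> \<in> bump_alg"
  shows "\<phi> differentiable at x" "dir_deriv b \<phi> \<in> bump_alg"
proof -
  obtain D where D: "\<And>x. (\<phi> has_derivative D x) (at x)" "\<And>b. (\<lambda>x. D x b) \<in> bump_alg"
    using bump_alg_derivative[OF assms] by blast
  show "\<phi> differentiable at x" using D(1) by (rule differentiableI)
  have "dir_deriv b \<phi> = (\<lambda>x. D x b)"
    by (simp add: fun_eq_iff dir_deriv_def frechet_derivative_at[OF D(1), symmetric])
  then show "dir_deriv b \<phi> \<in> bump_alg" using D(2) by simp
qed

lemma bump_alg_smooth: "\<phi> \<in> bump_alg \<Longrightarrow> smooth \<phi>"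
proof -
  assume *: "\<phi> \<in> bump_alg"
  have "foldr dir_deriv bs \<phi> \<in> bump_alg" for bs
    by (induction bs) (auto simp: * bump_alg_dir_deriv)
  then show ?thesis
    by (auto simp: smooth_def differentiable_on_def intro: differentiable_at_withinI bump_alg_dir_deriv)
qed

lemma test_functionsI:
  assumes "smooth \<phi>" "compact K" "K \<subseteq> S" "\<And>x. x \<notin> K \<Longrightarrow> \<phi> x = 0"
  shows "\<phi> \<in> test_functions S"
proof -
  have "closure (support_on UNIV \<phi>) \<subseteq> K"
    using assms by (intro closure_minimal) (auto simp: support_on_def compact_imp_closed)
  then have "compact (closure (support_on UNIV \<phi>))" "closure (support_on UNIV \<phi>) \<subseteq> S"
    using assms compact_Int_closed[OF assms(2) closed_closure[of "support_on UNIV \<phi>"]]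
    by (auto simp: Int_absorb1)
  then show ?thesis
    using assms by (simp add: test_functions_def)
qed

text \<open>Approximating the quotient of \<open>\<psi>\<close> by a bump with a polynomial avoids smooth cutoffs that are
  identically 1 on a ball.\<close>

lemma test_functions_dense:
  fixes \<psi> :: "'a::euclidean_space \<Rightarrow> real"
  assumes cont: "continuous_on UNIV \<psi>" and supp: "\<And>x. norm x \<ge> r \<Longrightarrow> \<psi> x = 0"
    and r: "r > 0" and e: "e > 0"
  obtains \<phi> where "\<phi> \<in> test_functions UNIV" "\<And>x. norm x \<ge> r + 1 \<Longrightarrow> \<phi> x = 0"
    "\<And>x. \<bar>\<phi> x - \<psi> x\<bar> \<le> e"
proof -
  define \<eta> :: "'a \<Rightarrow> real" where "\<eta> = (\<lambda>x. flat_exp 0 ((r + 1)\<^sup>2 - x \<bullet> x))"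
  have \<eta>A: "\<eta> \<in> bump_alg" unfolding \<eta>_def by (rule bump_alg.flat)
  have norm_iff: "(r + 1)\<^sup>2 - x \<bullet> x > 0 \<longleftrightarrow> norm x < r + 1" for x :: 'a
    using r power_strict_mono[of "norm x" "r + 1" 2] power_mono[of "r + 1" "norm x" 2]
    by (auto simp: dot_square_norm not_less[symmetric] simp del: not_less)
  have \<eta>0: "\<eta> x = 0" if "norm x \<ge> r + 1" for x
    using norm_iff[of x] that by (auto simp: \<eta>_def flat_exp_def)
  have \<eta>p: "\<eta> x > 0" if "norm x < r + 1" for x
    using norm_iff[of x] that by (auto simp: \<eta>_def flat_exp_def)
  have \<eta>1: "0 \<le> \<eta> x \<and> \<eta> x \<le> 1" for x
    by (auto simp: \<eta>_def flat_exp_def)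
  have \<eta>c: "continuous_on UNIV \<eta>"
    using bump_alg_dir_deriv(1)[OF \<eta>A] by (simp add: continuous_at_imp_continuous_on differentiable_imp_continuous_within)
  \<comment> \<open>For norm x > r the numerator is 0, and so is the quotient, even where \<eta>
    vanishes, since division by zero yields 0. The two open sets overlap and cover the
    space.\<close>
  have "continuous_on (ball 0 (r + 1) \<union> - cball 0 r) (\<lambda>x. \<psi> x / \<eta> x)"
  proof (rule continuous_on_open_Un)
    show "continuous_on (ball 0 (r + 1)) (\<lambda>x. \<psi> x / \<eta> x)"
      using \<eta>p by (intro continuous_intros continuous_on_subset[OF cont] continuous_on_subset[OF \<eta>c])
        (auto simp: less_imp_neq[symmetric])
    have "continuous_on (- cball 0 r) (\<lambda>x. 0 :: real)" by simp
    then show "continuous_on (- cball 0 r) (\<lambda>x. \<psi> x / \<eta> x)"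
      by (rule continuous_on_eq) (auto simp: supp)
  qed auto
  moreover have "ball 0 (r + 1) \<union> - cball 0 r = (UNIV :: 'a set)" by auto
  ultimately have "continuous_on (cball 0 (r + 1)) (\<lambda>x. \<psi> x / \<eta> x)"
    using continuous_on_subset by fastforce
  then obtain p where p: "real_polynomial_function p" 
      "\<And>x. x \<in> cball 0 (r + 1) \<Longrightarrow> \<bar>\<psi> x / \<eta> x - p x\<bar> < e"
    using Stone_Weierstrass_real_polynomial_function[OF compact_cball _ e] by blast
  \<comment> \<open>Multiplication by \<eta> <= 1 does not enlarge the error of the
    polynomial.\<close>
  have 1: "\<bar>p x * \<eta> x - \<psi> x\<bar> \<le> e" for x
  proof (cases "norm x < r + 1")
    case True
    have "\<bar>p x * \<eta> x - \<psi> x\<bar> = \<bar>\<psi> x / \<eta> x - p x\<bar> * \<eta> x"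
    proof -
      have "\<bar>\<psi> x / \<eta> x - p x\<bar> * \<eta> x = \<bar>(\<psi> x / \<eta> x - p x) * \<eta> x\<bar>"
        using \<eta>1[of x] by (simp add: abs_mult)
      also have "(\<psi> x / \<eta> x - p x) * \<eta> x = - (p x * \<eta> x - \<psi> x)"
        using \<eta>p[OF True] by (simp add: field_simps)
      finally show ?thesis by (simp only: abs_minus_cancel)
    qed
    also have "\<dots> \<le> e * 1"
      using p(2)[of x] True \<eta>1[of x] by (intro mult_mono) auto
    finally show ?thesis by simp
  qed (use \<eta>0[of x] supp[of x] e in auto)
  have "(\<lambda>x. p x * \<eta> x) \<in> test_functions UNIV"
    by (rule test_functionsI[OF bump_alg_smooth[OF bump_alg.mult[OF real_polynomial_bump_alg[OF p(1)] \<eta>A]],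
          of "cball 0 (r + 1)"])
      (auto simp: \<eta>0)
  then show ?thesis
    using 1 \<eta>0 by (intro that[of "\<lambda>x. p x * \<eta> x"]) auto
qed

subsection \<open>Integration against test functions\<close>

lemma test_functions_deriv_continuous:
  assumes "\<phi> \<in> test_functions S"
  shows "continuous_on UNIV \<phi>" "\<phi> differentiable at x" "b \<in> Basis \<Longrightarrow> continuous_on UNIV (dir_deriv b \<phi>)"
proof -
  have sm: "foldr dir_deriv bs \<phi> differentiable_on UNIV" if "set bs \<subseteq> Basis" for bs
    using assms that by (simp add: test_functions_def smooth_def)
  show "continuous_on UNIV \<phi>" using sm[of "[]"] by (simp add: differentiable_imp_continuous_on)
  show "\<phi> differentiable at x" using sm[of "[]"] by (simp add: differentiable_on_def)
  show "b \<in> Basis \<Longrightarrow> continuous_on UNIV (dir_deriv b \<phi>)"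
    using sm[of "[b]"] by (simp add: differentiable_imp_continuous_on)
qed

lemma dir_deriv_eq_0_outside:
  assumes "closed K" "\<And>x. x \<notin> K \<Longrightarrow> \<phi> x = 0" "x \<notin> K"
  shows "dir_deriv b \<phi> x = 0"
proof -
  have "((\<lambda>_. 0) has_derivative (\<lambda>_. 0)) (at x)" by simp
  then have "(\<phi> has_derivative (\<lambda>_. 0)) (at x)"
    by (rule has_derivative_transform_within_open[of _ _ _ _ "- K"]) (use assms in auto)
  then show ?thesis by (simp add: dir_deriv_def frechet_derivative_at[symmetric])
qed

lemma test_functions_support:
  assumes "\<phi> \<in> test_functions S"
  obtains K where "compact K" "K \<subseteq> S" "\<And>x. x \<notin> K \<Longrightarrow> \<phi> x = 0" 
    "\<And>b x. x \<notin> K \<Longrightarrow> dir_deriv b \<phi> x = 0"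
proof -
  let ?K = "closure (support_on UNIV \<phi>)"
  have z: "\<phi> x = 0" if "x \<notin> ?K" for x
    using that closure_subset[of "support_on UNIV \<phi>"] by (auto simp: support_on_def)
  show ?thesis
  proof (rule that[of ?K])
    show "compact ?K" "?K \<subseteq> S" using assms by (auto simp: test_functions_def)
    show "dir_deriv b \<phi> x = 0" if "x \<notin> ?K" for b x
      using dir_deriv_eq_0_outside[OF closed_closure z that] .
  qed (rule z)
qed

lemma dir_deriv_sum_Basis:
  assumes "\<phi> differentiable at x"
  shows "frechet_derivative \<phi> (at x) \<xi> = (\<Sum>b\<in>Basis. (\<xi> \<bullet> b) * dir_deriv b \<phi> x)"
proof -
  have lin: "linear (frechet_derivative \<phi> (at x))"
    using assms by (rule linear_frechet_derivative)
  have "frechet_derivative \<phi> (at x) (\<Sum>b\<in>Basis. (\<xi> \<bullet> b) *\<^sub>R b) = (\<Sum>b\<in>Basis. (\<xi> \<bullet> b) * dir_deriv b \<phi> x)"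
    by (simp add: linear_sum[OF lin] linear_scale[OF lin] dir_deriv_def)
  then show ?thesis by (simp add: euclidean_representation)
qed

section \<open>Measurability and local integrability\<close>

lemma continuous_borel_lebesgue:
  "continuous_on UNIV f \<Longrightarrow> f \<in> borel_measurable lebesgue"
  for f :: "'a::euclidean_space \<Rightarrow> 'b::euclidean_space"
  by (intro measurable_completion) (simp add: borel_measurable_continuous_onI)

text \<open>The definition gives measurability of truncations to compact sets; u is their pointwise
  limit along growing balls.\<close>

lemma locally_integrable_borel_measurable:
  fixes u :: "'a::euclidean_space \<Rightarrow> 'b::euclidean_space"
  assumes "locally_integrable u"
  shows "u \<in> borel_measurable lebesgue"
proof (rule borel_measurable_LIMSEQ_metric)
  fix n :: nat
  show "(\<lambda>x. indicat_real (cball 0 (real n)) x *\<^sub>R u x) \<in> borel_measurable lebesgue"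
    using assms compact_cball[of "0::'a" "real n"]
    unfolding locally_integrable_def set_integrable_def
    by (intro borel_measurable_integrable) simp
next
  fix x :: 'a
  obtain N where N: "norm x \<le> real N" using real_arch_simple by blast
  have "\<forall>\<^sub>F n in sequentially. u x = indicat_real (cball 0 (real n)) x *\<^sub>R u x"
    using eventually_ge_at_top[of N] by eventually_elim (use N in auto)
  then show "(\<lambda>n. indicat_real (cball 0 (real n)) x *\<^sub>R u x) \<longlonglongrightarrow> u x"
    by (rule Lim_transform_eventually[OF tendsto_const])
qed

lemma locally_integrable_mult_bounded:
  fixes u :: "'a::euclidean_space \<Rightarrow> 'b::euclidean_space"
  assumes u: "locally_integrable u" and m: "\<psi> \<in> borel_measurable lebesgue"
    and K: "compact K" "\<And>x. x \<notin> K \<Longrightarrow> \<psi> x = 0" and B: "\<And>x. \<bar>\<psi> x\<bar> \<le> B"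
  shows "integrable lebesgue (\<lambda>x. \<psi> x *\<^sub>R u x)"
proof (rule Bochner_Integration.integrable_bound)
  have "integrable lebesgue (\<lambda>x. indicat_real K x *\<^sub>R u x)"
    using u K by (auto simp: locally_integrable_def set_integrable_def)
  then show "integrable lebesgue (\<lambda>x. B * norm (indicat_real K x *\<^sub>R u x))"
    by (intro integrable_mult_right integrable_norm)
  show "(\<lambda>x. \<psi> x *\<^sub>R u x) \<in> borel_measurable lebesgue"
    using locally_integrable_borel_measurable[OF u] m by measurable
  show "AE x in lebesgue. norm (\<psi> x *\<^sub>R u x) \<le> norm (B * norm (indicat_real K x *\<^sub>R u x))"
  proof (intro AE_I2)
    fix x
    have "0 \<le> B" using B[of x] by linarith
    then show "norm (\<psi> x *\<^sub>R u x) \<le> norm (B * norm (indicat_real K x *\<^sub>R u x))"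
      using B[of x] K(2)[of x] by (cases "x \<in> K") (auto simp: abs_mult intro: mult_right_mono)
  qed
qed

lemma continuous_compact_support_bounded:
  fixes \<psi> :: "'a::euclidean_space \<Rightarrow> real"
  assumes c: "continuous_on UNIV \<psi>" and K: "compact K" "\<And>x. x \<notin> K \<Longrightarrow> \<psi> x = 0"
  obtains B where "\<And>x. \<bar>\<psi> x\<bar> \<le> B" "B \<ge> 0"
proof -
  have "bounded (\<psi> ` K)"
    using c K by (intro compact_imp_bounded compact_continuous_image) (auto intro: continuous_on_subset)
  then obtain B where "B > 0" "\<And>x. x \<in> K \<Longrightarrow> \<bar>\<psi> x\<bar> \<le> B"
    by (auto simp: bounded_pos)
  then have "\<bar>\<psi> x\<bar> \<le> B" for x using K(2)[of x] by (cases "x \<in> K") auto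
  with \<open>B > 0\<close> show ?thesis by (intro that) auto
qed

lemma locally_integrable_mult_continuous:
  fixes u :: "'a::euclidean_space \<Rightarrow> 'b::euclidean_space" and \<psi> :: "'a \<Rightarrow> real"
  assumes u: "locally_integrable u" and c: "continuous_on UNIV \<psi>"
    and K: "compact K" "\<And>x. x \<notin> K \<Longrightarrow> \<psi> x = 0"
  shows "integrable lebesgue (\<lambda>x. \<psi> x *\<^sub>R u x)"
proof -
  obtain B where B: "\<And>x. \<bar>\<psi> x\<bar> \<le> B"
    using continuous_compact_support_bounded[OF c K] by metis
  show ?thesis
    by (rule locally_integrable_mult_bounded[OF u continuous_borel_lebesgue[OF c] K B])
qed

lemma locally_integrable_continuous:
  fixes u :: "'a::euclidean_space \<Rightarrow> 'b::euclidean_space"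
  assumes "continuous_on UNIV u" shows "locally_integrable u"
  unfolding locally_integrable_def
proof (intro allI impI)
  fix K :: "'a set" assume K: "compact K"
  have "continuous_on K u" using assms continuous_on_subset by blast
  then have "integrable lborel (\<lambda>x. indicator K x *\<^sub>R u x)"
    using borel_integrable_compact[OF K, of u] by (simp add: indicator_scaleR_eq_if)
  then show "set_integrable lebesgue K u"
    unfolding set_integrable_def
    by (subst integrable_completion) (auto intro: borel_measurable_integrable)
qed

lemma locally_integrable_const [simp]: "locally_integrable (\<lambda>x. c)"
  by (rule locally_integrable_continuous) simp

lemma integrable_mult_test:
  assumes "locally_integrable u" "\<psi> \<in> test_functions S"
  shows "integrable lebesgue (\<lambda>x. u x * \<psi> x :: real)"
proof -
  obtain K where "compact K" "\<And>x. x \<notin> K \<Longrightarrow> \<psi> x = 0" using test_functions_support[OF assms(2)] by metis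
  from locally_integrable_mult_continuous[OF assms(1) test_functions_deriv_continuous(1)[OF assms(2)] this]
  show ?thesis by (simp add: mult.commute)
qed

lemma integrable_mult_test_deriv:
  assumes "locally_integrable u" "\<psi> \<in> test_functions S" "b \<in> Basis"
  shows "integrable lebesgue (\<lambda>x. u x * dir_deriv b \<psi> x :: real)"
proof -
  obtain K where "compact K" "\<And>x. x \<notin> K \<Longrightarrow> dir_deriv b \<psi> x = 0" 
    using test_functions_support[OF assms(2)] by metis
  from locally_integrable_mult_continuous[OF assms(1) test_functions_deriv_continuous(3)[OF assms(2,3)] this]
  show ?thesis by (simp add: mult.commute)
qed

text \<open>The natural test function is w itself, which is neither bounded nor smooth. Its
  truncation \<open>\<psi> n\<close> is an almost everywhere limit of uniformly bounded test
  functions supported in one ball, so the bound passes to it by dominated convergence and reads a <=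
  A sqrt a for its squared norm a. Fatou's lemma then removes the truncation.\<close>

lemma L2_duality:
  fixes w :: "'a::euclidean_space \<Rightarrow> real"
  assumes w: "locally_integrable w" and A: "A \<ge> 0"
    and bound: "\<And>\<psi>. \<psi> \<in> test_functions UNIV \<Longrightarrow>
      \<bar>\<integral>x. w x * \<psi> x \<partial>lebesgue\<bar> \<le> A * sqrt (\<integral>x. (\<psi> x)\<^sup>2 \<partial>lebesgue)"
  shows "(\<integral>\<^sup>+x. ennreal ((w x)\<^sup>2) \<partial>lebesgue) \<le> ennreal (A\<^sup>2)"
proof -
  have wm[measurable]: "w \<in> borel_measurable lebesgue" using locally_integrable_borel_measurable[OF w] .
  define \<psi> where "\<psi> n x = (if \<bar>w x\<bar> \<le> real n \<and> norm x \<le> real n then w x else 0)" for n x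
  have \<psi>m[measurable]: "\<psi> n \<in> borel_measurable lebesgue" for n
  proof -
    have [measurable]: "(\<lambda>x::'a. x) \<in> borel_measurable lebesgue"
      by (rule continuous_borel_lebesgue) simp
    show ?thesis unfolding \<psi>_def by measurable
  qed
  have \<psi>b: "\<bar>\<psi> n x\<bar> \<le> real n" for n x by (simp add: \<psi>_def)
  have \<psi>s: "\<psi> n x = 0" if "norm x > real n" for n x using that by (simp add: \<psi>_def)
  have key: "(\<integral>\<^sup>+x. ennreal ((\<psi> n x)\<^sup>2) \<partial>lebesgue) \<le> ennreal (A\<^sup>2)" for n
  proof -
    have "\<psi> n measurable_on UNIV"
      by (rule lebesgue_measurable_imp_measurable_on_real) auto
    then obtain N g where N: "negligible N" and gc: "\<And>m. continuous_on UNIV (g m)" 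
      and gl: "\<And>x. x \<notin> N \<Longrightarrow> (\<lambda>m. g m x) \<longlonglongrightarrow> \<psi> n x"
      unfolding measurable_on_def by auto
    define c :: "'a \<Rightarrow> real" where "c x = max 0 (min 1 (real n + 1 - norm x))" for x
    define h where "h m x = max (- real n) (min (real n) (g m x)) * c x" for m x
    have hc: "continuous_on UNIV (h m)" for m
      unfolding h_def c_def by (intro continuous_intros gc)
    have hs: "h m x = 0" if "norm x \<ge> real n + 1" for m x
      using that by (simp add: h_def c_def)
    have hb: "\<bar>h m x\<bar> \<le> real n" for m x
    proof -
      have "\<bar>h m x\<bar> \<le> real n * 1"
        unfolding h_def abs_mult by (intro mult_mono) (auto simp: c_def)
      then show ?thesis by simp
    qed
    have hl: "(\<lambda>m. h m x) \<longlonglongrightarrow> \<psi> n x" if "x \<notin> N" for x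
    proof -
      have "(\<lambda>m. h m x) \<longlonglongrightarrow> max (- real n) (min (real n) (\<psi> n x)) * c x"
        unfolding h_def by (intro tendsto_intros gl that)
      moreover have "max (- real n) (min (real n) (\<psi> n x)) * c x = \<psi> n x"
        using \<psi>b[of n x] \<psi>s[of n x] by (cases "norm x \<le> real n") (auto simp: c_def)
      ultimately show ?thesis by simp
    qed
    have "\<exists>\<phi>. \<phi> \<in> test_functions UNIV \<and> (\<forall>x. norm x \<ge> real n + 1 + 1 \<longrightarrow> \<phi> x = 0) \<and>
          (\<forall>x. \<bar>\<phi> x - h m x\<bar> \<le> inverse (real (Suc m)))" for m
      by (rule test_functions_dense[where r = "real n + 1" and e = "inverse (real (Suc m))", OF hc[of m] hs]) (simp_all, blast)
    then have "\<forall>m. \<exists>\<phi>. \<phi> \<in> test_functions UNIV \<and> (\<forall>x. norm x \<ge> real n + 1 + 1 \<longrightarrow> \<phi> x = 0) \<and>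
          (\<forall>x. \<bar>\<phi> x - h m x\<bar> \<le> inverse (real (Suc m)))" by blast
    from choice[OF this] obtain \<phi> where \<phi>: "\<And>m. \<phi> m \<in> test_functions UNIV" 
        "\<And>m x. norm x \<ge> real n + 1 + 1 \<Longrightarrow> \<phi> m x = 0"
        "\<And>m x. \<bar>\<phi> m x - h m x\<bar> \<le> inverse (real (Suc m))"
      by blast
    have \<phi>l: "(\<lambda>m. \<phi> m x) \<longlonglongrightarrow> \<psi> n x" if "x \<notin> N" for x
    proof -
      have "(\<lambda>m. \<phi> m x - h m x) \<longlonglongrightarrow> 0"
        by (rule Lim_null_comparison[OF _ LIMSEQ_inverse_real_of_nat]) (use \<phi>(3) in auto)
      from tendsto_add[OF this hl[OF that]] show ?thesis by simp
    qed
    have \<phi>b: "\<bar>\<phi> m x\<bar> \<le> real n + 1" for m x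
      using \<phi>(3)[of m x] hb[of m x] le_imp_inverse_le[of 1 "real (Suc m)"] by simp
    have \<phi>m[measurable]: "\<phi> m \<in> borel_measurable lebesgue" for m
      using continuous_borel_lebesgue[OF test_functions_deriv_continuous(1)[OF \<phi>(1)]] .
    have AEN: "AE x in lebesgue. x \<notin> N"
      using N by (simp add: negligible_iff_null_sets AE_not_in)
    let ?I = "indicat_real (cball 0 (real n + 2)) :: 'a \<Rightarrow> real"
    have I1: "integrable lebesgue (\<lambda>x. (real n + 1) * norm (?I x *\<^sub>R w x))"
      using w compact_cball[of "0::'a" "real n + 2"]
      by (intro integrable_mult_right integrable_norm) (auto simp: locally_integrable_def set_integrable_def)
    have I2: "integrable lebesgue (\<lambda>x. (real n + 1)\<^sup>2 * norm (?I x *\<^sub>R (1::real)))"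
    proof -
      have "set_integrable lebesgue (cball (0::'a) (real n + 2)) (\<lambda>x. 1 :: real)"
        using locally_integrable_const compact_cball unfolding locally_integrable_def by blast
      then show ?thesis
        unfolding set_integrable_def by (intro integrable_mult_right integrable_norm)
    qed
    have bd1: "norm (w x * \<phi> m x) \<le> (real n + 1) * norm (?I x *\<^sub>R w x)" for m x
      using \<phi>b[of m x] \<phi>(2)[of x m] by (cases "norm x \<le> real n + 2")
        (auto simp: abs_mult mult.commute[of "\<bar>w x\<bar>"] intro: mult_right_mono)
    have bd2: "norm ((\<phi> m x)\<^sup>2) \<le> (real n + 1)\<^sup>2 * norm (?I x *\<^sub>R (1::real))" for m x
      using \<phi>b[of m x] \<phi>(2)[of x m] power_mono[of "\<bar>\<phi> m x\<bar>" "real n + 1" 2] 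
      by (cases "norm x \<le> real n + 2") auto
    have L1: "(\<lambda>m. \<integral>x. w x * \<phi> m x \<partial>lebesgue) \<longlonglongrightarrow> (\<integral>x. w x * \<psi> n x \<partial>lebesgue)"
    proof (rule integral_dominated_convergence[OF _ _ I1])
      show "AE x in lebesgue. (\<lambda>m. w x * \<phi> m x) \<longlonglongrightarrow> w x * \<psi> n x"
        using AEN by eventually_elim (intro tendsto_intros \<phi>l)
    qed (use bd1 in auto)
    have L2: "(\<lambda>m. \<integral>x. (\<phi> m x)\<^sup>2 \<partial>lebesgue) \<longlonglongrightarrow> (\<integral>x. (\<psi> n x)\<^sup>2 \<partial>lebesgue)"
    proof (rule integral_dominated_convergence[OF _ _ I2])
      show "AE x in lebesgue. (\<lambda>m. (\<phi> m x)\<^sup>2) \<longlonglongrightarrow> (\<psi> n x)\<^sup>2"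
        using AEN by eventually_elim (intro tendsto_intros \<phi>l)
    qed (use bd2 in auto)
    define a where "a = (\<integral>x. (\<psi> n x)\<^sup>2 \<partial>lebesgue)"
    have "\<bar>\<integral>x. w x * \<psi> n x \<partial>lebesgue\<bar> \<le> A * sqrt a"
      unfolding a_def
      by (rule LIMSEQ_le[OF tendsto_rabs[OF L1] tendsto_mult_left[OF tendsto_real_sqrt[OF L2]]])
        (use bound \<phi>(1) in blast)
    \<comment> \<open>\<open>\<psi> n x\<close> is either \<open>w x\<close> or 0, so pairing it
      with w produces its own square.\<close>
    also have "(\<lambda>x. w x * \<psi> n x) = (\<lambda>x. (\<psi> n x)\<^sup>2)"
      by (auto simp: \<psi>_def power2_eq_square)
    finally have le: "\<bar>a\<bar> \<le> A * sqrt a" unfolding a_def .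
    have a0: "a \<ge> 0" unfolding a_def by simp
    have "a \<le> A\<^sup>2"
    proof (cases "a = 0")
      case False
      then have "sqrt a > 0" using a0 by simp
      moreover have "sqrt a * sqrt a \<le> A * sqrt a" using le a0 by simp
      ultimately have "sqrt a \<le> A" by (meson mult_right_le_imp_le)
      then show ?thesis by (rule sqrt_le_D)
    qed simp
    have "integrable lebesgue (\<lambda>x. (\<psi> n x)\<^sup>2)"
    proof (rule Bochner_Integration.integrable_bound[OF I2])
      show "AE x in lebesgue. norm ((\<psi> n x)\<^sup>2) \<le> norm ((real n + 1)\<^sup>2 * norm (?I x *\<^sub>R (1::real)))"
      proof (intro AE_I2)
        fix x
        show "norm ((\<psi> n x)\<^sup>2) \<le> norm ((real n + 1)\<^sup>2 * norm (?I x *\<^sub>R (1::real)))"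
          using \<psi>b[of n x] \<psi>s[of n x] power_mono[of "\<bar>\<psi> n x\<bar>" "real n + 1" 2] 
          by (cases "norm x \<le> real n") auto
      qed
    qed auto
    then have "(\<integral>\<^sup>+x. ennreal ((\<psi> n x)\<^sup>2) \<partial>lebesgue) = ennreal a"
      unfolding a_def by (rule nn_integral_eq_integral) simp
    then show ?thesis using \<open>a \<le> A\<^sup>2\<close> by (simp add: ennreal_leI)
  qed
  have lim: "(\<lambda>n. ennreal ((\<psi> n x)\<^sup>2)) \<longlonglongrightarrow> ennreal ((w x)\<^sup>2)" for x
  proof -
    obtain N where N: "max \<bar>w x\<bar> (norm x) \<le> real N" using real_arch_simple by blast
    have "\<forall>\<^sub>F n in sequentially. ennreal ((w x)\<^sup>2) = ennreal ((\<psi> n x)\<^sup>2)"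
      using eventually_ge_at_top[of N] by eventually_elim (use N in \<open>auto simp: \<psi>_def\<close>)
    then show ?thesis by (rule Lim_transform_eventually[OF tendsto_const])
  qed
  have "(\<integral>\<^sup>+x. ennreal ((w x)\<^sup>2) \<partial>lebesgue) = (\<integral>\<^sup>+x. liminf (\<lambda>n. ennreal ((\<psi> n x)\<^sup>2)) \<partial>lebesgue)"
    using lim_imp_Liminf[OF _ lim] by simp
  also have "\<dots> \<le> liminf (\<lambda>n. \<integral>\<^sup>+x. ennreal ((\<psi> n x)\<^sup>2) \<partial>lebesgue)"
    by (rule nn_integral_liminf) measurable
  also have "\<dots> \<le> ennreal (A\<^sup>2)"
    using Liminf_mono[OF always_eventually[OF allI[OF key]], of sequentially] by (simp add: Liminf_const)
  finally show ?thesis .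
qed

lemma integral_Cauchy_Schwarz:
  fixes f g :: "'a \<Rightarrow> real"
  assumes [measurable]: "f \<in> borel_measurable M" "g \<in> borel_measurable M"
    and f: "integrable M (\<lambda>x. (f x)\<^sup>2)" and g: "integrable M (\<lambda>x. (g x)\<^sup>2)"
  shows "integrable M (\<lambda>x. f x * g x)"
    "\<bar>\<integral>x. f x * g x \<partial>M\<bar> \<le> sqrt (\<integral>x. (f x)\<^sup>2 \<partial>M) * sqrt (\<integral>x. (g x)\<^sup>2 \<partial>M)"
proof -
  show fg: "integrable M (\<lambda>x. f x * g x)"
  proof (rule Bochner_Integration.integrable_bound)
    show "integrable M (\<lambda>x. (f x)\<^sup>2 + (g x)\<^sup>2)" using f g by simp
    show "AE x in M. norm (f x * g x) \<le> norm ((f x)\<^sup>2 + (g x)\<^sup>2)"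
    proof (intro AE_I2)
      fix x
      have "2 * \<bar>f x * g x\<bar> \<le> (f x)\<^sup>2 + (g x)\<^sup>2"
        using sum_squares_bound[of "\<bar>f x\<bar>" "\<bar>g x\<bar>"] by (simp add: abs_mult)
      then show "norm (f x * g x) \<le> norm ((f x)\<^sup>2 + (g x)\<^sup>2)" by simp
    qed
  qed measurable
  define a b c where "a = (\<integral>x. (f x)\<^sup>2 \<partial>M)" "b = (\<integral>x. f x * g x \<partial>M)" "c = (\<integral>x. (g x)\<^sup>2 \<partial>M)"
  have q: "0 \<le> a + 2 * t * b + t\<^sup>2 * c" for t
  proof -
    have "0 \<le> (\<integral>x. (f x + t * g x)\<^sup>2 \<partial>M)" by simp
    also have "(\<lambda>x. (f x + t * g x)\<^sup>2) = (\<lambda>x. (f x)\<^sup>2 + 2 * t * (f x * g x) + t\<^sup>2 * (g x)\<^sup>2)"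
      by (simp add: power2_eq_square algebra_simps)
    finally show ?thesis using f g fg by (simp add: a_b_c_def)
  qed
  have c0: "c \<ge> 0" and a0: "a \<ge> 0" by (simp_all add: a_b_c_def)
  have "b\<^sup>2 \<le> a * c"
  proof (cases "c = 0")
    case True
    have "b = 0"
    proof (rule ccontr)
      assume "b \<noteq> 0"
      \<comment> \<open>For c = 0 the quadratic is affine in t, and this t gives it the value
        -1.\<close>
      then show False using q[of "- (a + 1) / (2 * b)"] True by (simp add: field_simps)
    qed
    then show ?thesis using True by simp
  next
    case False
    \<comment> \<open>The quadratic is smallest at t = - b / c.\<close>
    then have "0 \<le> (a - b\<^sup>2 / c) * c"
      using q[of "- b / c"] c0 by (intro mult_nonneg_nonneg) (auto simp: power2_eq_square field_simps)
    also have "(a - b\<^sup>2 / c) * c = a * c - b\<^sup>2" using False by (simp add: left_diff_distrib)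
    finally show ?thesis by simp
  qed
  then have "\<bar>b\<bar> \<le> sqrt (a * c)"
    by (simp add: real_le_rsqrt)
  then show "\<bar>\<integral>x. f x * g x \<partial>M\<bar> \<le> sqrt (\<integral>x. (f x)\<^sup>2 \<partial>M) * sqrt (\<integral>x. (g x)\<^sup>2 \<partial>M)"
    by (simp add: a_b_c_def real_sqrt_mult)
qed

subsection \<open>Weak gradients and translations\<close>

lemma locally_integrable_diff:
  "locally_integrable u \<Longrightarrow> locally_integrable v \<Longrightarrow> locally_integrable (\<lambda>x. u x - v x)"
  unfolding locally_integrable_def by (auto intro: set_integral_diff(1))

lemma locally_integrable_scaleR:
  "locally_integrable u \<Longrightarrow> locally_integrable (\<lambda>x. c *\<^sub>R u x)"
  unfolding locally_integrable_def set_integrable_def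
  by (subst scaleR_left_commute, intro allI impI integrable_scaleR_right) simp

lemma locally_integrable_inner:
  assumes "locally_integrable u" shows "locally_integrable (\<lambda>x. u x \<bullet> b)"
  unfolding locally_integrable_def set_integrable_def
proof (intro allI impI)
  fix K :: "'a set" assume "compact K"
  then have "integrable lebesgue (\<lambda>x. (indicat_real K x *\<^sub>R u x) \<bullet> b)"
    using assms by (intro integrable_inner_left) (auto simp: locally_integrable_def set_integrable_def)
  then show "integrable lebesgue (\<lambda>x. indicat_real K x *\<^sub>R (u x \<bullet> b))" by simp
qed

lemma locally_integrable_AE:
  assumes u: "locally_integrable u" and m: "v \<in> borel_measurable lebesgue" and ae: "AE x in lebesgue. u x = v x"
  shows "locally_integrable v"
  unfolding locally_integrable_def set_integrable_def
proof (intro allI impI)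
  fix K :: "'a set" assume K: "compact K"
  have Km: "K \<in> sets lebesgue" using K by (simp add: lmeasurable_compact fmeasurableD)
  have "integrable lebesgue (\<lambda>x. indicat_real K x *\<^sub>R u x)"
    using u K by (auto simp: locally_integrable_def set_integrable_def)
  then show "integrable lebesgue (\<lambda>x. indicat_real K x *\<^sub>R v x)"
    by (rule integrable_cong_AE_imp) (use ae m Km in auto)
qed

lemma has_weak_gradient_AE:
  assumes "has_weak_gradient u g" "v \<in> borel_measurable lebesgue" "AE x in lebesgue. u x = v x"
  shows "has_weak_gradient v g"
proof -
  have l2: "locally_integrable u" using assms(1) by (simp add: has_weak_gradient_def)
  note l = locally_integrable_AE[OF l2 assms(2,3)] l2
  have "(\<integral>x. v x * dir_deriv b \<phi> x \<partial>lebesgue) = (\<integral>x. u x * dir_deriv b \<phi> x \<partial>lebesgue)" 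
    if "\<phi> \<in> test_functions UNIV" "b \<in> Basis" for \<phi> b
    by (rule integral_cong_AE)
      (use assms(3) borel_measurable_integrable[OF integrable_mult_test_deriv[OF l(1) that]] 
        borel_measurable_integrable[OF integrable_mult_test_deriv[OF l(2) that]] in auto)
  then show ?thesis using assms(1) l by (simp add: has_weak_gradient_def)
qed

text \<open>Each component of the difference of two weak gradients satisfies the bound of
  \<open>L2_duality\<close> with A = 0. This makes \<open>D12_norm\<close>, which is defined through
  \<open>SOME\<close>, computable from any weak gradient at hand.\<close>

lemma weak_gradient_unique:
  fixes u :: "'a::euclidean_space \<Rightarrow> real"
  assumes g: "has_weak_gradient u g" and h: "has_weak_gradient u h"
  shows "AE x in lebesgue. g x = h x"
proof -
  have "AE x in lebesgue. (g x - h x) \<bullet> b = 0" if b: "b \<in> Basis" for b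
  proof -
    have lg: "locally_integrable (\<lambda>x. g x \<bullet> b)" and lh: "locally_integrable (\<lambda>x. h x \<bullet> b)"
      using g h by (auto simp: has_weak_gradient_def intro: locally_integrable_inner)
    have lw: "locally_integrable (\<lambda>x. (g x - h x) \<bullet> b)"
      using locally_integrable_diff[OF lg lh] by (simp add: inner_diff_left)
    have "(\<integral>\<^sup>+x. ennreal (((g x - h x) \<bullet> b)\<^sup>2) \<partial>lebesgue) \<le> ennreal (0\<^sup>2)"
    proof (rule L2_duality[OF lw order_refl])
      fix \<psi> :: "'a \<Rightarrow> real" assume \<psi>: "\<psi> \<in> test_functions UNIV"
      have "(\<integral>x. ((g x - h x) \<bullet> b) * \<psi> x \<partial>lebesgue) = 
          (\<integral>x. (g x \<bullet> b) * \<psi> x \<partial>lebesgue) - (\<integral>x. (h x \<bullet> b) * \<psi> x \<partial>lebesgue)"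
        using integrable_mult_test[OF lg \<psi>] integrable_mult_test[OF lh \<psi>]
        by (simp add: inner_diff_left left_diff_distrib)
      also have "\<dots> = 0"
        using g h \<psi> b by (simp add: has_weak_gradient_def)
      finally show "\<bar>\<integral>x. ((g x - h x) \<bullet> b) * \<psi> x \<partial>lebesgue\<bar> \<le> 0 * sqrt (\<integral>x. (\<psi> x)\<^sup>2 \<partial>lebesgue)"
        by simp
    qed
    then have "(\<integral>\<^sup>+x. ennreal (((g x - h x) \<bullet> b)\<^sup>2) \<partial>lebesgue) = 0" by simp
    then have "AE x in lebesgue. ennreal (((g x - h x) \<bullet> b)\<^sup>2) = 0"
      using locally_integrable_borel_measurable[OF lw] by (subst (asm) nn_integral_0_iff_AE) auto
    then show ?thesis by eventually_elim (simp add: ennreal_eq_0_iff)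
  qed
  then have "AE x in lebesgue. \<forall>b\<in>Basis. (g x - h x) \<bullet> b = 0"
    by (intro AE_finite_allI) auto
  then show ?thesis
    by eventually_elim (auto simp: euclidean_eq_iff[where 'a='a] inner_diff_left)
qed

lemma has_weak_gradient_weak_gradient:
  assumes "has_weak_gradient u g"
  shows "has_weak_gradient u (weak_gradient u)" 
    "AE x in lebesgue. weak_gradient u x = g x"
proof -
  show 1: "has_weak_gradient u (weak_gradient u)"
    unfolding weak_gradient_def by (rule someI[of _ g]) (rule assms)
  show "AE x in lebesgue. weak_gradient u x = g x"
    using weak_gradient_unique[OF 1 assms] .
qed

lemma D12_norm_eq:
  assumes "has_weak_gradient u g"
  shows "(D12_norm u)\<^sup>2 = (\<integral>x. (norm (g x))\<^sup>2 \<partial>lebesgue)"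
proof -
  note w = has_weak_gradient_weak_gradient[OF assms]
  have m: "weak_gradient u \<in> borel_measurable lebesgue" "g \<in> borel_measurable lebesgue"
    using w(1) assms by (auto simp: has_weak_gradient_def intro: locally_integrable_borel_measurable)
  have "(\<integral>x. (norm (weak_gradient u x))\<^sup>2 \<partial>lebesgue) = (\<integral>x. (norm (g x))\<^sup>2 \<partial>lebesgue)"
    using w(2) m by (intro integral_cong_AE) auto
  then show ?thesis by (simp add: D12_norm_def)
qed

lemma D12_norm_nonneg: "D12_norm u \<ge> 0"
  by (simp add: D12_norm_def)

lemma has_weak_gradient_scale:
  assumes "has_weak_gradient u g"
  shows "has_weak_gradient (\<lambda>x. c * u x) (\<lambda>x. c *\<^sub>R g x)"
  using assms locally_integrable_scaleR[of u c] locally_integrable_scaleR[of g c]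
  by (auto simp: has_weak_gradient_def mult.assoc)

lemma has_weak_gradient_diff:
  assumes u: "has_weak_gradient u g" and v: "has_weak_gradient v h"
  shows "has_weak_gradient (\<lambda>x. u x - v x) (\<lambda>x. g x - h x)"
proof -
  have l: "locally_integrable u" "locally_integrable v" "locally_integrable g" "locally_integrable h"
    using u v by (auto simp: has_weak_gradient_def)
  have "(\<integral>x. (u x - v x) * dir_deriv b \<phi> x \<partial>lebesgue) = - (\<integral>x. ((g x - h x) \<bullet> b) * \<phi> x \<partial>lebesgue)"
    if t: "\<phi> \<in> test_functions UNIV" "b \<in> Basis" for \<phi> b
    using u v t integrable_mult_test_deriv[OF l(1) t] integrable_mult_test_deriv[OF l(2) t]
      integrable_mult_test[OF locally_integrable_inner[OF l(3)] t(1)]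
      integrable_mult_test[OF locally_integrable_inner[OF l(4)] t(1)]
    by (simp add: has_weak_gradient_def left_diff_distrib inner_diff_left)
  with l show ?thesis by (auto simp: has_weak_gradient_def intro: locally_integrable_diff)
qed

section \<open>Translations and the difference quotient estimate\<close>

lemma integral_lebesgue_translation:
  fixes f :: "'a::euclidean_space \<Rightarrow> real"
  assumes "f \<in> borel_measurable borel"
  shows "(\<integral>x. f (x + c) \<partial>lebesgue) = (\<integral>x. f x \<partial>lebesgue)"
proof -
  have "(\<integral>x. f x \<partial>distr lborel borel ((+) c)) = (\<integral>x. f (c + x) \<partial>lborel)"
    using assms by (intro integral_distr) auto
  then have "(\<integral>x. f (x + c) \<partial>lborel) = (\<integral>x. f x \<partial>lborel)"
    by (simp add: lborel_distr_plus add.commute)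
  with assms show ?thesis by (simp add: integral_completion)
qed

text \<open>The shift acts on \<psi>, so u may be merely locally integrable: the difference
  quotients of \<psi> are bounded by B and supported in one ball, and dominated convergence applies.
  It serves twice, for the translation estimate and, with u = 1, for integration by parts.\<close>

lemma integral_translate_deriv:
  fixes u :: "'a::euclidean_space \<Rightarrow> real"
  assumes u: "locally_integrable u"
    and D: "\<And>x. (\<psi> has_derivative D x) (at x)" and c: "continuous_on UNIV (\<lambda>x. D x \<xi>)"
    and K: "compact K" "\<And>x. x \<notin> K \<Longrightarrow> \<psi> x = 0"
  shows "((\<lambda>s. \<integral>x. u x * \<psi> (x - s *\<^sub>R \<xi>) \<partial>lebesgue) has_real_derivative 
      - (\<integral>x. u x * D (x - s *\<^sub>R \<xi>) \<xi> \<partial>lebesgue)) (at s)"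
proof -
  have \<psi>c: "continuous_on UNIV \<psi>"
    using D by (meson continuous_at_imp_continuous_on has_derivative_continuous)
  have D0: "D x \<xi> = 0" if "x \<notin> K" for x
    using dir_deriv_eq_0_outside[OF compact_imp_closed[OF K(1)] K(2) that, where b = \<xi>] frechet_derivative_at[OF D]
    by (simp add: dir_deriv_def)
  obtain B where B: "\<And>x. \<bar>D x \<xi>\<bar> \<le> B" "B \<ge> 0"
    using continuous_compact_support_bounded[OF c K(1) D0] by metis
  have line: "((\<lambda>t. \<psi> (x - t *\<^sub>R \<xi>)) has_real_derivative - D (x - t *\<^sub>R \<xi>) \<xi>) (at t)" for x t
  proof -
    have "((\<lambda>t. x - t *\<^sub>R \<xi>) has_derivative (\<lambda>h. - (h *\<^sub>R \<xi>))) (at t)"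
      by (auto intro!: derivative_eq_intros)
    from has_derivative_compose[OF this D]
    have "((\<lambda>t. \<psi> (x - t *\<^sub>R \<xi>)) has_derivative (\<lambda>h. D (x - t *\<^sub>R \<xi>) (- (h *\<^sub>R \<xi>)))) (at t)" .
    moreover have "linear (D (x - t *\<^sub>R \<xi>))" using D has_derivative_linear by blast
    then have "(\<lambda>h. D (x - t *\<^sub>R \<xi>) (- (h *\<^sub>R \<xi>))) = (*) (- D (x - t *\<^sub>R \<xi>) \<xi>)"
      by (auto simp: linear_neg linear_scale fun_eq_iff)
    ultimately show ?thesis by (simp add: has_field_derivative_def)
  qed
  have lip: "\<bar>\<psi> (x - t *\<^sub>R \<xi>) - \<psi> (x - s *\<^sub>R \<xi>)\<bar> \<le> B * \<bar>t - s\<bar>" for x t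
    using field_differentiable_bound[of UNIV "\<lambda>t. \<psi> (x - t *\<^sub>R \<xi>)" "\<lambda>t. - D (x - t *\<^sub>R \<xi>) \<xi>" B t s] line B
    by (auto intro: has_field_derivative_at_within)
  obtain r where r: "\<And>x. x \<in> K \<Longrightarrow> norm x \<le> r"
    using K(1) compact_imp_bounded bounded_iff by metis
  have "((\<lambda>h. ((\<integral>x. u x * \<psi> (x - (s + h) *\<^sub>R \<xi>) \<partial>lebesgue) - (\<integral>x. u x * \<psi> (x - s *\<^sub>R \<xi>) \<partial>lebesgue)) / h) 
      \<longlongrightarrow> - (\<integral>x. u x * D (x - s *\<^sub>R \<xi>) \<xi> \<partial>lebesgue)) (at 0)"
  proof (unfold tendsto_at_iff_sequentially, intro allI impI)
    fix X :: "nat \<Rightarrow> real" assume X0: "\<forall>i. X i \<in> UNIV - {0}" and X: "X \<longlonglongrightarrow> 0"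
    obtain H where H: "\<And>i. \<bar>X i\<bar> \<le> H"
      using X by (metis Bseq_def convergentI convergent_imp_Bseq real_norm_def)
    \<comment> \<open>Every shift \<open>s + X i\<close> is at most \<open>\<bar>s\<bar> + H\<close>
      in absolute value, so the ball of radius \<rho> contains all shifted supports.\<close>
    define \<rho> where "\<rho> = r + (\<bar>s\<bar> + H) * norm \<xi>"
    have out: "\<psi> (x - (s + t) *\<^sub>R \<xi>) = 0" if "norm x > \<rho>" "\<bar>t\<bar> \<le> H" for x t
    proof -
      have "norm ((s + t) *\<^sub>R \<xi>) \<le> (\<bar>s\<bar> + H) * norm \<xi>"
        unfolding norm_scaleR using that by (intro mult_right_mono) auto
      then have "norm (x - (s + t) *\<^sub>R \<xi>) > r"
        using that(1) norm_triangle_ineq2[of x "(s + t) *\<^sub>R \<xi>"] unfolding \<rho>_def by linarith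
      then show ?thesis using r K(2) by force
    qed
    let ?q = "\<lambda>i x. (\<psi> (x - (s + X i) *\<^sub>R \<xi>) - \<psi> (x - s *\<^sub>R \<xi>)) / X i"
    have int: "integrable lebesgue (\<lambda>x. u x * \<psi> (x - (s + t) *\<^sub>R \<xi>))" if "\<bar>t\<bar> \<le> H" for t
    proof -
      have "continuous_on UNIV (\<lambda>x. \<psi> (x - (s + t) *\<^sub>R \<xi>))"
        by (rule continuous_on_compose2[OF \<psi>c]) (auto intro!: continuous_intros)
      from locally_integrable_mult_continuous[OF u this compact_cball[of 0 \<rho>]] out that
      show ?thesis by (simp add: mult.commute)
    qed
    have H0: "H \<ge> 0" using H[of 0] by linarith
    have um: "u \<in> borel_measurable lebesgue" by (rule locally_integrable_borel_measurable[OF u])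
    have L: "(\<lambda>i. \<integral>x. u x * ?q i x \<partial>lebesgue) \<longlonglongrightarrow> (\<integral>x. u x * (- D (x - s *\<^sub>R \<xi>) \<xi>) \<partial>lebesgue)"
    proof (rule integral_dominated_convergence)
      have "continuous_on UNIV (\<lambda>x. D (x - s *\<^sub>R \<xi>) \<xi>)"
        by (rule continuous_on_compose2[OF c]) (auto intro!: continuous_intros)
      then show "(\<lambda>x. u x * (- D (x - s *\<^sub>R \<xi>) \<xi>)) \<in> borel_measurable lebesgue"
        using um continuous_borel_lebesgue by (intro borel_measurable_times borel_measurable_uminus) blast+
      show "(\<lambda>x. u x * ?q i x) \<in> borel_measurable lebesgue" for i
      proof -
        have "integrable lebesgue (\<lambda>x. (u x * \<psi> (x - (s + X i) *\<^sub>R \<xi>) - u x * \<psi> (x - (s + 0) *\<^sub>R \<xi>)) / X i)"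
          using H H0 by (intro integrable_divide_zero Bochner_Integration.integrable_diff int) auto
        then show ?thesis by (auto simp: right_diff_distrib dest: borel_measurable_integrable)
      qed
      show "integrable lebesgue (\<lambda>x. B * norm (indicat_real (cball 0 \<rho>) x *\<^sub>R u x))"
        using u compact_cball[of "0::'a" \<rho>]
        by (intro integrable_mult_right integrable_norm) (auto simp: locally_integrable_def set_integrable_def)
      show "AE x in lebesgue. (\<lambda>i. u x * ?q i x) \<longlonglongrightarrow> u x * (- D (x - s *\<^sub>R \<xi>) \<xi>)"
      proof (intro AE_I2 tendsto_intros)
        fix x
        have "((\<lambda>h. (\<psi> (x - (s + h) *\<^sub>R \<xi>) - \<psi> (x - s *\<^sub>R \<xi>)) / h) \<longlongrightarrow> - D (x - s *\<^sub>R \<xi>) \<xi>) (at 0)"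
          using line[of x s] by (simp add: DERIV_def)
        then show "(\<lambda>i. ?q i x) \<longlonglongrightarrow> - D (x - s *\<^sub>R \<xi>) \<xi>"
          using X0 X unfolding tendsto_at_iff_sequentially by (auto simp: o_def)
      qed
      show "AE x in lebesgue. norm (u x * ?q i x) \<le> B * norm (indicat_real (cball 0 \<rho>) x *\<^sub>R u x)" for i
      proof (intro AE_I2)
        fix x
        have "\<bar>?q i x\<bar> \<le> B"
          using lip[of x "s + X i"] X0 by (simp add: abs_divide divide_le_eq)
        moreover have "?q i x = 0" if "norm x > \<rho>"
          using out[OF that H[of i]] out[OF that, of 0] H0 by simp
        ultimately show "norm (u x * ?q i x) \<le> B * norm (indicat_real (cball 0 \<rho>) x *\<^sub>R u x)"
          using mult_right_mono[of "\<bar>?q i x\<bar>" B "\<bar>u x\<bar>"] 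
          by (cases "norm x > \<rho>") (auto simp: abs_mult mult.commute[of "\<bar>u x\<bar>"])
      qed
    qed
    have E: "(\<integral>x. u x * ?q i x \<partial>lebesgue) = 
       ((\<integral>x. u x * \<psi> (x - (s + X i) *\<^sub>R \<xi>) \<partial>lebesgue) - (\<integral>x. u x * \<psi> (x - s *\<^sub>R \<xi>) \<partial>lebesgue)) / X i" for i
    proof -
      have "(\<integral>x. u x * ?q i x \<partial>lebesgue) = 
          (\<integral>x. (u x * \<psi> (x - (s + X i) *\<^sub>R \<xi>) - u x * \<psi> (x - (s + 0) *\<^sub>R \<xi>)) / X i \<partial>lebesgue)"
        by (simp add: right_diff_distrib)
      also have "\<dots> = ((\<integral>x. u x * \<psi> (x - (s + X i) *\<^sub>R \<xi>) \<partial>lebesgue) - (\<integral>x. u x * \<psi> (x - (s + 0) *\<^sub>R \<xi>) \<partial>lebesgue)) / X i"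
        using int[OF H[of i]] int[of 0] H0 by (subst integral_divide_zero, subst Bochner_Integration.integral_diff) auto
      finally show ?thesis by simp
    qed
    show "((\<lambda>h. ((\<integral>x. u x * \<psi> (x - (s + h) *\<^sub>R \<xi>) \<partial>lebesgue) - (\<integral>x. u x * \<psi> (x - s *\<^sub>R \<xi>) \<partial>lebesgue)) / h) \<circ> X) 
        \<longlonglongrightarrow> - (\<integral>x. u x * D (x - s *\<^sub>R \<xi>) \<xi> \<partial>lebesgue)"
      using L unfolding E by (simp add: o_def)
  qed
  then show ?thesis by (simp add: DERIV_def)
qed

lemma foldr_dir_deriv_translate:
  assumes "smooth \<psi>" "set bs \<subseteq> Basis"
  shows "foldr dir_deriv bs (\<lambda>x. \<psi> (x - c)) = (\<lambda>x. foldr dir_deriv bs \<psi> (x - c))"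
  using assms(2)
proof (induction bs)
  case (Cons b bs)
  let ?\<phi> = "foldr dir_deriv bs \<psi>"
  have "?\<phi> differentiable at y" for y
    using assms(1) Cons.prems by (auto simp: smooth_def differentiable_on_def)
  then have D: "(?\<phi> has_derivative frechet_derivative ?\<phi> (at y)) (at y)" for y
    by (simp add: frechet_derivative_works)
  have "((\<lambda>x. ?\<phi> (x - c)) has_derivative frechet_derivative ?\<phi> (at (x - c))) (at x)" for x
  proof -
    have "((\<lambda>x. x - c) has_derivative (\<lambda>h. h)) (at x)"
      by (auto intro!: derivative_eq_intros)
    from has_derivative_compose[OF this D] show ?thesis .
  qed
  from frechet_derivative_at[OF this] 
  have "dir_deriv b (\<lambda>x. ?\<phi> (x - c)) = (\<lambda>x. dir_deriv b ?\<phi> (x - c))"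
    by (simp add: dir_deriv_def fun_eq_iff)
  then show ?case using Cons by simp
qed simp

lemma test_functions_translate:
  assumes "\<psi> \<in> test_functions UNIV"
  shows "(\<lambda>x. \<psi> (x - c)) \<in> test_functions UNIV"
proof -
  have sm: "smooth \<psi>" using assms by (simp add: test_functions_def)
  obtain K where K: "compact K" "\<And>x. x \<notin> K \<Longrightarrow> \<psi> x = 0" 
    using test_functions_support[OF assms] by metis
  have "smooth (\<lambda>x. \<psi> (x - c))"
    unfolding smooth_def
  proof (intro allI impI)
    fix bs :: "'a list" assume bs: "set bs \<subseteq> Basis"
    have "foldr dir_deriv bs \<psi> differentiable at (x - c)" for x
      using sm bs by (simp add: smooth_def differentiable_on_def)
    then have "(\<lambda>x. foldr dir_deriv bs \<psi> (x - c)) differentiable at x" for x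
      using differentiable_chain_at[of "\<lambda>x. x - c" x "foldr dir_deriv bs \<psi>"] by (simp add: o_def)
    then show "foldr dir_deriv bs (\<lambda>x. \<psi> (x - c)) differentiable_on UNIV"
      by (simp add: foldr_dir_deriv_translate[OF sm bs] differentiable_on_def differentiable_at_withinI)
  qed
  then show ?thesis
  proof (rule test_functionsI)
    show "compact ((+) c ` K)" using K(1) by (rule compact_translation)
    show "\<psi> (x - c) = 0" if "x \<notin> (+) c ` K" for x
      using that K(2)[of "x - c"] by (metis add.commute diff_add_cancel image_eqI)
  qed simp
qed

lemma dir_deriv_translate:
  assumes "\<psi> \<in> test_functions UNIV" "b \<in> Basis"
  shows "dir_deriv b (\<lambda>x. \<psi> (x - c)) x = dir_deriv b \<psi> (x - c)"
  using foldr_dir_deriv_translate[of \<psi> "[b]" c] assms by (simp add: test_functions_def fun_eq_iff)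

lemma locally_integrable_translate:
  fixes u :: "'a::euclidean_space \<Rightarrow> real"
  assumes [measurable]: "u \<in> borel_measurable borel" and u: "locally_integrable u"
  shows "locally_integrable (\<lambda>x. u (x + c))"
  unfolding locally_integrable_def set_integrable_def
proof (intro allI impI)
  fix K :: "'a set" assume K: "compact K"
  let ?K = "(+) c ` K"
  have cK: "compact ?K" using K by (rule compact_translation)
  have [measurable]: "K \<in> sets borel" "?K \<in> sets borel"
    using K cK by (auto intro: borel_compact)
  let ?f = "\<lambda>x. indicat_real ?K x *\<^sub>R u x"
  have "integrable lebesgue ?f"
    using u cK by (auto simp: locally_integrable_def set_integrable_def)
  then have "integrable lborel ?f" by (subst (asm) integrable_completion) auto
  then have "integrable (distr lborel borel ((+) c)) ?f" by (simp add: lborel_distr_plus)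
  then have "integrable lborel (\<lambda>x. ?f (c + x))" by (subst (asm) integrable_distr_eq) auto
  moreover have "?f (c + x) = indicat_real K x *\<^sub>R u (x + c)" for x
    by (auto simp: indicator_def add.commute)
  ultimately show "integrable lebesgue (\<lambda>x. indicat_real K x *\<^sub>R u (x + c))"
    by (subst integrable_completion) auto
qed

text \<open>By duality the difference is tested with \<psi>. The function \<open>G s\<close>, the
  integral of u times \<psi> shifted by \<open>s *\<^sub>R \<xi>\<close>, interpolates between the
  pairings of \<psi> with u and with the translate of u. Its derivative is the pairing of
  \<open>g x \<bullet> \<xi>\<close> with the shifted \<psi>, which Cauchy-Schwarz bounds uniformly
  in s.\<close>

lemma translation_estimate:
  fixes u :: "'a::euclidean_space \<Rightarrow> real"
  assumes um[measurable]: "u \<in> borel_measurable borel" and g: "has_weak_gradient u g"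
    and gi: "integrable lebesgue (\<lambda>x. (norm (g x))\<^sup>2)"
  shows "(\<integral>\<^sup>+x. ennreal ((u (x + \<xi>) - u x)\<^sup>2) \<partial>lborel)
      \<le> ennreal ((norm \<xi>)\<^sup>2 * (\<integral>x. (norm (g x))\<^sup>2 \<partial>lebesgue))"
proof -
  define k where "k = (\<integral>x. (norm (g x))\<^sup>2 \<partial>lebesgue)"
  have k0: "k \<ge> 0" by (simp add: k_def)
  have ul: "locally_integrable u" and gl: "locally_integrable g" using g by (auto simp: has_weak_gradient_def)
  have gm[measurable]: "g \<in> borel_measurable lebesgue" by (rule locally_integrable_borel_measurable[OF gl])
  note ul' = locally_integrable_translate[OF um ul, of \<xi>]
  have wl: "locally_integrable (\<lambda>x. u (x + \<xi>) - u x)" by (intro locally_integrable_diff ul ul')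
  have gle: "(g x \<bullet> \<xi>)\<^sup>2 \<le> (norm \<xi>)\<^sup>2 * (norm (g x))\<^sup>2" for x
    using Cauchy_Schwarz_ineq[of "g x" \<xi>] by (simp add: dot_square_norm mult.commute)
  have gxi: "integrable lebesgue (\<lambda>x. (g x \<bullet> \<xi>)\<^sup>2)"
    by (rule Bochner_Integration.integrable_bound[OF integrable_mult_right[OF gi, of "(norm \<xi>)\<^sup>2"]])
      (use gle in auto)
  have gxk: "(\<integral>x. (g x \<bullet> \<xi>)\<^sup>2 \<partial>lebesgue) \<le> (norm \<xi>)\<^sup>2 * k"
    using integral_mono[OF gxi integrable_mult_right[OF gi, of "(norm \<xi>)\<^sup>2"] gle] by (simp add: k_def)
  have "(\<integral>\<^sup>+x. ennreal ((u (x + \<xi>) - u x)\<^sup>2) \<partial>lebesgue) \<le> ennreal ((norm \<xi> * sqrt k)\<^sup>2)"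
  proof (rule L2_duality[OF wl])
    fix \<psi> :: "'a \<Rightarrow> real" assume \<psi>: "\<psi> \<in> test_functions UNIV"
    obtain K where K: "compact K" "\<And>x. x \<notin> K \<Longrightarrow> \<psi> x = 0" 
      using test_functions_support[OF \<psi>] by metis
    have \<psi>c: "continuous_on UNIV \<psi>" by (rule test_functions_deriv_continuous[OF \<psi>])
    have [measurable]: "\<psi> \<in> borel_measurable borel" using \<psi>c by (rule borel_measurable_continuous_onI)
    define D where "D x = frechet_derivative \<psi> (at x)" for x
    have D: "(\<psi> has_derivative D x) (at x)" for x
      using test_functions_deriv_continuous(2)[OF \<psi>] by (simp add: D_def frechet_derivative_works)
    have D\<xi>: "D x \<xi> = (\<Sum>b\<in>Basis. (\<xi> \<bullet> b) * dir_deriv b \<psi> x)" for x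
      unfolding D_def by (rule dir_deriv_sum_Basis[OF test_functions_deriv_continuous(2)[OF \<psi>]])
    have Dc: "continuous_on UNIV (\<lambda>x. D x \<xi>)"
      unfolding D\<xi> by (intro continuous_intros test_functions_deriv_continuous(3)[OF \<psi>])
    define \<psi>' where "\<psi>' s x = \<psi> (x - s *\<^sub>R \<xi>)" for s x
    have t': "\<psi>' s \<in> test_functions UNIV" for s
      using test_functions_translate[OF \<psi>] unfolding \<psi>'_def by blast
    have P: "(\<integral>x. u x * D (x - s *\<^sub>R \<xi>) \<xi> \<partial>lebesgue) = - (\<integral>x. (g x \<bullet> \<xi>) * \<psi>' s x \<partial>lebesgue)" for s
    proof -
      have "(\<integral>x. u x * D (x - s *\<^sub>R \<xi>) \<xi> \<partial>lebesgue) = 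
          (\<integral>x. (\<Sum>b\<in>Basis. (\<xi> \<bullet> b) * (u x * dir_deriv b (\<psi>' s) x)) \<partial>lebesgue)"
        unfolding D\<xi> \<psi>'_def
        by (intro Bochner_Integration.integral_cong refl)
           (simp add: dir_deriv_translate[OF \<psi>] sum_distrib_left mult.left_commute)
      also have "\<dots> = (\<Sum>b\<in>Basis. (\<xi> \<bullet> b) * (\<integral>x. u x * dir_deriv b (\<psi>' s) x \<partial>lebesgue))"
        using integrable_mult_test_deriv[OF ul t'] by (subst Bochner_Integration.integral_sum) auto
      also have "\<dots> = (\<Sum>b\<in>Basis. (\<xi> \<bullet> b) * - (\<integral>x. (g x \<bullet> b) * \<psi>' s x \<partial>lebesgue))"
        using g t' by (intro sum.cong refl) (simp add: has_weak_gradient_def)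
      also have "\<dots> = - (\<integral>x. (\<Sum>b\<in>Basis. (\<xi> \<bullet> b) * ((g x \<bullet> b) * \<psi>' s x)) \<partial>lebesgue)"
        using integrable_mult_test[OF locally_integrable_inner[OF gl] t'] 
        by (subst Bochner_Integration.integral_sum) (auto simp: sum_negf)
      also have "(\<lambda>x. (\<Sum>b\<in>Basis. (\<xi> \<bullet> b) * ((g x \<bullet> b) * \<psi>' s x))) = (\<lambda>x. (g x \<bullet> \<xi>) * \<psi>' s x)"
        by (simp add: fun_eq_iff euclidean_inner[of _ \<xi>] sum_distrib_left sum_distrib_right mult_ac)
      finally show ?thesis .
    qed
    define G where "G s = (\<integral>x. u x * \<psi>' s x \<partial>lebesgue)" for s
    have G: "(G has_real_derivative (\<integral>x. (g x \<bullet> \<xi>) * \<psi>' s x \<partial>lebesgue)) (at s)" for s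
      using integral_translate_deriv[OF ul D Dc K, of s] P[of s] unfolding G_def \<psi>'_def by simp
    define b where "b = norm \<xi> * sqrt k * sqrt (\<integral>x. (\<psi> x)\<^sup>2 \<partial>lebesgue)"
    have bnd: "norm (\<integral>x. (g x \<bullet> \<xi>) * \<psi>' s x \<partial>lebesgue) \<le> b" for s
    proof -
      have [measurable]: "\<psi>' s \<in> borel_measurable lebesgue"
        by (rule continuous_borel_lebesgue[OF test_functions_deriv_continuous(1)[OF t']])
      have "integrable lebesgue (\<lambda>x. \<psi>' s x * \<psi>' s x)"
        using integrable_mult_test[OF locally_integrable_continuous t'] test_functions_deriv_continuous(1)[OF t'] by blast
      then have "\<bar>\<integral>x. (g x \<bullet> \<xi>) * \<psi>' s x \<partial>lebesgue\<bar> \<le> 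
          sqrt (\<integral>x. (g x \<bullet> \<xi>)\<^sup>2 \<partial>lebesgue) * sqrt (\<integral>x. (\<psi>' s x)\<^sup>2 \<partial>lebesgue)"
        by (intro integral_Cauchy_Schwarz gxi) (auto simp: power2_eq_square)
      also have "(\<integral>x. (\<psi>' s x)\<^sup>2 \<partial>lebesgue) = (\<integral>x. (\<psi> x)\<^sup>2 \<partial>lebesgue)"
        using integral_lebesgue_translation[of "\<lambda>x. (\<psi> x)\<^sup>2" "- (s *\<^sub>R \<xi>)"] by (simp add: \<psi>'_def)
      also have "sqrt (\<integral>x. (g x \<bullet> \<xi>)\<^sup>2 \<partial>lebesgue) \<le> norm \<xi> * sqrt k"
        using real_sqrt_le_mono[OF gxk] by (simp add: real_sqrt_mult)
      finally show ?thesis unfolding b_def by (simp add: mult_right_mono)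
    qed
    have "norm (G 1 - G 0) \<le> b * norm (1 - 0 :: real)"
      by (rule field_differentiable_bound[of UNIV G]) 
        (use G bnd in \<open>auto intro: has_field_derivative_at_within\<close>)
    moreover have "G 1 = (\<integral>x. u (x + \<xi>) * \<psi> x \<partial>lebesgue)"
      using integral_lebesgue_translation[of "\<lambda>x. u x * \<psi> (x - \<xi>)" \<xi>] by (simp add: G_def \<psi>'_def)
    moreover have "(\<integral>x. (u (x + \<xi>) - u x) * \<psi> x \<partial>lebesgue) = (\<integral>x. u (x + \<xi>) * \<psi> x \<partial>lebesgue) - G 0"
      using integrable_mult_test[OF ul \<psi>] integrable_mult_test[OF ul' \<psi>]
      by (simp add: G_def \<psi>'_def left_diff_distrib)
    ultimately show "\<bar>\<integral>x. (u (x + \<xi>) - u x) * \<psi> x \<partial>lebesgue\<bar> 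
        \<le> norm \<xi> * sqrt k * sqrt (\<integral>x. (\<psi> x)\<^sup>2 \<partial>lebesgue)"
      by (simp add: b_def)
  qed (use k0 in auto)
  then show ?thesis
    using k0 by (simp add: nn_integral_completion power_mult_distrib k_def)
qed

subsection \<open>Level sets and the weak Sobolev inequality\<close>

lemma emeasure_lborel_translate:
  fixes S :: "'a::euclidean_space set"
  assumes "S \<in> sets borel"
  shows "emeasure lborel {\<xi>. x + \<xi> \<in> S} = emeasure lborel S"
proof -
  have "emeasure lborel S = emeasure (distr lborel borel ((+) x)) S"
    by (simp add: lborel_distr_plus)
  also have "\<dots> = emeasure lborel {\<xi>. x + \<xi> \<in> S}"
    using assms by (subst emeasure_distr) (auto simp: vimage_def)
  finally show ?thesis by simp
qed

lemma ennreal_le_divideI: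
  assumes "x * ennreal c \<le> ennreal d" "c > 0" "d \<ge> 0"
  shows "x \<le> ennreal (d / c)"
proof (cases x)
  case (real r)
  then have "r * c \<le> d" using assms by (simp add: ennreal_mult[symmetric])
  then show ?thesis using assms real by (simp add: pos_le_divide_eq ennreal_leI)
next
  case top
  then show ?thesis using assms by (simp add: ennreal_top_mult top_unique)
qed

text \<open>If |u x| > t, then at least half of the ball about x has |u| <= t/2, and there the
  difference to u x is at least t/2. The integral of the squared difference over x and |\<xi>| < h
  is therefore at least (t^2/4) (V/2) times the measure of the level set, and at most h^2 k V; the
  quotient of the two gives the factor 8.\<close>

lemma level_set_bound:
  fixes u :: "'a::euclidean_space \<Rightarrow> real"
  assumes um[measurable]: "u \<in> borel_measurable borel"
    and tr: "\<And>\<xi>. (\<integral>\<^sup>+x. ennreal ((u (x + \<xi>) - u x)\<^sup>2) \<partial>lborel) \<le> ennreal ((norm \<xi>)\<^sup>2 * k)"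
    and k: "k \<ge> 0" and h: "h > 0" and t: "t > 0"
    and half: "AE x in lborel. \<bar>u x\<bar> > t \<longrightarrow> 
      emeasure lborel (ball x h \<inter> {y. \<bar>u y\<bar> > t / 2}) \<le> ennreal (measure lborel (ball (0::'a) h) / 2)"
  shows "emeasure lborel {x. \<bar>u x\<bar> > t} \<le> ennreal (8 * h\<^sup>2 * k / t\<^sup>2)"
proof -
  define V where "V = measure lborel (ball (0::'a) h)"
  have V: "V > 0" unfolding V_def using h by (simp add: content_ball_pos)
  have Vx: "emeasure lborel (ball x h) = ennreal V" for x :: 'a
    using h by (simp add: V_def emeasure_ball content_ball)
  let ?F = "\<lambda>x \<xi>. ennreal ((u (x + \<xi>) - u x)\<^sup>2) * indicator (ball 0 h) \<xi>"
  have upper: "(\<integral>\<^sup>+x. \<integral>\<^sup>+\<xi>. ?F x \<xi> \<partial>lborel \<partial>lborel) \<le> ennreal (h\<^sup>2 * k) * ennreal V"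
  proof -
    have "(\<integral>\<^sup>+x. \<integral>\<^sup>+\<xi>. ?F x \<xi> \<partial>lborel \<partial>lborel) = (\<integral>\<^sup>+\<xi>. \<integral>\<^sup>+x. ?F x \<xi> \<partial>lborel \<partial>lborel)"
    proof (rule lborel_pair.Fubini'[symmetric])
      have [measurable]: "(\<lambda>p. indicator (ball (0::'a) h) (snd p) :: ennreal) \<in> borel_measurable (borel \<Otimes>\<^sub>M borel)"
        by (rule measurable_compose[OF measurable_snd borel_measurable_indicator]) simp
      show "case_prod ?F \<in> borel_measurable (lborel \<Otimes>\<^sub>M lborel)"
        unfolding split_beta' by measurable
    qed
    also have "\<dots> \<le> (\<integral>\<^sup>+\<xi>. ennreal (h\<^sup>2 * k) * indicator (ball (0::'a) h) \<xi> \<partial>lborel)"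
    proof (rule nn_integral_mono)
      fix \<xi> :: 'a
      have "(\<integral>\<^sup>+x. ennreal ((u (x + \<xi>) - u x)\<^sup>2) \<partial>lborel) \<le> ennreal (h\<^sup>2 * k)" if "norm \<xi> < h"
        using tr[of \<xi>] that k by (rule_tac order_trans) (auto intro!: ennreal_leI mult_right_mono power_mono)
      then show "(\<integral>\<^sup>+x. ?F x \<xi> \<partial>lborel) \<le> ennreal (h\<^sup>2 * k) * indicator (ball 0 h) \<xi>"
        by (cases "\<xi> \<in> ball 0 h") auto
    qed
    also have "\<dots> = ennreal (h\<^sup>2 * k) * ennreal V"
      by (subst nn_integral_cmult_indicator) (auto simp: Vx)
    finally show ?thesis .
  qed
  have lower: "(\<integral>\<^sup>+\<xi>. ?F x \<xi> \<partial>lborel) \<ge> ennreal (t\<^sup>2 / 4) * ennreal (V / 2)"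
    if ux: "\<bar>u x\<bar> > t" and hx: "emeasure lborel (ball x h \<inter> {y. \<bar>u y\<bar> > t / 2}) \<le> ennreal (V / 2)" for x
  proof -
    let ?S = "ball x h \<inter> {y. \<bar>u y\<bar> \<le> t / 2}"
    have S: "?S \<in> sets borel" by measurable
    have "ennreal V = emeasure lborel (?S \<union> (ball x h \<inter> {y. \<bar>u y\<bar> > t / 2}))"
      by (simp add: Vx[of x, symmetric]) (rule arg_cong[of _ _ "emeasure lborel"], auto)
    also have "\<dots> = emeasure lborel ?S + emeasure lborel (ball x h \<inter> {y. \<bar>u y\<bar> > t / 2})"
      by (rule plus_emeasure[symmetric]) auto
    also have "\<dots> \<le> emeasure lborel ?S + ennreal (V / 2)"
      by (rule add_left_mono[OF hx])
    finally have "ennreal V - ennreal (V / 2) \<le> emeasure lborel ?S"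
      by (simp add: ennreal_minus_le_iff add.commute)
    then have "ennreal (V / 2) \<le> emeasure lborel ?S"
      using V by (simp add: ennreal_minus)
    then have "ennreal (t\<^sup>2 / 4) * ennreal (V / 2) \<le> ennreal (t\<^sup>2 / 4) * emeasure lborel {\<xi>. x + \<xi> \<in> ?S}"
      using emeasure_lborel_translate[OF S, of x] by (simp add: mult_left_mono)
    also have "\<dots> = (\<integral>\<^sup>+\<xi>. ennreal (t\<^sup>2 / 4) * indicator {\<xi>. x + \<xi> \<in> ?S} \<xi> \<partial>lborel)"
      by (subst nn_integral_cmult_indicator) auto
    also have "\<dots> \<le> (\<integral>\<^sup>+\<xi>. ?F x \<xi> \<partial>lborel)"
    proof (rule nn_integral_mono)
      fix \<xi>
      have "t\<^sup>2 / 4 \<le> (u (x + \<xi>) - u x)\<^sup>2" if "\<bar>u (x + \<xi>)\<bar> \<le> t / 2"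
      proof -
        have "t / 2 \<le> \<bar>u (x + \<xi>) - u x\<bar>" using that ux by linarith
        from power_mono[OF this, of 2] show ?thesis using t by (simp add: power_divide)
      qed
      then show "ennreal (t\<^sup>2 / 4) * indicator {\<xi>. x + \<xi> \<in> ?S} \<xi> \<le> ?F x \<xi>"
        by (auto simp: indicator_def dist_norm intro: ennreal_leI)
    qed
    finally show ?thesis .
  qed
  have "emeasure lborel {x. \<bar>u x\<bar> > t} * ennreal (t\<^sup>2 / 4 * (V / 2)) 
      = (\<integral>\<^sup>+x. (ennreal (t\<^sup>2 / 4) * ennreal (V / 2)) * indicator {x. \<bar>u x\<bar> > t} x \<partial>lborel)"
    using V by (subst nn_integral_cmult_indicator) (auto simp: ennreal_mult[symmetric] mult.commute)
  also have "\<dots> \<le> (\<integral>\<^sup>+x. \<integral>\<^sup>+\<xi>. ?F x \<xi> \<partial>lborel \<partial>lborel)"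
  proof (rule nn_integral_mono_AE)
    show "AE x in lborel. ennreal (t\<^sup>2 / 4) * ennreal (V / 2) * indicator {x. \<bar>u x\<bar> > t} x \<le> (\<integral>\<^sup>+\<xi>. ?F x \<xi> \<partial>lborel)"
      using half
    proof eventually_elim
      case (elim x)
      then show ?case using lower[of x] by (cases "\<bar>u x\<bar> > t") (auto simp: V_def)
    qed
  qed
  also have "\<dots> \<le> ennreal (h\<^sup>2 * k * V)"
    using upper k V by (simp add: ennreal_mult)
  finally have "emeasure lborel {x. \<bar>u x\<bar> > t} \<le> ennreal (h\<^sup>2 * k * V / (t\<^sup>2 / 4 * (V / 2)))"
    using V t k by (intro ennreal_le_divideI) auto
  also have "h\<^sup>2 * k * V / (t\<^sup>2 / 4 * (V / 2)) = 8 * h\<^sup>2 * k / t\<^sup>2"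
    using V t by (simp add: field_simps)
  finally show ?thesis .
qed

text \<open>The supremum over \<open>t\<close> of \<open>t\<^bsup>2*\<^esup>\<close> times the measure of the level set is finite since \<open>u\<close> lies in
  \<open>L\<^bsup>2*\<^esup>\<close>, and choosing a ball of twice the volume of the lower level set bounds it by a
  smaller power of itself.\<close>

definition weak_sobolev_const :: "nat \<Rightarrow> real" where
  "weak_sobolev_const N = (8 * (2 / unit_ball_vol N) powr (2 / N) * 2 powr (crit_exp N * (2 / N))) powr (crit_exp N / 2)"

lemma weak_sobolev:
  fixes u :: "'a::euclidean_space \<Rightarrow> real"
  assumes um[measurable]: "u \<in> borel_measurable borel" and N: "DIM('a) \<ge> 3"
    and int: "integrable lborel (\<lambda>x. \<bar>u x\<bar> powr crit_exp DIM('a))"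
    and tr: "\<And>\<xi>. (\<integral>\<^sup>+x. ennreal ((u (x + \<xi>) - u x)\<^sup>2) \<partial>lborel) \<le> ennreal ((norm \<xi>)\<^sup>2 * k)"
    and k: "k \<ge> 0" and t: "t > 0"
  shows "emeasure lborel {x. \<bar>u x\<bar> > t} \<le> 
    ennreal (weak_sobolev_const DIM('a) * k powr (crit_exp DIM('a) / 2) / t powr crit_exp DIM('a))"
proof -
  define n where "n = real DIM('a)"
  define e where "e = crit_exp DIM('a)"
  define \<omega> where "\<omega> = unit_ball_vol n"
  have n: "n \<ge> 3" using N by (simp add: n_def)
  have e: "e = 2 * n / (n - 2)" by (simp add: e_def crit_exp_def n_def)
  have e0: "e > 0" using n e by simp
  have \<omega>: "\<omega> > 0" using n by (simp add: \<omega>_def)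
  define I where "I = (\<integral>x. \<bar>u x\<bar> powr e \<partial>lborel)"
  \<comment> \<open>Chebyshev's inequality. Its constant I depends on u; the gain is that m and the
    supremum S below are finite.\<close>
  have fin: "emeasure lborel {x. \<bar>u x\<bar> > t} \<le> ennreal (I / t powr e)" if "t > 0" for t
  proof (rule ennreal_le_divideI)
    have "emeasure lborel {x. \<bar>u x\<bar> > t} * ennreal (t powr e) 
        = (\<integral>\<^sup>+x. ennreal (t powr e) * indicator {x. \<bar>u x\<bar> > t} x \<partial>lborel)"
      by (subst nn_integral_cmult_indicator) (auto simp: mult.commute)
    also have "\<dots> \<le> (\<integral>\<^sup>+x. ennreal (\<bar>u x\<bar> powr e) \<partial>lborel)"
      using that e0 by (intro nn_integral_mono) (auto simp: indicator_def intro!: ennreal_leI powr_mono2)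
    also have "\<dots> = ennreal I"
      unfolding I_def using int by (intro nn_integral_eq_integral) (auto simp: e_def)
    finally show "emeasure lborel {x. \<bar>u x\<bar> > t} * ennreal (t powr e) \<le> ennreal I" .
  qed (use that in \<open>auto simp: I_def\<close>)
  define m where "m t = measure lborel {x. \<bar>u x\<bar> > t}" for t
  have em: "emeasure lborel {x. \<bar>u x\<bar> > t} = ennreal (m t)" if "t > 0" for t
    unfolding m_def using fin[OF that] by (intro emeasure_eq_ennreal_measure) (auto simp: top_unique)
  have m0: "m t \<ge> 0" for t by (simp add: m_def)
  have I0: "I \<ge> 0" by (simp add: I_def)
  have mI: "t powr e * m t \<le> I" if "t > 0" for t
    using fin[OF that] that I0 by (simp add: em field_simps)
  have rec: "m t \<le> 8 * k / t\<^sup>2 * (2 * m (t / 2) / \<omega>) powr (2 / n)" if t: "t > 0" for t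
  proof (cases "m (t / 2) = 0")
    \<comment> \<open>The radius chosen in the other case would be 0 here, but then
      \<open>m t\<close> is 0 as well.\<close>
    case True
    have "emeasure lborel {x. \<bar>u x\<bar> > t} \<le> emeasure lborel {x. \<bar>u x\<bar> > t / 2}"
      using t by (intro emeasure_mono) auto
    then have "ennreal (m t) \<le> ennreal (m (t / 2))"
      unfolding em[OF t] em[OF half_gt_zero[OF t]] .
    then have "m t = 0" using True m0[of t] by simp
    then show ?thesis using k by simp
  next
    case False
    then have mp: "m (t / 2) > 0" using m0[of "t / 2"] by simp
    define h where "h = (2 * m (t / 2) / \<omega>) powr (1 / n)"
    have h: "h > 0" using mp \<omega> by (simp add: h_def)
    have "h ^ DIM('a) = 2 * m (t / 2) / \<omega>"
      using mp \<omega> n h by (simp add: powr_realpow[symmetric] h_def powr_powr n_def)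
    then have hV: "measure lborel (ball (0::'a) h) / 2 = m (t / 2)"
      using h \<omega> unfolding n_def \<omega>_def by (simp add: content_ball del: unit_ball_vol_pos)
    have "emeasure lborel {x. \<bar>u x\<bar> > t} \<le> ennreal (8 * h\<^sup>2 * k / t\<^sup>2)"
    proof (rule level_set_bound[OF um tr k h t])
      show "AE x in lborel. \<bar>u x\<bar> > t \<longrightarrow> 
        emeasure lborel (ball x h \<inter> {y. \<bar>u y\<bar> > t / 2}) \<le> ennreal (measure lborel (ball (0::'a) h) / 2)"
        unfolding hV using em[of "t / 2"] t emeasure_mono[of "ball _ h \<inter> {y. \<bar>u y\<bar> > t / 2}" "{y. \<bar>u y\<bar> > t / 2}" lborel]
        by (intro AE_I2 impI) auto
    qed
    moreover have "h\<^sup>2 = (2 * m (t / 2) / \<omega>) powr (2 / n)"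
      using h by (simp add: powr_numeral[symmetric] h_def powr_powr)
    ultimately show ?thesis using t k h by (simp add: em mult_ac)
  qed
  define S where "S = (SUP t\<in>{0<..}. t powr e * m t)"
  have bdd: "bdd_above ((\<lambda>t. t powr e * m t) ` {0<..})"
    using mI by (intro bdd_aboveI2[of _ _ I]) auto
  have mS: "t powr e * m t \<le> S" if "t > 0" for t
    unfolding S_def using that by (intro cSUP_upper bdd) auto
  have S0: "S \<ge> 0" using mS[of 1] m0[of 1] by simp
  define c where "c = 8 * (2 / \<omega>) powr (2 / n) * 2 powr (e * (2 / n))"
  have c: "c > 0" using \<omega> by (simp add: c_def)
  have step: "t powr e * m t \<le> c * k * S powr (2 / n)" if t: "t > 0" for t
  proof -
    have "m (t / 2) \<le> S * (t / 2) powr (- e)"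
      using mS[of "t / 2"] t by (simp add: powr_minus field_simps)
    then have "(2 * m (t / 2) / \<omega>) powr (2 / n) \<le> (2 / \<omega> * (S * (t / 2) powr (- e))) powr (2 / n)"
      using \<omega> m0 n by (intro powr_mono2) (auto simp: divide_simps mult_ac)
    also have "\<dots> = (2 / \<omega>) powr (2 / n) * S powr (2 / n) * (t / 2) powr (- e * (2 / n))"
      using \<omega> S0 t by (simp add: powr_mult powr_powr del: times_divide_eq_left times_divide_eq_right)
    also have "(t / 2) powr (- e * (2 / n)) = t powr (- e * (2 / n)) * 2 powr (e * (2 / n))"
      using t by (simp add: powr_divide powr_minus field_simps)
    finally have "8 * k / t\<^sup>2 * (2 * m (t / 2) / \<omega>) powr (2 / n) \<le> 
        8 * k / t\<^sup>2 * ((2 / \<omega>) powr (2 / n) * S powr (2 / n) * (t powr (- e * (2 / n)) * 2 powr (e * (2 / n))))"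
      using k by (intro mult_left_mono) auto
    with rec[OF t] have "t powr e * m t \<le> t powr e * (8 * k / t\<^sup>2 * ((2 / \<omega>) powr (2 / n) * S powr (2 / n) 
        * (t powr (- e * (2 / n)) * 2 powr (e * (2 / n)))))"
      by (intro mult_left_mono) auto
    also have "\<dots> = c * k * S powr (2 / n) * (t powr e * t powr (- 2) * t powr (- e * (2 / n)))"
      using t by (simp add: c_def powr_minus powr_numeral field_simps)
    also have "t powr e * t powr (- 2) * t powr (- e * (2 / n)) = t powr (e + - 2 + - e * (2 / n))"
      by (simp only: powr_add)
    \<comment> \<open>The powers of t cancel because e (1 - 2/n) = 2, the scaling relation that
      determines the critical exponent.\<close>
    also have "e + - 2 + - e * (2 / n) = 0"
      using n by (simp add: e field_simps)
    finally show ?thesis using t by simp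
  qed
  have "S \<le> c * k * S powr (2 / n)"
    by (subst S_def, rule cSUP_least) (use step in auto)
  \<comment> \<open>As S is finite, a positive S can be divided by \<open>S powr (2 / n)\<close>;
    the exponent e/2 is the inverse of 1 - 2/n.\<close>
  have "S \<le> (c * k) powr (e / 2)"
  proof (cases "S = 0")
    case False
    then have S: "S > 0" using S0 by simp
    have "S powr (1 - 2 / n) = S / S powr (2 / n)" using S by (simp add: powr_diff)
    also have "\<dots> \<le> c * k" using \<open>S \<le> c * k * S powr (2 / n)\<close> S by (simp add: field_simps)
    finally have "(S powr (1 - 2 / n)) powr (e / 2) \<le> (c * k) powr (e / 2)"
      using e0 by (intro powr_mono2) auto
    moreover have "(1 - 2 / n) * (e / 2) = 1" using n by (simp add: e field_simps)
    ultimately show ?thesis using S by (simp add: powr_powr)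
  qed simp
  also have "\<dots> = weak_sobolev_const DIM('a) * k powr (e / 2)"
    using c k by (simp add: weak_sobolev_const_def c_def powr_mult e_def \<omega>_def n_def)
  finally have "t powr e * m t \<le> weak_sobolev_const DIM('a) * k powr (e / 2)"
    using mS[OF t] by simp
  then show ?thesis
    using t by (simp add: em e_def[symmetric] pos_le_divide_eq mult.commute ennreal_leI)
qed

subsection \<open>Elements of the Sobolev spaces\<close>

text \<open>The integral of the product of \<phi> and \<psi> does not change under translation along
  b. Its derivative in the shift, minus the integral of \<open>D x b\<close>, is therefore 0, and
  the product rule splits this into the two sides of the integration by parts formula.\<close>

lemma test_functions_weak_gradient:
  fixes \<phi> :: "'a::euclidean_space \<Rightarrow> real"
  assumes \<phi>: "\<phi> \<in> test_functions S"
  defines "g \<equiv> \<lambda>x. \<Sum>b\<in>Basis. dir_deriv b \<phi> x *\<^sub>R b"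
  shows "has_weak_gradient \<phi> g" "continuous_on UNIV g"
proof -
  have \<phi>c: "continuous_on UNIV \<phi>" by (rule test_functions_deriv_continuous[OF \<phi>])
  show gc: "continuous_on UNIV g"
    unfolding g_def by (intro continuous_intros test_functions_deriv_continuous(3)[OF \<phi>])
  have gb: "g x \<bullet> b = dir_deriv b \<phi> x" if "b \<in> Basis" for b x
    using that by (simp add: g_def inner_sum_left inner_Basis if_distrib if_distribR sum.delta' cong: if_cong)
  have "(\<integral>x. \<phi> x * dir_deriv b \<psi> x \<partial>lebesgue) = - (\<integral>x. (g x \<bullet> b) * \<psi> x \<partial>lebesgue)"
    if \<psi>: "\<psi> \<in> test_functions UNIV" and b: "b \<in> Basis" for \<psi> b
  proof -
    have \<psi>c: "continuous_on UNIV \<psi>" by (rule test_functions_deriv_continuous[OF \<psi>])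
    obtain K where K: "compact K" "\<And>x. x \<notin> K \<Longrightarrow> \<psi> x = 0" 
      using test_functions_support[OF \<psi>] by metis
    define D where "D x h = \<phi> x * frechet_derivative \<psi> (at x) h + frechet_derivative \<phi> (at x) h * \<psi> x" for x h
    have D: "((\<lambda>x. \<phi> x * \<psi> x) has_derivative D x) (at x)" for x
      unfolding D_def using test_functions_deriv_continuous(2)[OF \<psi>] test_functions_deriv_continuous(2)[OF \<phi>]
      by (intro has_derivative_mult) (simp_all add: frechet_derivative_works)
    have Db: "D x b = \<phi> x * dir_deriv b \<psi> x + dir_deriv b \<phi> x * \<psi> x" for x
      by (simp add: D_def dir_deriv_def)
    have Dc: "continuous_on UNIV (\<lambda>x. D x b)"
      unfolding Db by (intro continuous_intros \<phi>c \<psi>c test_functions_deriv_continuous(3)[OF \<phi> b] 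
          test_functions_deriv_continuous(3)[OF \<psi> b])
    have [measurable]: "(\<lambda>x. \<phi> x * \<psi> x) \<in> borel_measurable borel"
      using \<phi>c \<psi>c by (intro borel_measurable_continuous_onI continuous_intros)
    have "(\<integral>x. 1 * (\<phi> (x - s *\<^sub>R b) * \<psi> (x - s *\<^sub>R b)) \<partial>lebesgue) = (\<integral>x. \<phi> x * \<psi> x \<partial>lebesgue)" for s
      using integral_lebesgue_translation[of "\<lambda>x. \<phi> x * \<psi> x" "- (s *\<^sub>R b)"] by simp
    moreover have "((\<lambda>s. \<integral>x. 1 * (\<phi> (x - s *\<^sub>R b) * \<psi> (x - s *\<^sub>R b)) \<partial>lebesgue) has_real_derivative 
      - (\<integral>x. 1 * D (x - 0 *\<^sub>R b) b \<partial>lebesgue)) (at 0)"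
      by (rule integral_translate_deriv[OF locally_integrable_const D Dc K(1)]) (use K(2) in auto)
    ultimately have "(\<integral>x. D x b \<partial>lebesgue) = 0"
      by (auto dest: DERIV_unique[OF _ DERIV_const])
    then have "(\<integral>x. \<phi> x * dir_deriv b \<psi> x + dir_deriv b \<phi> x * \<psi> x \<partial>lebesgue) = 0"
      by (simp add: Db)
    then show ?thesis
      using integrable_mult_test_deriv[OF locally_integrable_continuous[OF \<phi>c] \<psi> b]
        integrable_mult_test[OF locally_integrable_continuous[OF test_functions_deriv_continuous(3)[OF \<phi> b]] \<psi>] b
      by (simp add: gb)
  qed
  then show "has_weak_gradient \<phi> g"
    using \<phi>c gc by (simp add: has_weak_gradient_def locally_integrable_continuous)
qed

lemma integrable_continuous_compact_support:
  fixes \<psi> :: "'a::euclidean_space \<Rightarrow> real"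
  assumes "continuous_on UNIV \<psi>" "compact K" "\<And>x. x \<notin> K \<Longrightarrow> \<psi> x = 0"
  shows "integrable lebesgue \<psi>"
  using locally_integrable_mult_continuous[OF locally_integrable_const[of "1::real"] assms] by simp

lemma crit_exp_pos: "N \<ge> 3 \<Longrightarrow> crit_exp N > 0"
  by (simp add: crit_exp_def)

lemma powr_abs_diff_le:
  fixes a b :: real
  assumes "e > 0"
  shows "\<bar>a - b\<bar> powr e \<le> 2 powr e * (\<bar>a\<bar> powr e + \<bar>b\<bar> powr e)"
proof -
  have "\<bar>a - b\<bar> powr e \<le> (2 * max \<bar>a\<bar> \<bar>b\<bar>) powr e"
    using assms by (intro powr_mono2) auto
  also have "\<dots> = 2 powr e * max \<bar>a\<bar> \<bar>b\<bar> powr e" by (simp add: powr_mult)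
  also have "max \<bar>a\<bar> \<bar>b\<bar> powr e \<le> \<bar>a\<bar> powr e + \<bar>b\<bar> powr e" by (auto simp: max_def)
  finally show ?thesis by (simp add: mult_left_mono)
qed

text \<open>Prepares the application of \<open>weak_sobolev\<close> to the error u - \<phi> of an
  approximation in \<open>D12_0\<close>.\<close>

lemma D12_diff_test:
  fixes u :: "'a::euclidean_space \<Rightarrow> real"
  assumes N: "DIM('a) \<ge> 3" and u: "u \<in> D12" and \<phi>: "\<phi> \<in> test_functions S"
  shows "(\<lambda>x. u x - \<phi> x) \<in> D12"
proof -
  define e where "e = crit_exp DIM('a)"
  have e: "e > 0" using crit_exp_pos[OF N] by (simp add: e_def)
  obtain g where g: "has_weak_gradient u g" "integrable lebesgue (\<lambda>x. (norm (g x))\<^sup>2)"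
    and um[measurable]: "u \<in> borel_measurable lebesgue" and ui: "integrable lebesgue (\<lambda>x. \<bar>u x\<bar> powr e)"
    using u by (auto simp: D12_def e_def)
  define h where "h x = (\<Sum>b\<in>Basis. dir_deriv b \<phi> x *\<^sub>R b)" for x
  have h: "has_weak_gradient \<phi> h" and hc: "continuous_on UNIV h"
    using test_functions_weak_gradient[OF \<phi>] by (simp_all add: h_def[abs_def])
  have \<phi>c: "continuous_on UNIV \<phi>" by (rule test_functions_deriv_continuous[OF \<phi>])
  have \<phi>m[measurable]: "\<phi> \<in> borel_measurable lebesgue" by (rule continuous_borel_lebesgue[OF \<phi>c])
  obtain K where K: "compact K" "\<And>x. x \<notin> K \<Longrightarrow> \<phi> x = 0" "\<And>b x. x \<notin> K \<Longrightarrow> dir_deriv b \<phi> x = 0"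
    using test_functions_support[OF \<phi>] by metis
  have \<phi>i: "integrable lebesgue (\<lambda>x. \<bar>\<phi> x\<bar> powr e)"
  proof (rule integrable_continuous_compact_support[OF _ K(1)])
    show "continuous_on UNIV (\<lambda>x. \<bar>\<phi> x\<bar> powr e)"
      by (rule continuous_on_powr') (use e \<phi>c in \<open>auto intro: continuous_intros\<close>)
  qed (simp add: K(2))
  have hi: "integrable lebesgue (\<lambda>x. (norm (h x))\<^sup>2)"
    by (rule integrable_continuous_compact_support[OF _ K(1)]) 
      (use hc K(3) in \<open>auto intro!: continuous_intros simp: h_def\<close>)
  have 1: "integrable lebesgue (\<lambda>x. \<bar>u x - \<phi> x\<bar> powr e)"
  proof (rule Bochner_Integration.integrable_bound)
    show "integrable lebesgue (\<lambda>x. 2 powr e * (\<bar>u x\<bar> powr e + \<bar>\<phi> x\<bar> powr e))"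
      by (intro integrable_mult_right Bochner_Integration.integrable_add ui \<phi>i)
    show "AE x in lebesgue. norm (\<bar>u x - \<phi> x\<bar> powr e) \<le> norm (2 powr e * (\<bar>u x\<bar> powr e + \<bar>\<phi> x\<bar> powr e))"
      using powr_abs_diff_le[OF e] by (intro AE_I2) simp
  qed measurable
  have [measurable]: "g \<in> borel_measurable lebesgue" "h \<in> borel_measurable lebesgue"
    using g(1) h by (auto simp: has_weak_gradient_def intro: locally_integrable_borel_measurable)
  have 2: "integrable lebesgue (\<lambda>x. (norm (g x - h x))\<^sup>2)"
  proof (rule Bochner_Integration.integrable_bound)
    show "integrable lebesgue (\<lambda>x. 2 * (norm (g x))\<^sup>2 + 2 * (norm (h x))\<^sup>2)"
      by (intro integrable_mult_right Bochner_Integration.integrable_add g hi)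
    show "AE x in lebesgue. norm ((norm (g x - h x))\<^sup>2) \<le> norm (2 * (norm (g x))\<^sup>2 + 2 * (norm (h x))\<^sup>2)"
    proof (rule AE_I2)
      fix x
      have "(norm (g x - h x))\<^sup>2 \<le> (norm (g x) + norm (h x))\<^sup>2"
        by (intro power_mono norm_triangle_ineq4) auto
      also have "\<dots> \<le> 2 * (norm (g x))\<^sup>2 + 2 * (norm (h x))\<^sup>2"
        using sum_squares_bound[of "norm (g x)" "norm (h x)"] by (simp add: power2_sum)
      finally show "norm ((norm (g x - h x))\<^sup>2) \<le> norm (2 * (norm (g x))\<^sup>2 + 2 * (norm (h x))\<^sup>2)" by simp
    qed
  qed measurable
  show ?thesis
    unfolding D12_def using has_weak_gradient_diff[OF g(1) h] 1 2 by (auto simp: e_def)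
qed

text \<open>Fubini's theorem and compositions with translations and orthogonal maps are carried out
  for Borel functions on \<open>lborel\<close>. The representative comes with the data that
  \<open>weak_sobolev\<close> consumes, expressed by the norm of u itself.\<close>

lemma D12_borel_representative:
  fixes u :: "'a::euclidean_space \<Rightarrow> real"
  assumes "u \<in> D12"
  shows "\<exists>v \<in> borel_measurable borel. (AE x in lborel. u x = v x) \<and>
    integrable lborel (\<lambda>x. \<bar>v x\<bar> powr crit_exp DIM('a)) \<and>
    (\<forall>\<xi>. (\<integral>\<^sup>+x. ennreal ((v (x + \<xi>) - v x)\<^sup>2) \<partial>lborel) \<le> ennreal ((norm \<xi>)\<^sup>2 * (D12_norm u)\<^sup>2))"
proof -
  obtain g where g: "has_weak_gradient u g" "integrable lebesgue (\<lambda>x. (norm (g x))\<^sup>2)"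
    and um[measurable]: "u \<in> borel_measurable lebesgue" 
    and ui: "integrable lebesgue (\<lambda>x. \<bar>u x\<bar> powr crit_exp DIM('a))"
    using assms by (auto simp: D12_def)
  obtain v where vm: "v \<in> borel_measurable lborel" and ae: "AE x in lborel. u x = v x"
    using completion_ex_borel_measurable_real[OF um] by blast
  have [measurable]: "v \<in> borel_measurable lebesgue" "v \<in> borel_measurable borel" 
    using vm by (auto intro: measurable_completion)
  have aeL: "AE x in lebesgue. u x = v x" using ae by (rule AE_completion)
  have gv: "has_weak_gradient v g" by (rule has_weak_gradient_AE[OF g(1) _ aeL]) measurable
  have "integrable lebesgue (\<lambda>x. \<bar>v x\<bar> powr crit_exp DIM('a))"
    by (rule integrable_cong_AE_imp[OF ui]) (use aeL in auto)
  then have "integrable lborel (\<lambda>x. \<bar>v x\<bar> powr crit_exp DIM('a))"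
    by (subst (asm) integrable_completion) auto
  moreover have "(\<integral>\<^sup>+x. ennreal ((v (x + \<xi>) - v x)\<^sup>2) \<partial>lborel) \<le> ennreal ((norm \<xi>)\<^sup>2 * (D12_norm u)\<^sup>2)" for \<xi>
    unfolding D12_norm_eq[OF g(1)] by (rule translation_estimate[OF _ gv g(2)]) measurable
  ultimately show ?thesis using vm ae by (intro bexI[of _ v]) auto
qed

text \<open>An approximating test function \<phi> vanishes on the ball, so there u agrees with the
  error u - \<phi>. By the weak Sobolev inequality the error exceeds t only on a set of measure at
  most C \<epsilon>^e / t^e, and \<epsilon> is arbitrary.\<close>

lemma D12_0_AE_zero:
  fixes u :: "'a::euclidean_space \<Rightarrow> real"
  assumes N: "DIM('a) \<ge> 3" and u: "u \<in> D12_0 (ext_domain R)"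
  shows "AE x in lborel. norm x \<le> R \<longrightarrow> u x = 0"
proof -
  define e where "e = crit_exp DIM('a)"
  define C where "C = weak_sobolev_const DIM('a)"
  have e: "e > 0" using crit_exp_pos[OF N] by (simp add: e_def)
  have uD: "u \<in> D12" using u by (simp add: D12_0_def)
  obtain v where vm[measurable]: "v \<in> borel_measurable borel" and uv: "AE x in lborel. u x = v x"
    using D12_borel_representative[OF uD] by blast
  have small: "emeasure lborel {x. norm x \<le> R \<and> \<bar>v x\<bar> > t} \<le> ennreal (C * \<epsilon> powr e / t powr e)"
    if t: "t > 0" and \<epsilon>: "\<epsilon> > 0" for t \<epsilon>
  proof -
    obtain \<phi> where \<phi>: "\<phi> \<in> test_functions (ext_domain R)" "D12_norm (\<lambda>x. u x - \<phi> x) < \<epsilon>"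
      using u \<epsilon> by (auto simp: D12_0_def)
    obtain K where K: "K \<subseteq> ext_domain R" "\<And>x. x \<notin> K \<Longrightarrow> \<phi> x = 0"
      by (rule test_functions_support[OF \<phi>(1)]) blast
    have \<phi>0: "\<phi> x = 0" if "norm x \<le> R" for x
    proof (rule K(2))
      show "x \<notin> K" using that K(1) by (auto simp: ext_domain_def)
    qed
    let ?k = "(D12_norm (\<lambda>x. u x - \<phi> x))\<^sup>2"
    obtain w where wm[measurable]: "w \<in> borel_measurable borel" and w: "AE x in lborel. u x - \<phi> x = w x"
      "integrable lborel (\<lambda>x. \<bar>w x\<bar> powr crit_exp DIM('a))"
      "\<And>\<xi>. (\<integral>\<^sup>+x. ennreal ((w (x + \<xi>) - w x)\<^sup>2) \<partial>lborel) \<le> ennreal ((norm \<xi>)\<^sup>2 * ?k)"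
      using D12_borel_representative[OF D12_diff_test[OF N uD \<phi>(1)]] by blast
    have "emeasure lborel {x. norm x \<le> R \<and> \<bar>v x\<bar> > t} \<le> emeasure lborel {x. \<bar>w x\<bar> > t}"
    proof (rule emeasure_mono_AE)
      show "AE x in lborel. x \<in> {x. norm x \<le> R \<and> \<bar>v x\<bar> > t} \<longrightarrow> x \<in> {x. \<bar>w x\<bar> > t}"
        using uv w(1) by eventually_elim (auto simp: \<phi>0)
    qed measurable
    also have "\<dots> \<le> ennreal (C * ?k powr (e / 2) / t powr e)"
      unfolding e_def C_def by (rule weak_sobolev[OF wm N w(2,3) _ t]) simp
    also have "\<dots> \<le> ennreal (C * \<epsilon> powr e / t powr e)"
    proof (intro ennreal_leI divide_right_mono mult_left_mono)
      have "?k powr (e / 2) = D12_norm (\<lambda>x. u x - \<phi> x) powr e"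
        using D12_norm_nonneg[of "\<lambda>x. u x - \<phi> x"]
        by (cases "D12_norm (\<lambda>x. u x - \<phi> x) = 0") (simp_all add: powr_powr flip: powr_numeral)
      also have "\<dots> \<le> \<epsilon> powr e"
        using \<phi>(2) e D12_norm_nonneg by (intro powr_mono2) auto
      finally show "?k powr (e / 2) \<le> \<epsilon> powr e" .
    qed (auto simp: C_def weak_sobolev_const_def)
    finally show ?thesis .
  qed
  have null: "emeasure lborel {x. norm x \<le> R \<and> \<bar>v x\<bar> > t} = 0" if t: "t > 0" for t
  proof -
    let ?x = "emeasure lborel {x. norm x \<le> R \<and> \<bar>v x\<bar> > t}"
    have "?x < top" using small[OF t zero_less_one] by (rule le_less_trans) simp
    then obtain r where r: "r \<ge> 0" "?x = ennreal r" by (cases ?x) auto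
    have C0: "C \<ge> 0" by (simp add: C_def weak_sobolev_const_def)
    have "r \<le> C * inverse (real (Suc n)) powr e / t powr e" for n
      using small[OF t, of "inverse (real (Suc n))"] r C0 by (simp add: ennreal_le_iff del: of_nat_Suc)
    moreover have "(\<lambda>n. C * inverse (real (Suc n)) powr e / t powr e) \<longlonglongrightarrow> C * 0 / t powr e"
      by (intro tendsto_intros tendsto_zero_powrI[OF LIMSEQ_inverse_real_of_nat tendsto_const])
        (use t e in auto)
    ultimately have "r \<le> C * 0 / t powr e" by (meson LIMSEQ_le_const)
    then show ?thesis using r by simp
  qed
  have "AE x in lborel. \<forall>n. \<not> (norm x \<le> R \<and> \<bar>v x\<bar> > inverse (real (Suc n)))"
  proof (subst AE_all_countable, intro allI)
    fix n
    have "{x. norm x \<le> R \<and> \<bar>v x\<bar> > inverse (real (Suc n))} \<in> null_sets lborel"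
      by (intro null_setsI null) (simp, measurable)
    from AE_not_in[OF this] show "AE x in lborel. \<not> (norm x \<le> R \<and> \<bar>v x\<bar> > inverse (real (Suc n)))" by simp
  qed
  with uv show ?thesis
  proof eventually_elim
    case (elim x)
    show ?case
    proof (rule impI, rule ccontr)
      assume "norm x \<le> R" "u x \<noteq> 0"
      then have "\<bar>v x\<bar> > 0" using elim by simp
      then obtain n where "inverse (real (Suc n)) < \<bar>v x\<bar>" using reals_Archimedean by blast
      with elim \<open>norm x \<le> R\<close> show False by blast
    qed
  qed
qed

subsection \<open>Orbits of orthogonal groups\<close>

lemma orthogonal_transformation_borel [measurable_dest]:
  "orthogonal_transformation g \<Longrightarrow> g \<in> borel_measurable borel"
  for g :: "'a::euclidean_space \<Rightarrow> 'a"
  by (intro borel_measurable_continuous_onI linear_continuous_on)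
    (simp add: linear_conv_bounded_linear[symmetric] orthogonal_transformation_linear)

text \<open>Uniqueness of Haar measure: the integral of \<open>1\<^sub>A (x + g y) 1\<^sub>B (g y)\<close> over \<open>(x, y)\<close>, where
  \<open>B\<close> is the unit ball, is computed in two ways.\<close>

lemma lborel_distr_orthogonal:
  fixes g :: "'a::euclidean_space \<Rightarrow> 'a"
  assumes g: "orthogonal_transformation g"
  shows "distr lborel borel g = lborel"
proof (rule measure_eqI)
  have gm[measurable]: "g \<in> borel_measurable borel" using g by (rule orthogonal_transformation_borel)
  have glin: "linear g" using g by (rule orthogonal_transformation_linear)
  fix A :: "'a set" assume "A \<in> sets (distr lborel borel g)"
  then have A[measurable]: "A \<in> sets borel" by simp
  define B :: "'a set" where "B = ball 0 1"
  have B[measurable]: "B \<in> sets borel" by (simp add: B_def)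
  have gB: "g y \<in> B \<longleftrightarrow> y \<in> B" for y using g by (simp add: B_def orthogonal_transformation_norm)
  have translate: "(\<integral>\<^sup>+y. f (c + y) \<partial>lborel) = (\<integral>\<^sup>+y. f y \<partial>lborel)" 
    if "f \<in> borel_measurable borel" for f :: "'a \<Rightarrow> ennreal" and c
  proof -
    have "(\<integral>\<^sup>+y. f y \<partial>distr lborel borel ((+) c)) = (\<integral>\<^sup>+y. f (c + y) \<partial>lborel)"
      using that by (intro nn_integral_distr) auto
    then show ?thesis by (simp add: lborel_distr_plus)
  qed
  have iA[measurable]: "(indicator A :: 'a \<Rightarrow> ennreal) \<in> borel_measurable borel"
    and iB[measurable]: "(indicator B :: 'a \<Rightarrow> ennreal) \<in> borel_measurable borel" by simp_all
  have shift: "(\<integral>\<^sup>+y. indicator A (x + g y) * indicator B (g y) \<partial>lborel) 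
      = (\<integral>\<^sup>+y. indicator A (g y) * indicator B (g y - x) \<partial>lborel)" for x
  proof -
    \<comment> \<open>The substitution y -> c + y turns x + g y into g y, and g y into g y -
      x.\<close>
    obtain c where c: "g c = - x"
      using orthogonal_transformation_surj[OF g] by (metis surjD)
    have "(\<integral>\<^sup>+y. indicator A (x + g y) * indicator B (g y) \<partial>lborel) = 
        (\<integral>\<^sup>+y. indicator A (x + g (c + y)) * indicator B (g (c + y)) \<partial>lborel)"
      by (subst translate[of "\<lambda>y. indicator A (x + g y) * indicator B (g y)" c]) auto
    then show ?thesis by (simp add: linear_add[OF glin] c)
  qed
  have "emeasure lborel A * emeasure lborel B = (\<integral>\<^sup>+y. emeasure lborel A * indicator B y \<partial>lborel)"
    by (subst nn_integral_cmult_indicator) auto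
  also have "\<dots> = (\<integral>\<^sup>+y. \<integral>\<^sup>+x. indicator A (x + g y) * indicator B (g y) \<partial>lborel \<partial>lborel)"
  proof (rule nn_integral_cong)
    fix y
    have "(\<integral>\<^sup>+x. indicator A (x + g y) * indicator B (g y) \<partial>lborel) = 
        (\<integral>\<^sup>+x. indicator A (g y + x) \<partial>lborel) * indicator B (g y)"
      by (subst nn_integral_multc) (auto simp: add.commute)
    also have "(\<integral>\<^sup>+x. indicator A (g y + x) \<partial>lborel) = (\<integral>\<^sup>+x. indicator A x \<partial>lborel)"
      by (rule translate) simp
    also have "\<dots> = emeasure lborel A" by simp
    finally show "emeasure lborel A * indicator B y = 
        (\<integral>\<^sup>+x. indicator A (x + g y) * indicator B (g y) \<partial>lborel)"
      using gB[of y] by (simp add: indicator_def)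
  qed
  also have "\<dots> = (\<integral>\<^sup>+x. \<integral>\<^sup>+y. indicator A (x + g y) * indicator B (g y) \<partial>lborel \<partial>lborel)"
    by (rule lborel_pair.Fubini') measurable
  also have "\<dots> = (\<integral>\<^sup>+x. \<integral>\<^sup>+y. indicator A (g y) * indicator B (g y - x) \<partial>lborel \<partial>lborel)"
    by (simp add: shift)
  also have "\<dots> = (\<integral>\<^sup>+y. \<integral>\<^sup>+x. indicator A (g y) * indicator B (g y - x) \<partial>lborel \<partial>lborel)"
    by (rule lborel_pair.Fubini') measurable
  also have "\<dots> = (\<integral>\<^sup>+y. emeasure lborel B * indicator (g -` A) y \<partial>lborel)"
  proof (rule nn_integral_cong)
    fix y
    have "(\<integral>\<^sup>+x. indicator A (g y) * indicator B (g y - x) \<partial>lborel) = 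
        indicator A (g y) * (\<integral>\<^sup>+x. indicator B (g y - x) \<partial>lborel)"
      by (subst nn_integral_cmult) auto
    also have "(\<integral>\<^sup>+x. indicator B (g y - x) \<partial>lborel) = (\<integral>\<^sup>+x. indicator (ball (g y) 1) x \<partial>lborel)"
      by (intro nn_integral_cong) (auto simp: B_def indicator_def dist_norm norm_minus_commute)
    also have "\<dots> = emeasure lborel B"
      by (simp add: B_def emeasure_ball)
    finally show "(\<integral>\<^sup>+x. indicator A (g y) * indicator B (g y - x) \<partial>lborel) = 
        emeasure lborel B * indicator (g -` A) y"
      unfolding indicator_vimage by (simp only: mult.commute)
  qed
  also have "\<dots> = emeasure lborel B * emeasure lborel (g -` A)"
    using measurable_sets_borel[OF gm A] by (subst nn_integral_cmult_indicator) auto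
  finally have "emeasure lborel B * emeasure lborel (g -` A) = emeasure lborel B * emeasure lborel A"
    by (simp add: mult.commute)
  moreover have "emeasure lborel B \<noteq> 0" "emeasure lborel B \<noteq> top"
    by (simp_all add: B_def emeasure_ball ennreal_eq_0_iff not_le)
  ultimately have "emeasure lborel (g -` A) = emeasure lborel A"
    by (simp add: ennreal_mult_cancel_left)
  then show "emeasure (distr lborel borel g) A = emeasure lborel A"
    by (simp add: emeasure_distr)
qed simp

lemma AE_compose_orthogonal:
  fixes g :: "'a::euclidean_space \<Rightarrow> 'a"
  assumes g: "orthogonal_transformation g" and P: "AE x in lborel. P x"
  shows "AE x in lborel. P (g x)"
proof -
  obtain N where N: "{x. \<not> P x} \<subseteq> N" "N \<in> null_sets lborel"
    using P by (auto elim!: AE_E simp: null_sets_def)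
  have gm[measurable]: "g \<in> borel_measurable borel" using g by (rule orthogonal_transformation_borel)
  have "emeasure lborel (g -` N) = emeasure (distr lborel borel g) N"
    using N by (subst emeasure_distr) auto
  then have "g -` N \<in> null_sets lborel"
    using N measurable_sets_borel[OF gm, of N] by (auto simp: lborel_distr_orthogonal[OF g] null_sets_def)
  then show ?thesis
    by (rule AE_I') (use N in auto)
qed

text \<open>Up to a null set, g i maps the part of {|u| > s} in the ball about x onto its part in
  the ball about g i x, and it preserves measure. Centres at distance at least 2 h make the n open
  balls disjoint.\<close>

lemma ball_measure_le_by_orbit:
  fixes u :: "'a::euclidean_space \<Rightarrow> real" and g :: "nat \<Rightarrow> 'a \<Rightarrow> 'a"
  assumes um[measurable]: "u \<in> borel_measurable borel"
    and g: "\<And>i. i < n \<Longrightarrow> orthogonal_transformation (g i)"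
    and inv: "\<And>i. i < n \<Longrightarrow> AE x in lborel. u (g i x) = u x"
    and sep: "\<And>i j. i < j \<Longrightarrow> j < n \<Longrightarrow> 2 * h \<le> dist (g i x) (g j x)"
  shows "of_nat n * emeasure lborel (ball x h \<inter> {y. \<bar>u y\<bar> > s}) \<le> emeasure lborel {y. \<bar>u y\<bar> > s}"
proof -
  let ?E = "{y. \<bar>u y\<bar> > s}"
  have E: "?E \<in> sets borel" by measurable
  have eq: "emeasure lborel (ball (g i x) h \<inter> ?E) = emeasure lborel (ball x h \<inter> ?E)" if i: "i < n" for i
  proof -
    have gm[measurable]: "g i \<in> borel_measurable borel" using g[OF i] by (rule orthogonal_transformation_borel)
    have "emeasure lborel (ball (g i x) h \<inter> ?E) = emeasure (distr lborel borel (g i)) (ball (g i x) h \<inter> ?E)"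
      by (simp add: lborel_distr_orthogonal[OF g[OF i]])
    also have "\<dots> = emeasure lborel (g i -` (ball (g i x) h \<inter> ?E))"
      using E by (subst emeasure_distr) auto
    also have "\<dots> = emeasure lborel (ball x h \<inter> ?E)"
    proof (rule emeasure_eq_AE)
      show "AE y in lborel. (y \<in> g i -` (ball (g i x) h \<inter> ?E)) = (y \<in> ball x h \<inter> ?E)"
        using inv[OF i]
        by eventually_elim (use g[OF i] in \<open>simp add: orthogonal_transformation_isometry\<close>)
      show "g i -` (ball (g i x) h \<inter> ?E) \<in> sets lborel"
        using E measurable_sets_borel[OF gm, of "ball (g i x) h \<inter> ?E"] by auto
    qed (use E in auto)
    finally show ?thesis .
  qed
  have disj: "disjoint_family_on (\<lambda>i. ball (g i x) h \<inter> ?E) {..<n}"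
    unfolding disjoint_family_on_def
  proof (intro ballI impI)
    have *: "ball (g i x) h \<inter> ball (g j x) h = {}" if "i < j" "j < n" for i j
    proof -
      have "False" if y: "dist (g i x) y < h" "dist (g j x) y < h" for y
        using sep[OF \<open>i < j\<close> \<open>j < n\<close>] dist_triangle[of "g i x" "g j x" y] y by (simp add: dist_commute)
      then show ?thesis by auto
    qed
    fix i j assume "i \<in> {..<n}" "j \<in> {..<n}" "i \<noteq> j"
    then show "(ball (g i x) h \<inter> ?E) \<inter> (ball (g j x) h \<inter> ?E) = {}"
      using *[of i j] *[of j i] by (cases "i < j") auto
  qed
  have "of_nat n * emeasure lborel (ball x h \<inter> ?E) = (\<Sum>i<n. emeasure lborel (ball (g i x) h \<inter> ?E))"
    by (simp add: eq)
  also have "\<dots> = emeasure lborel (\<Union>i<n. ball (g i x) h \<inter> ?E)"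
    using E disj by (intro sum_emeasure) auto
  also have "\<dots> \<le> emeasure lborel ?E"
    using E by (intro emeasure_mono) auto
  finally show ?thesis .
qed

text \<open>The points lie on the circle of radius norm y in the plane of y and y', with equally
  spaced coordinates along y. Their distance is at least the difference of these coordinates, so
  angles can be avoided.\<close>

lemma
  fixes y y' :: "'a::real_inner"
  assumes "orthogonal y y'" "norm y' = norm y"
  defines "p \<equiv> \<lambda>n i. (real i / real n) *\<^sub>R y + sqrt (1 - (real i / real n)\<^sup>2) *\<^sub>R y'"
  shows circle_points_norm: "i < n \<Longrightarrow> norm (p n i) = norm y"
    and circle_points_dist: "i < j \<Longrightarrow> j < n \<Longrightarrow> norm y / real n \<le> dist (p n i) (p n j)"
proof -
  have pyth: "(norm (a *\<^sub>R y + b *\<^sub>R y'))\<^sup>2 = (a\<^sup>2 + b\<^sup>2) * (norm y)\<^sup>2" for a b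
  proof -
    have "(norm (a *\<^sub>R y + b *\<^sub>R y'))\<^sup>2 = (norm (a *\<^sub>R y))\<^sup>2 + (norm (b *\<^sub>R y'))\<^sup>2"
      using assms(1) by (intro norm_add_Pythagorean) (simp add: orthogonal_clauses)
    then show ?thesis using assms(2) by (simp add: power_mult_distrib distrib_right)
  qed
  show "norm (p n i) = norm y" if "i < n"
  proof -
    have "(real i / real n)\<^sup>2 \<le> 1"
      using that by (intro power_le_one) auto
    then have "(norm (p n i))\<^sup>2 = (norm y)\<^sup>2"
      unfolding p_def pyth by (simp add: real_sqrt_pow2)
    then show ?thesis by (simp add: power2_eq_iff_nonneg)
  qed
  show "norm y / real n \<le> dist (p n i) (p n j)" if ij: "i < j" "j < n"
  proof -
    have n: "0 < real n" using ij by simp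
    define a where "a = real i / real n - real j / real n"
    define b where "b = sqrt (1 - (real i / real n)\<^sup>2) - sqrt (1 - (real j / real n)\<^sup>2)"
    have "p n i - p n j = a *\<^sub>R y + b *\<^sub>R y'"
      by (simp add: p_def a_def b_def scaleR_diff_left)
    then have "(dist (p n i) (p n j))\<^sup>2 = (a\<^sup>2 + b\<^sup>2) * (norm y)\<^sup>2"
      by (simp add: dist_norm pyth)
    moreover have "a\<^sup>2 * (norm y)\<^sup>2 \<le> (a\<^sup>2 + b\<^sup>2) * (norm y)\<^sup>2" by (intro mult_right_mono) auto
    ultimately have 1: "(\<bar>a\<bar> * norm y)\<^sup>2 \<le> (dist (p n i) (p n j))\<^sup>2" by (simp add: power_mult_distrib)
    have "\<bar>a\<bar> \<ge> 1 / real n"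
      using ij n by (simp add: a_def diff_divide_distrib[symmetric] divide_right_mono)
    then have "norm y / real n \<le> \<bar>a\<bar> * norm y"
      using mult_right_mono[of "1 / real n" "\<bar>a\<bar>" "norm y"] by simp
    also have "\<dots> \<le> dist (p n i) (p n j)" using power2_le_imp_le[OF 1] by simp
    finally show ?thesis .
  qed
qed

text \<open>One of the two components has norm at least norm x / 2. It is moved along a circle while
  the other one stays fixed. For z this is multiplication by unit complex numbers; for y the circle
  lies in the plane of y and an orthogonal vector, which exists because the dimension is at least
  2.\<close>

lemma Gamma_inf_orbit:
  fixes x :: "complex \<times> (real^'m)"
  assumes m: "CARD('m) \<ge> 2"
  obtains g where "\<And>i. i < n \<Longrightarrow> g i \<in> Gamma_inf" 
    "\<And>i j. i < j \<Longrightarrow> j < n \<Longrightarrow> norm x / (2 * real n) \<le> dist (g i x) (g j x)"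
proof -
  obtain z y where x: "x = (z, y)" by (cases x)
  have xle: "norm x \<le> norm z + norm y" unfolding x by (rule norm_Pair_le)
  show ?thesis
  proof (cases "norm z \<ge> norm y")
    case True
    have orth: "orthogonal z (\<i> * z)" by (simp add: orthogonal_def inner_complex_def)
    define \<alpha> where "\<alpha> i = Complex (real i / real n) (sqrt (1 - (real i / real n)\<^sup>2))" for i :: nat
    have \<alpha>: "\<alpha> i * z = (real i / real n) *\<^sub>R z + sqrt (1 - (real i / real n)\<^sup>2) *\<^sub>R (\<i> * z)" for i
      by (simp add: \<alpha>_def complex_eq_iff)
    define g where "g i = (\<lambda>(z, y::real^'m). (\<alpha> i * z, y))" for i
    have "g i \<in> Gamma_inf" if "i < n" for i
    proof -
      have "(real i / real n)\<^sup>2 \<le> 1" using that by (intro power_le_one) auto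
      then have "norm (\<alpha> i) = 1" by (simp add: \<alpha>_def complex_norm)
      then show ?thesis
        unfolding Gamma_inf_def g_def
        by (intro CollectI exI[of _ "\<alpha> i"] exI[of _ "\<lambda>y. y"]) (simp add: orthogonal_transformation_id)
    qed
    moreover have "norm x / (2 * real n) \<le> dist (g i x) (g j x)" if "i < j" "j < n" for i j
    proof -
      have "norm x / (2 * real n) \<le> norm z / real n"
        using xle True that by (simp add: field_simps)
      also have "\<dots> \<le> dist (\<alpha> i * z) (\<alpha> j * z)"
        unfolding \<alpha> by (rule circle_points_dist[OF orth _ that]) (simp add: norm_mult)
      also have "\<dots> \<le> dist (g i x) (g j x)"
        using dist_fst_le[of "g i x" "g j x"] by (simp add: g_def x)
      finally show ?thesis .
    qed
    ultimately show ?thesis by (rule that)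
  next
    case False
    obtain w :: "real^'m" where w: "w \<noteq> 0" "orthogonal y w"
      using orthogonal_to_vector_exists[of y] m by auto
    define y' where "y' = (norm y / norm w) *\<^sub>R w"
    have y': "orthogonal y y'" "norm y' = norm y"
      using w by (auto simp: y'_def orthogonal_def)
    define p where "p i = (real i / real n) *\<^sub>R y + sqrt (1 - (real i / real n)\<^sup>2) *\<^sub>R y'" for i :: nat
    \<comment> \<open>An orthogonal map carries y to any given vector of the same norm. The identity
      for i >= n makes the choice function total.\<close>
    have "\<exists>\<beta>. orthogonal_transformation \<beta> \<and> (i < n \<longrightarrow> \<beta> y = p i)" for i
    proof (cases "i < n")
      case True
      then have "norm y = norm (p i)"
        unfolding p_def by (rule circle_points_norm[OF y', symmetric])
      then show ?thesis using orthogonal_transformation_exists by metis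
    qed (auto intro!: exI[of _ "\<lambda>x. x"] simp: orthogonal_transformation_id)
    then obtain \<beta> where \<beta>: "\<And>i. orthogonal_transformation (\<beta> i)" "\<And>i. i < n \<Longrightarrow> \<beta> i y = p i"
      by metis
    define g where "g i = (\<lambda>(z, y). (1 * z :: complex, \<beta> i y))" for i
    have "g i \<in> Gamma_inf" if "i < n" for i
      unfolding Gamma_inf_def g_def
      by (intro CollectI exI[of _ 1] exI[of _ "\<beta> i"]) (simp add: \<beta>(1))
    moreover have "norm x / (2 * real n) \<le> dist (g i x) (g j x)" if "i < j" "j < n" for i j
    proof -
      have "norm x / (2 * real n) \<le> norm y / real n"
        using xle False that by (simp add: field_simps)
      also have "\<dots> \<le> dist (p i) (p j)"
        unfolding p_def by (rule circle_points_dist[OF y' that])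
      also have "\<dots> \<le> dist (g i x) (g j x)"
        using dist_snd_le[of "g i x" "g j x"] that by (simp add: g_def x \<beta>)
      finally show ?thesis .
    qed
    ultimately show ?thesis by (rule that)
  qed
qed

lemma Gamma_inf_orthogonal:
  assumes "g \<in> Gamma_inf" shows "orthogonal_transformation g"
proof -
  obtain \<alpha> \<beta> where g: "g = (\<lambda>(z, y). (\<alpha> * z, \<beta> y))" "norm \<alpha> = 1" "orthogonal_transformation \<beta>"
    using assms by (auto simp: Gamma_inf_def)
  have "linear \<beta>" using g(3) by (rule orthogonal_transformation_linear)
  then have "linear g"
    unfolding g(1) by (intro linearI) (auto simp: linear_add linear_scale algebra_simps)
  moreover have "norm (g v) = norm v" for v
    using g(2,3) by (cases v) (simp add: g(1) norm_Pair norm_mult orthogonal_transformation_norm)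
  ultimately show ?thesis by (simp add: orthogonal_transformation)
qed

subsection \<open>Smallness of the nonlinear term far from the origin\<close>

text \<open>On the level with b j / 2 < |u| <= b j the integrand is at most
  \<open>b j powr r\<close> and the measure at most M (2 / b j)^e, which gives a geometric series of
  ratio \<open>l powr (r - e)\<close>. The ratio is below 1 for l = 1/2 if r > e and for l = 2 if r
  < e, so one lemma covers both small and large values of u.\<close>

lemma dyadic_integral_bound:
  fixes u :: "'a::euclidean_space \<Rightarrow> real"
  assumes um[measurable]: "u \<in> borel_measurable borel"
    and weak: "\<And>t. t > 0 \<Longrightarrow> emeasure lborel {x. \<bar>u x\<bar> > t} \<le> ennreal (M / t powr e)"
    and M: "M \<ge> 0" and a: "a > 0" and l: "l > 0" "l powr (r - e) < 1" and r: "r > 0"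
    and cover: "\<And>x. x \<in> S \<Longrightarrow> \<exists>j. a * l ^ j / 2 < \<bar>u x\<bar> \<and> \<bar>u x\<bar> \<le> a * l ^ j"
  shows "(\<integral>\<^sup>+x. ennreal (\<bar>u x\<bar> powr r) * indicator S x \<partial>lborel) 
    \<le> ennreal (2 powr e * M * a powr (r - e) / (1 - l powr (r - e)))"
proof -
  define b where "b j = a * l ^ j" for j
  have b: "b j > 0" for j using a l by (simp add: b_def)
  define f where "f j x = ennreal (b j powr r) * indicator {x. \<bar>u x\<bar> > b j / 2} x" for j and x :: 'a
  have [measurable]: "f j \<in> borel_measurable lborel" for j unfolding f_def by measurable
  have "(\<integral>\<^sup>+x. ennreal (\<bar>u x\<bar> powr r) * indicator S x \<partial>lborel) \<le> (\<integral>\<^sup>+x. (\<Sum>j. f j x) \<partial>lborel)"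
  proof (rule nn_integral_mono)
    fix x
    show "ennreal (\<bar>u x\<bar> powr r) * indicator S x \<le> (\<Sum>j. f j x)"
    proof (cases "x \<in> S")
      case True
      then obtain j where j: "b j / 2 < \<bar>u x\<bar>" "\<bar>u x\<bar> \<le> b j" using cover unfolding b_def by blast
      have "ennreal (\<bar>u x\<bar> powr r) * indicator S x \<le> f j x"
        using True j r by (simp add: f_def ennreal_leI powr_mono2)
      also have "\<dots> = (\<Sum>j\<in>{j}. f j x)" by simp
      also have "\<dots> \<le> (\<Sum>j. f j x)" by (rule sum_le_suminf) auto
      finally show ?thesis .
    qed simp
  qed
  also have "\<dots> = (\<Sum>j. \<integral>\<^sup>+x. f j x \<partial>lborel)"
    by (rule nn_integral_suminf) measurable
  also have "\<dots> \<le> (\<Sum>j. ennreal (2 powr e * M * a powr (r - e) * (l powr (r - e)) ^ j))"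
  proof (rule suminf_le)
    fix j
    have "(\<integral>\<^sup>+x. f j x \<partial>lborel) = ennreal (b j powr r) * emeasure lborel {x. \<bar>u x\<bar> > b j / 2}"
      unfolding f_def by (subst nn_integral_cmult_indicator) auto
    also have "\<dots> \<le> ennreal (b j powr r) * ennreal (M / (b j / 2) powr e)"
      using b[of j] by (intro mult_left_mono weak) auto
    also have "\<dots> = ennreal (b j powr r * (M / (b j / 2) powr e))"
      by (rule ennreal_mult[symmetric]) (use M in auto)
    also have "b j powr r * (M / (b j / 2) powr e) = 2 powr e * M * b j powr (r - e)"
      using b[of j] by (simp add: powr_divide powr_diff field_simps)
    also have "b j powr (r - e) = a powr (r - e) * (l powr (r - e)) ^ j"
      using a l by (simp add: b_def powr_mult powr_powr powr_realpow[symmetric] mult.commute)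
    finally show "(\<integral>\<^sup>+x. f j x \<partial>lborel) \<le> ennreal (2 powr e * M * a powr (r - e) * (l powr (r - e)) ^ j)"
      by (simp add: mult.assoc)
  qed auto
  also have "\<dots> = ennreal (\<Sum>j. 2 powr e * M * a powr (r - e) * (l powr (r - e)) ^ j)"
    using M l by (intro suminf_ennreal2 summable_mult summable_geometric) auto
  also have "(\<Sum>j. 2 powr e * M * a powr (r - e) * (l powr (r - e)) ^ j) = 
      2 powr e * M * a powr (r - e) / (1 - l powr (r - e))"
    using l by (subst suminf_mult) (auto simp: suminf_geometric)
  finally show ?thesis .
qed

text \<open>Here j is the integer part of the binary logarithm of d / s. Rounding d / s down first
  changes nothing, since powers of two are integers.\<close>

lemma dyadic_below:
  fixes s :: real
  assumes "0 < s" "s \<le> d"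
  shows "\<exists>j. d * (1/2) ^ j / 2 < s \<and> s \<le> d * (1/2) ^ j"
proof -
  have "nat \<lfloor>d / s\<rfloor> \<ge> 1" using assms by (simp add: nat_le_iff le_nat_iff le_floor_iff)
  from ex_power_ivl1[OF order_refl this]
  obtain j where j: "2 ^ j \<le> nat \<lfloor>d / s\<rfloor>" "nat \<lfloor>d / s\<rfloor> < 2 ^ (j + 1)" by blast
  have 0: "d / s \<ge> 0" using assms by simp
  have "real (2 ^ j) \<le> real (nat \<lfloor>d / s\<rfloor>)" using j(1) by (rule of_nat_mono)
  also have "\<dots> \<le> d / s" using 0 by simp
  finally have 1: "2 ^ j \<le> d / s" by simp
  have "real (nat \<lfloor>d / s\<rfloor>) + 1 \<le> real (2 ^ (j + 1))" 
    using of_nat_mono[of "Suc (nat \<lfloor>d / s\<rfloor>)" "2 ^ (j + 1)", where 'a=real] j(2) by simp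
  then have 2: "d / s < 2 ^ (j + 1)" using 0 by simp linarith
  show ?thesis
    using 1 2 assms by (intro exI[of _ j]) (simp add: field_simps power_divide)
qed

text \<open>The quotient s / d is rounded up, because now its lower bound \<open>2 ^ j\<close> is
  the strict one. The first level is the interval from d to 2 * d, whence the factor 2 in
  front.\<close>

lemma dyadic_above:
  fixes s :: real
  assumes "0 < d" "d < s"
  shows "\<exists>j. 2 * d * 2 ^ j / 2 < s \<and> s \<le> 2 * d * 2 ^ j"
proof -
  have "1 < s / d" using assms by simp
  then have "nat \<lceil>s / d\<rceil> \<ge> 2" by (simp add: le_nat_iff)
  from ex_power_ivl2[OF order_refl this]
  obtain j where j: "2 ^ j < nat \<lceil>s / d\<rceil>" "nat \<lceil>s / d\<rceil> \<le> 2 ^ (j + 1)" by blast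
  have "s / d \<le> real (nat \<lceil>s / d\<rceil>)" by (rule real_nat_ceiling_ge)
  also have "\<dots> \<le> real (2 ^ (j + 1))" using j(2) by (rule of_nat_mono)
  finally have 1: "s / d \<le> 2 ^ (j + 1)" by simp
  have "int (2 ^ j) < \<lceil>s / d\<rceil>" using j(1) by (simp add: zless_nat_eq_int_zless)
  then have 2: "2 ^ j < s / d" by (simp add: less_ceiling_iff)
  show ?thesis
    using 1 2 assms by (intro exI[of _ j]) (simp add: field_simps)
qed

text \<open>The growth profile of \<open>primitive f\<close> in (f1), without its constant. For p <
  \<open>crit_exp N\<close> < q and s >= 0 it lies below \<open>s powr crit_exp N\<close>, hence is
  integrable along every u in \<open>D12\<close>.\<close>

definition two_power :: "real \<Rightarrow> real \<Rightarrow> real \<Rightarrow> real" where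
  "two_power p q s = (if s \<ge> 1 then s powr p else s powr q)"

lemma two_power_measurable [measurable]: "two_power p q \<in> borel_measurable borel"
  unfolding two_power_def[abs_def] by measurable

lemma two_power_nonneg: "two_power p q s \<ge> 0"
  by (simp add: two_power_def)

text \<open>The values of |u| are split at d and 1/d. Below d the exponent q and above 1/d the
  exponent p give convergent dyadic sums with a positive power of d in front. In between the
  integrand is at most \<open>(1 / d) powr p\<close>, and the measure m of {|u| > d} is the one
  quantity that must come from elsewhere.\<close>

lemma two_power_integral_bound:
  fixes u :: "'a::euclidean_space \<Rightarrow> real"
  assumes um[measurable]: "u \<in> borel_measurable borel"
    and weak: "\<And>t. t > 0 \<Longrightarrow> emeasure lborel {x. \<bar>u x\<bar> > t} \<le> ennreal (M / t powr e)"
    and M: "M \<ge> 0" and pq: "0 < p" "p < e" "e < q" and d: "0 < d" "d < 1"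
    and mid: "emeasure lborel {x. \<bar>u x\<bar> > d} \<le> ennreal m" and m: "m \<ge> 0"
  shows "(\<integral>\<^sup>+x. ennreal (two_power p q \<bar>u x\<bar>) \<partial>lborel) \<le>
    ennreal (2 powr e * M * (d powr (q - e) / (1 - 2 powr (e - q)) + 2 powr (p - e) * d powr (e - p) / (1 - 2 powr (p - e)))
      + (1 / d) powr p * m)"
proof -
  define c1 where "c1 = 2 powr e * M * d powr (q - e) / (1 - (1/2) powr (q - e))"
  define c2 where "c2 = 2 powr e * M * (2 * (1 / d)) powr (p - e) / (1 - 2 powr (p - e))"
  let ?f1 = "\<lambda>x. ennreal (\<bar>u x\<bar> powr q) * indicator {x. 0 < \<bar>u x\<bar> \<and> \<bar>u x\<bar> \<le> d} x"
  let ?f2 = "\<lambda>x. ennreal (\<bar>u x\<bar> powr p) * indicator {x. 1 / d < \<bar>u x\<bar>} x"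
  let ?f3 = "\<lambda>x. ennreal ((1 / d) powr p) * indicator {x. d < \<bar>u x\<bar>} x"
  have h1: "(1/2::real) powr (q - e) < 1" using pq powr_less_mono2[of "q - e" "1/2::real" 1] by simp
  have h2: "2 powr (p - e) < (1::real)" using pq by (simp add: powr_less_one)
  have "(\<integral>\<^sup>+x. ennreal (two_power p q \<bar>u x\<bar>) \<partial>lborel) \<le> (\<integral>\<^sup>+x. ?f1 x + ?f2 x + ?f3 x \<partial>lborel)"
  proof (rule nn_integral_mono)
    fix x
    define s where "s = \<bar>u x\<bar>"
    have s0: "s \<ge> 0" by (simp add: s_def)
    have d1: "1 / d > 1" using d by simp
    consider "s = 0" | "0 < s" "s \<le> d" | "d < s" "s \<le> 1 / d" | "1 / d < s" using s0 by linarith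
    then show "ennreal (two_power p q \<bar>u x\<bar>) \<le> ?f1 x + ?f2 x + ?f3 x"
    proof cases
      case 1
      then show ?thesis by (simp add: two_power_def s_def)
    next
      case 2
      then have "ennreal (two_power p q \<bar>u x\<bar>) \<le> ?f1 x" using d by (simp add: two_power_def s_def)
      also have "\<dots> \<le> ?f1 x + ?f2 x + ?f3 x" by (simp add: add.assoc)
      finally show ?thesis .
    next
      case 3
      have "two_power p q s \<le> (1 / d) powr p"
      proof (cases "s \<ge> 1")
        case True
        then show ?thesis using 3 pq by (simp add: two_power_def powr_mono2)
      next
        case False
        then have "s powr q \<le> 1" using s0 pq powr_mono2[of q s 1] by simp
        also have "1 \<le> (1 / d) powr p" using d1 pq by (intro ge_one_powr_ge_zero) auto
        finally show ?thesis using False by (simp add: two_power_def)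
      qed
      then have "ennreal (two_power p q \<bar>u x\<bar>) \<le> ?f3 x" using 3 by (simp add: s_def ennreal_leI)
      also have "\<dots> \<le> ?f1 x + ?f2 x + ?f3 x" by simp
      finally show ?thesis .
    next
      case 4
      then have "ennreal (two_power p q \<bar>u x\<bar>) \<le> ?f2 x" using d1 by (simp add: two_power_def s_def)
      also have "\<dots> \<le> ?f1 x + ?f2 x + ?f3 x" by (simp add: add.commute add.left_commute)
      finally show ?thesis .
    qed
  qed
  also have "\<dots> = (\<integral>\<^sup>+x. ?f1 x \<partial>lborel) + (\<integral>\<^sup>+x. ?f2 x \<partial>lborel) + (\<integral>\<^sup>+x. ?f3 x \<partial>lborel)"
    by (subst nn_integral_add, measurable)+
  also have "\<dots> \<le> ennreal c1 + ennreal c2 + ennreal ((1 / d) powr p * m)"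
  proof (intro add_mono)
    show "(\<integral>\<^sup>+x. ?f1 x \<partial>lborel) \<le> ennreal c1"
      unfolding c1_def using d pq h1
      by (intro dyadic_integral_bound[OF um weak M] dyadic_below) auto
    show "(\<integral>\<^sup>+x. ?f2 x \<partial>lborel) \<le> ennreal c2"
      unfolding c2_def using d pq h2
      by (intro dyadic_integral_bound[OF um weak M] dyadic_above) auto
    have "(\<integral>\<^sup>+x. ?f3 x \<partial>lborel) = ennreal ((1 / d) powr p) * emeasure lborel {x. d < \<bar>u x\<bar>}"
      by (subst nn_integral_cmult_indicator) auto
    also have "\<dots> \<le> ennreal ((1 / d) powr p) * ennreal m" using mid by (intro mult_left_mono) auto
    finally show "(\<integral>\<^sup>+x. ?f3 x \<partial>lborel) \<le> ennreal ((1 / d) powr p * m)"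
      using m by (simp add: ennreal_mult)
  qed
  also have "\<dots> = ennreal (c1 + c2 + (1 / d) powr p * m)"
    using M m h1 h2 by (simp add: c1_def c2_def ennreal_plus)
  also have "c1 + c2 = 2 powr e * M * (d powr (q - e) / (1 - 2 powr (e - q)) + 2 powr (p - e) * d powr (e - p) / (1 - 2 powr (p - e)))"
  proof -
    have 1: "(1 / 2) powr (q - e) = (2 powr (e - q) :: real)"
      by (simp add: powr_divide powr_minus_divide[symmetric])
    have 2: "(2 * (1 / d)) powr (p - e) = 2 powr (p - e) * d powr (e - p)"
      using d by (subst powr_mult) (auto simp: powr_divide powr_minus_divide[symmetric])
    show ?thesis unfolding c1_def c2_def 1 2 by (simp add: distrib_left)
  qed
  finally show ?thesis .
qed

text \<open>As d decreases to 0 the bracket tends to 0, since both exponents \<open>q - e\<close>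
  and \<open>e - p\<close> are positive.\<close>

lemma small_interpolation_parameter:
  fixes p e q A :: real
  assumes "p < e" "e < q" "\<eta> > 0"
  obtains d where "0 < d" "d < 1" 
    "A * (d powr (q - e) / (1 - 2 powr (e - q)) + 2 powr (p - e) * d powr (e - p) / (1 - 2 powr (p - e))) < \<eta>"
proof -
  have id: "((\<lambda>d::real. d) \<longlongrightarrow> 0) (at_right 0)" by (rule tendsto_ident_at)
  have ev: "\<forall>\<^sub>F d in at_right (0::real). 0 \<le> d" 
    using eventually_at_right_less[of "0::real"] by eventually_elim simp
  have 1: "((\<lambda>d. d powr (q - e)) \<longlongrightarrow> 0) (at_right 0)" "((\<lambda>d. d powr (e - p)) \<longlongrightarrow> 0) (at_right 0)"
    using assms by (auto intro!: tendsto_zero_powrI[OF id tendsto_const ev])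
  have "((\<lambda>d. A * (d powr (q - e) / (1 - 2 powr (e - q)) + 2 powr (p - e) * d powr (e - p) / (1 - 2 powr (p - e)))) 
      \<longlongrightarrow> A * (0 / (1 - 2 powr (e - q)) + 2 powr (p - e) * 0 / (1 - 2 powr (p - e)))) (at_right 0)"
    unfolding divide_inverse by (intro tendsto_mult tendsto_add tendsto_const 1)
  then have "\<forall>\<^sub>F d in at_right 0. A * (d powr (q - e) / (1 - 2 powr (e - q)) + 2 powr (p - e) * d powr (e - p) / (1 - 2 powr (p - e))) < \<eta>"
    using assms(3) by (auto dest: order_tendstoD(2))
  moreover have "\<forall>\<^sub>F d in at_right (0::real). 0 < d \<and> d < 1"
    by (rule eventually_at_rightI[of 0 1]) auto
  ultimately have "\<exists>d. 0 < d \<and> d < 1 \<and> A * (d powr (q - e) / (1 - 2 powr (e - q)) + 2 powr (p - e) * d powr (e - p) / (1 - 2 powr (p - e))) < \<eta>"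
    by (intro eventually_happens'[of "at_right (0::real)"]) (auto elim: eventually_elim2)
  with that show ?thesis by blast
qed

text \<open>The parameters are fixed in the order d, h, n, R, each depending on K, \<eta> and the
  earlier ones but not on u. Half of \<eta> is spent on the values of u outside the range from d to
  1/d, half on those inside.\<close>

lemma invariant_far_two_power_small:
  fixes p q K \<eta> :: real
  assumes m: "CARD('m::finite) \<ge> 2" and pq: "0 < p" "p < crit_exp (CARD('m) + 2)" "crit_exp (CARD('m) + 2) < q"
    and K: "K > 0" and \<eta>: "\<eta> > 0"
  obtains R where "R > 0" 
    "\<And>u :: complex \<times> (real^'m) \<Rightarrow> real. u \<in> D12_0 (ext_domain R) \<Longrightarrow> invariant Gamma_inf u \<Longrightarrow> 
      (D12_norm u)\<^sup>2 \<le> K \<Longrightarrow> 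
      (\<integral>\<^sup>+x. ennreal (two_power p q \<bar>u x\<bar>) \<partial>lebesgue) \<le> ennreal (\<eta> * (D12_norm u)\<^sup>2)"
proof -
  define N where "N = DIM(complex \<times> (real^'m))"
  have N2: "N = CARD('m) + 2" by (simp add: N_def)
  have N: "N \<ge> 3" using m by (simp add: N2)
  define e where "e = crit_exp N"
  have e2: "e > 2" using N by (simp add: e_def crit_exp_def pos_less_divide_eq)
  have pe: "p < e" and eq: "e < q" using pq by (simp_all add: e_def N2)
  define C where "C = weak_sobolev_const N"
  have C: "C \<ge> 0" by (simp add: C_def weak_sobolev_const_def)
  define A where "A = 2 powr e * (C * K powr (e / 2 - 1))"
  obtain d where d: "0 < d" "d < 1" 
    "A * (d powr (q - e) / (1 - 2 powr (e - q)) + 2 powr (p - e) * d powr (e - p) / (1 - 2 powr (p - e))) < \<eta> / 2"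
    using small_interpolation_parameter[OF pe eq, of "\<eta> / 2" A] \<eta> by auto
  \<comment> \<open>h solves the equation stated next: the measure bound 8 h^2 k / d^2 of
    \<open>level_set_bound\<close>, times the largest integrand on the middle range, is \<eta> k /
    2.\<close>
  define h where "h = sqrt (\<eta> * d\<^sup>2 / (16 * (1 / d) powr p))"
  have h: "h > 0" using d \<eta> by (simp add: h_def)
  have h2: "(1 / d) powr p * (8 * h\<^sup>2 / d\<^sup>2) = \<eta> / 2"
    using d \<eta> by (simp add: h_def field_simps)
  define V where "V = measure lborel (ball (0::complex \<times> (real^'m)) h)"
  have V: "V > 0" unfolding V_def using h by (rule content_ball_pos)
  \<comment> \<open>Q bounds the measure of {|u| > d/2} for all u of squared norm at most K. The
    choice of n below makes Q / n at most half the volume V of the ball.\<close>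
  define Q where "Q = C * K powr (e / 2) / (d / 2) powr e"
  have Q: "Q \<ge> 0" using C by (simp add: Q_def)
  obtain n :: nat where n: "2 * Q / V \<le> real n" "n > 0"
    using real_arch_simple[of "max 1 (2 * Q / V)"] by (metis max.bounded_iff of_nat_0_less_iff less_le_trans zero_less_one)
  \<comment> \<open>For norm x > R the orbit points of \<open>Gamma_inf_orbit\<close> have distance
    at least norm x / (2 n) > 2 h.\<close>
  define R where "R = 4 * h * real n"
  have R: "R > 0" using h n by (simp add: R_def)
  show ?thesis
  proof (rule that[OF R])
    fix u :: "complex \<times> (real^'m) \<Rightarrow> real"
    assume u: "u \<in> D12_0 (ext_domain R)" and inv: "invariant Gamma_inf u" and uK: "(D12_norm u)\<^sup>2 \<le> K"
    define k where "k = (D12_norm u)\<^sup>2"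
    have k0: "k \<ge> 0" by (simp add: k_def)
    have uD: "u \<in> D12" using u by (simp add: D12_0_def)
    obtain v where vm[measurable]: "v \<in> borel_measurable borel" and uv: "AE x in lborel. u x = v x"
      and vi: "integrable lborel (\<lambda>x. \<bar>v x\<bar> powr crit_exp DIM(complex \<times> (real^'m)))"
      and tr: "\<And>\<xi>. (\<integral>\<^sup>+x. ennreal ((v (x + \<xi>) - v x)\<^sup>2) \<partial>lborel) \<le> ennreal ((norm \<xi>)\<^sup>2 * k)"
      using D12_borel_representative[OF uD] unfolding k_def by blast
    define M where "M = C * k powr (e / 2)"
    have M: "M \<ge> 0" using C by (simp add: M_def)
    have weak: "emeasure lborel {x. \<bar>v x\<bar> > t} \<le> ennreal (M / t powr e)" if "t > 0" for t
      unfolding M_def C_def e_def N_def by (rule weak_sobolev[OF vm N[unfolded N_def] vi tr k0 that])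
    have vinv: "AE x in lborel. v (g x) = v x" if g: "g \<in> Gamma_inf" for g
    proof -
      have "AE x in lborel. u (g x) = u x"
        using inv g by (simp add: invariant_def AE_completion_iff)
      \<comment> \<open>Invariance is known for u. Passing to v at the point g x requires that g
        pulls null sets back to null sets.\<close>
      with uv AE_compose_orthogonal[OF Gamma_inf_orthogonal[OF g] uv] show ?thesis
        by eventually_elim simp
    qed
    have far: "AE x in lborel. \<bar>v x\<bar> > d \<longrightarrow> norm x > R"
      using D12_0_AE_zero[OF N[unfolded N_def] u] uv by eventually_elim (use d in force)
    have "AE x in lborel. \<bar>v x\<bar> > d \<longrightarrow> 
      emeasure lborel (ball x h \<inter> {y. \<bar>v y\<bar> > d / 2}) \<le> ennreal (V / 2)"
      using far
    proof eventually_elim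
      case (elim x)
      show ?case
      proof
        assume "\<bar>v x\<bar> > d"
        then have x: "norm x > R" using elim by simp
        obtain g where g: "\<And>i. i < n \<Longrightarrow> g i \<in> Gamma_inf" 
          and sep: "\<And>i j. i < j \<Longrightarrow> j < n \<Longrightarrow> norm x / (2 * real n) \<le> dist (g i x) (g j x)"
          using Gamma_inf_orbit[OF m] by metis
        have hx: "2 * h \<le> norm x / (2 * real n)"
          using x n by (simp add: R_def field_simps)
        let ?m = "emeasure lborel (ball x h \<inter> {y. \<bar>v y\<bar> > d / 2})"
        have "of_nat n * ?m \<le> emeasure lborel {y. \<bar>v y\<bar> > d / 2}"
          by (rule ball_measure_le_by_orbit[OF vm, where g = g])
            (use g sep hx in \<open>auto intro: Gamma_inf_orthogonal vinv order_trans\<close>)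
        also have "\<dots> \<le> ennreal (M / (d / 2) powr e)" using d by (intro weak) simp
        also have "\<dots> \<le> ennreal Q"
          unfolding M_def Q_def using C uK k0 e2
          by (intro ennreal_leI divide_right_mono mult_left_mono powr_mono2) (auto simp: k_def)
        finally have "?m * ennreal (real n) \<le> ennreal Q" by (simp add: mult.commute ennreal_of_nat_eq_real_of_nat)
        then have "?m \<le> ennreal (Q / real n)" using n Q by (intro ennreal_le_divideI) auto
        also have "\<dots> \<le> ennreal (V / 2)" using n V by (intro ennreal_leI) (simp add: field_simps)
        finally show "?m \<le> ennreal (V / 2)" .
      qed
    qed
    from level_set_bound[OF vm tr k0 h d(1) this[unfolded V_def]]
    have mid: "emeasure lborel {x. \<bar>v x\<bar> > d} \<le> ennreal (8 * h\<^sup>2 * k / d\<^sup>2)" .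
    have "(\<integral>\<^sup>+x. ennreal (two_power p q \<bar>u x\<bar>) \<partial>lebesgue) = (\<integral>\<^sup>+x. ennreal (two_power p q \<bar>v x\<bar>) \<partial>lborel)"
      unfolding nn_integral_completion by (rule nn_integral_cong_AE) (use uv in auto)
    also have "\<dots> \<le> ennreal (2 powr e * M * (d powr (q - e) / (1 - 2 powr (e - q)) + 2 powr (p - e) * d powr (e - p) / (1 - 2 powr (p - e)))
      + (1 / d) powr p * (8 * h\<^sup>2 * k / d\<^sup>2))"
      by (rule two_power_integral_bound[OF vm weak M pq(1) pe eq d(1,2) mid]) (use k0 in auto)
    also have "\<dots> \<le> ennreal (\<eta> * k)"
    proof (rule ennreal_leI)
      let ?X = "d powr (q - e) / (1 - 2 powr (e - q)) + 2 powr (p - e) * d powr (e - p) / (1 - 2 powr (p - e))"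
      have "1 - 2 powr (e - q) > (0::real)" "1 - 2 powr (p - e) > (0::real)" 
        using pe eq by (simp_all add: powr_less_one)
      then have X: "?X \<ge> 0" by (intro add_nonneg_nonneg divide_nonneg_nonneg) auto
      \<comment> \<open>Since e > 2, one factor k can be split off and the rest estimated by K; this
        makes the bound linear in k.\<close>
      have "k powr (e / 2) = k * k powr (e / 2 - 1)"
        using k0 by (cases "k = 0") (simp_all add: powr_diff)
      also have "\<dots> \<le> k * K powr (e / 2 - 1)"
        using k0 uK e2 by (intro mult_left_mono powr_mono2) (auto simp: k_def)
      finally have "2 powr e * M * ?X \<le> 2 powr e * (C * (k * K powr (e / 2 - 1))) * ?X"
        unfolding M_def using C X by (intro mult_right_mono mult_left_mono) auto
      also have "\<dots> = A * ?X * k" by (simp add: A_def mult_ac)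
      also have "\<dots> \<le> \<eta> / 2 * k" using d(3) k0 by (intro mult_right_mono) auto
      finally have "2 powr e * M * ?X \<le> \<eta> / 2 * k" .
      moreover have "(1 / d) powr p * (8 * h\<^sup>2 * k / d\<^sup>2) = \<eta> / 2 * k"
        using h2 by (metis (no_types, lifting) mult.assoc mult.commute times_divide_eq_left)
      ultimately have "2 powr e * M * ?X + (1 / d) powr p * (8 * h\<^sup>2 * k / d\<^sup>2) \<le> \<eta> / 2 * k + \<eta> / 2 * k"
        by (intro add_mono) simp_all
      also have "\<dots> = \<eta> * k" by simp
      finally show "2 powr e * M * ?X + (1 / d) powr p * (8 * h\<^sup>2 * k / d\<^sup>2) \<le> \<eta> * k" .
    qed
    finally show "(\<integral>\<^sup>+x. ennreal (two_power p q \<bar>u x\<bar>) \<partial>lebesgue) \<le> ennreal (\<eta> * (D12_norm u)\<^sup>2)"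
      by (simp add: k_def)
  qed
qed

subsection \<open>The Nehari set\<close>

lemma odd_ext_primitive_deriv:
  assumes c: "continuous_on {0..} f" and f0: "f 0 = 0"
  shows "(primitive (odd_ext f) has_real_derivative odd_ext f s) (at s)"
proof -
  \<comment> \<open>The two branches agree at 0 because f 0 = 0.\<close>
  have un: "continuous_on ({0..} \<union> {..0}) (\<lambda>s. if s \<ge> 0 then f s else - f (- s))"
  proof (rule continuous_on_If)
    show "continuous_on {..0} (\<lambda>s. - f (- s))"
      by (intro continuous_on_minus continuous_on_compose2[OF c]) (auto intro: continuous_intros)
  qed (use c f0 in auto)
  have "{0..} \<union> {..0} = (UNIV :: real set)" by auto
  with un have cont: "continuous_on UNIV (odd_ext f)" by (simp add: odd_ext_def[abs_def])
  \<comment> \<open>The interval from -b to b contains the base point 0 and has s in its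
    interior.\<close>
  define b where "b = \<bar>s\<bar> + 1"
  have "((\<lambda>u. LBINT y=ereal 0..ereal u. odd_ext f y) has_vector_derivative odd_ext f s) (at s within {- b..b})"
    by (rule interval_integral_FTC2) (use cont in \<open>auto simp: b_def intro: continuous_on_subset\<close>)
  then have "((\<lambda>u. LBINT y=ereal 0..ereal u. odd_ext f y) has_vector_derivative odd_ext f s) (at s)"
    by (subst (asm) at_within_Icc_at) (auto simp: b_def)
  then show ?thesis
    by (simp add: has_real_derivative_iff_has_vector_derivative primitive_def[abs_def])
qed

lemma primitive_odd_ext_nonneg:
  assumes "s \<ge> 0" shows "primitive (odd_ext f) s = primitive f s"
  unfolding primitive_def using assms
  by (intro interval_integral_cong) (auto simp: odd_ext_def einterval_def)

text \<open>The difference of the two sides has derivative 0, the integrand being odd, and it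
  vanishes at s = 0.\<close>

lemma primitive_odd_ext_even:
  assumes c: "continuous_on {0..} f" and f0: "f 0 = 0"
  shows "primitive (odd_ext f) (- s) = primitive (odd_ext f) s"
proof -
  let ?F = "primitive (odd_ext f)"
  note D = odd_ext_primitive_deriv[OF c f0]
  have "((\<lambda>s. ?F s - ?F (- s)) has_real_derivative odd_ext f s - odd_ext f (- s) * (- 1)) (at s)" for s
    by (intro DERIV_diff D DERIV_chain2[OF D]) (auto intro!: derivative_eq_intros)
  moreover have "odd_ext f s - odd_ext f (- s) * (- 1) = 0" for s
    using f0 by (auto simp: odd_ext_def)
  ultimately have "\<forall>s. ((\<lambda>s. ?F s - ?F (- s)) has_real_derivative 0) (at s)" by simp
  from DERIV_isconst_all[OF this, of s 0] show ?thesis by simp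
qed

text \<open>The two inequalities along a ray come from convexity of \<open>F\<close> together with
  \<open>\<theta> F s \<le> s F' s\<close>.\<close>

definition superquadratic :: "(real \<Rightarrow> real) \<Rightarrow> real \<Rightarrow> real \<Rightarrow> real \<Rightarrow> real \<Rightarrow> bool" where
  "superquadratic F A p q \<theta> \<longleftrightarrow> F \<in> borel_measurable borel \<and> (\<forall>s. F (- s) = F s) \<and> (\<forall>s\<ge>0. F s \<ge> 0) \<and>
    (\<forall>s\<ge>0. \<forall>t\<in>{0..1}. (1 + t * \<theta>) * F s \<le> F ((1 + t) * s) \<and> F ((1 + t) * s) \<le> F s + t * F (2 * s)) \<and>
    (\<forall>s\<ge>0. F (2 * s) \<le> A * two_power p q s)"

lemma superquadratic_primitive:
  fixes f f' :: "real \<Rightarrow> real"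
  assumes f1: "f1 N f f'" and f2: "f2 f f'"
  shows "\<exists>A>0. \<exists>p q. 2 < p \<and> p < crit_exp N \<and> crit_exp N < q \<and>
    (\<exists>\<theta>>2. superquadratic (primitive (odd_ext f)) A p q \<theta>)"
proof -
  define F where "F = primitive (odd_ext f)"
  obtain A p q where A: "A > 0" and p: "2 < p" "p < crit_exp N" and q: "crit_exp N < q"
    and b: "\<forall>s\<ge>1. \<bar>primitive f s\<bar> \<le> A * s powr p \<and> \<bar>f s\<bar> \<le> A * s powr (p - 1) \<and> \<bar>f' s\<bar> \<le> A * s powr (p - 2)"
    "\<forall>s\<in>{0..1}. \<bar>primitive f s\<bar> \<le> A * s powr q \<and> \<bar>f s\<bar> \<le> A * s powr (q - 1) \<and> \<bar>f' s\<bar> \<le> A * s powr (q - 2)"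
    using f1 unfolding f1_def by (elim conjE exE) (rule that; assumption)
  have b1: "\<bar>primitive f s\<bar> \<le> A * s powr p" if "s \<ge> 1" for s using b(1) that by blast
  have b2: "\<bar>primitive f s\<bar> \<le> A * s powr q" if "s \<in> {0..1}" for s using b(2) that by blast
  have b3: "\<bar>f s\<bar> \<le> A * s powr (q - 1)" if "s \<in> {0..1}" for s using b(2) that by blast
  have fD: "(f has_real_derivative f' s) (at s within {0..})" if "s \<ge> 0" for s
    by (rule conjunct1[OF f1[unfolded f1_def], rule_format, OF that])
  obtain \<theta> where \<theta>: "\<theta> > 2" and f2': "\<forall>s>0. 0 \<le> \<theta> * primitive f s \<and> \<theta> * primitive f s \<le> f s * s \<and> f s * s < f' s * s\<^sup>2"
    using f2 unfolding f2_def by (elim exE conjE) (rule that; assumption)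
  have ar: "0 \<le> \<theta> * primitive f s" "\<theta> * primitive f s \<le> f s * s" "f s * s < f' s * s\<^sup>2" if "s > 0" for s
    using f2' that by blast+
  \<comment> \<open>As \<open>0 powr (q - 1)\<close> is 0, the growth bound at s = 0 forces this
    value.\<close>
  have f0: "f 0 = 0" using b3[of 0] by simp
  have fc: "continuous_on {0..} f"
    unfolding continuous_on_eq_continuous_within by (intro ballI DERIV_continuous[OF fD]) simp
  note D = odd_ext_primitive_deriv[OF fc f0, folded F_def]
  have Fp: "F s = primitive f s" if "s \<ge> 0" for s
    unfolding F_def using that by (rule primitive_odd_ext_nonneg)
  have F0: "F 0 = 0" by (simp add: F_def primitive_def)
  have Fpos: "F s \<ge> 0" if "s \<ge> 0" for s
  proof (cases "s = 0")
    case False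
    then have "0 \<le> \<theta> * primitive f s" using that by (intro ar(1)) simp
    then show ?thesis using \<theta> by (simp add: Fp[OF that] zero_le_mult_iff)
  qed (simp add: F0)
  have Fc: "continuous_on UNIV F"
    by (intro continuous_at_imp_continuous_on ballI DERIV_isCont[OF D])
  \<comment> \<open>The chain in (f2) starts at 0 and ends with \<open>f' s * s\<^sup>2\<close>. So
    f is increasing, and its primitive is convex.\<close>
  have f'pos: "f' s \<ge> 0" if "s > 0" for s
  proof -
    have "0 < f' s * s\<^sup>2" by (rule le_less_trans[OF order_trans[OF ar(1,2)] ar(3)]) (rule that)+
    then show ?thesis using that by (simp add: zero_less_mult_iff)
  qed
  have mono: "f x \<le> f y" if xy: "0 \<le> x" "x \<le> y" for x y
  proof (rule DERIV_nonneg_imp_increasing_open[OF xy(2)])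
    show "\<exists>d. (f has_real_derivative d) (at z) \<and> 0 \<le> d" if "x < z" "z < y" for z
    proof -
      have "z \<in> interior {0..}" using that xy by (simp add: interior_real_atLeast)
      then have "at z within {0..} = at z" by (rule at_within_interior)
      moreover have "(f has_real_derivative f' z) (at z within {0..})" using that xy by (intro fD) simp
      moreover have "0 \<le> f' z" using that xy by (intro f'pos) simp
      ultimately show ?thesis by (intro exI[of _ "f' z"]) simp
    qed
    show "continuous_on {x..y} f" using fc by (rule continuous_on_subset) (use xy in auto)
  qed
  have convex: "convex_on {0..} F"
    by (rule convex_on_realI[OF _ D]) (simp_all add: odd_ext_def mono)
  have lower: "(1 + t * \<theta>) * F s \<le> F ((1 + t) * s)" if st: "s \<ge> 0" "0 \<le> t" "t \<le> 1" for s t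
  proof (cases "t * s = 0")
    case False
    then have pos: "t > 0" "s > 0" using st by auto
    then have lt: "s < (1 + t) * s" by simp
    \<comment> \<open>The intermediate point z lies to the right of s, so f z >= f s, and f s * s >=
      \<theta> F s by (f2).\<close>
    from MVT2[OF lt, of F "odd_ext f", OF D] obtain z 
      where z: "s < z" "z < (1 + t) * s" "F ((1 + t) * s) - F s = ((1 + t) * s - s) * odd_ext f z"
      by blast
    have "t * (\<theta> * F s) \<le> t * (f s * s)"
      using pos ar(2)[of s] Fp[of s] by (intro mult_left_mono) auto
    also have "\<dots> \<le> t * (f z * s)"
      using pos z mono[of s z] by (intro mult_left_mono mult_right_mono) auto
    also have "\<dots> = F ((1 + t) * s) - F s"
      using z pos by (simp add: odd_ext_def algebra_simps)
    finally show ?thesis by (simp add: algebra_simps)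
  qed (auto simp: F0)
  have upper: "F ((1 + t) * s) \<le> F s + t * F (2 * s)" if st: "s \<ge> 0" "0 \<le> t" "t \<le> 1" for s t
  proof -
    \<comment> \<open>The point (1 + t) s divides the segment from s to 2 s in the ratio t. This is
      the origin of the argument 2 s in the growth condition.\<close>
    have "F ((1 - t) *\<^sub>R s + t *\<^sub>R (2 * s)) \<le> (1 - t) * F s + t * F (2 * s)"
      by (rule convex_onD[OF convex]) (use st in auto)
    also have "(1 - t) *\<^sub>R s + t *\<^sub>R (2 * s) = (1 + t) * s" by (simp add: algebra_simps)
    also have "(1 - t) * F s \<le> F s" using Fpos[OF st(1)] st by (simp add: mult_left_le_one_le)
    finally show ?thesis by simp
  qed
  have growth: "F (2 * s) \<le> A * 2 powr q * two_power p q s" if s: "s \<ge> 0" for s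
  proof (cases "s \<ge> 1")
    case True
    have "F (2 * s) \<le> A * (2 * s) powr p" using b1[of "2 * s"] Fp[of "2 * s"] True by simp
    also have "\<dots> = A * 2 powr p * s powr p" using True by (simp add: powr_mult)
    also have "\<dots> \<le> A * 2 powr q * s powr p" using A p q by (intro mult_right_mono mult_left_mono) auto
    finally show ?thesis using True by (simp add: two_power_def)
  next
    case False
    have "F (2 * s) \<le> A * (2 * s) powr q"
    proof (cases "2 * s \<ge> 1")
      \<comment> \<open>For 1/2 <= s < 1 the argument 2 s already falls into the range of the
        exponent p, and enlarging p to q is allowed because 2 s >= 1.\<close>
      case True
      have "F (2 * s) \<le> A * (2 * s) powr p" using b1[OF True] Fp[of "2 * s"] s by simp
      also have "\<dots> \<le> A * (2 * s) powr q" using A p q True by (intro mult_left_mono powr_mono) auto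
      finally show ?thesis .
    next
      case False
      then show ?thesis using b2[of "2 * s"] Fp[of "2 * s"] s by simp
    qed
    also have "\<dots> = A * 2 powr q * s powr q" using s by (simp add: powr_mult)
    finally show ?thesis using False by (simp add: two_power_def)
  qed
  have "superquadratic F (A * 2 powr q) p q \<theta>"
    unfolding superquadratic_def
  proof (intro conjI allI ballI impI)
    show "F \<in> borel_measurable borel" by (rule borel_measurable_continuous_onI[OF Fc])
    show "F (- s) = F s" for s unfolding F_def by (rule primitive_odd_ext_even[OF fc f0])
    show "F s \<ge> 0" if "0 \<le> s" for s using that by (rule Fpos)
    show "(1 + t * \<theta>) * F s \<le> F ((1 + t) * s)" if "0 \<le> s" "t \<in> {0..1}" for s t
      using that by (intro lower) auto
    show "F ((1 + t) * s) \<le> F s + t * F (2 * s)" if "0 \<le> s" "t \<in> {0..1}" for s t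
      using that by (intro upper) auto
    show "F (2 * s) \<le> A * 2 powr q * two_power p q s" if "0 \<le> s" for s using that by (rule growth)
  qed
  then show ?thesis
    using A p q \<theta> unfolding F_def
    by (intro exI[of _ "A * 2 powr q"] exI[of _ p] exI[of _ q] exI[of _ \<theta>] conjI) simp_all
qed

section \<open>The energy along the ray through a Nehari element\<close>

lemma le_from_approx:
  fixes x y c :: real
  assumes "\<And>\<epsilon>. \<epsilon> > 0 \<Longrightarrow> x \<le> y + \<epsilon> * c" "c \<ge> 0"
  shows "x \<le> y"
proof (rule field_le_epsilon)
  fix d :: real assume "d > 0"
  then have "x \<le> y + d / (c + 1) * c" by (intro assms(1) divide_pos_pos) (use assms(2) in auto)
  moreover have "d / (c + 1) * c \<le> d" using assms(2) \<open>d > 0\<close> by (simp add: field_simps)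
  ultimately show "x \<le> y + d" by linarith
qed

lemma D12_scale:
  fixes u :: "'a::euclidean_space \<Rightarrow> real"
  assumes "u \<in> D12"
  shows "(\<lambda>x. c * u x) \<in> D12" "D12_norm (\<lambda>x. c * u x) = \<bar>c\<bar> * D12_norm u"
proof -
  obtain g where g: "has_weak_gradient u g" "integrable lebesgue (\<lambda>x. (norm (g x))\<^sup>2)"
    using assms by (auto simp: D12_def)
  note gc = has_weak_gradient_scale[OF g(1), of c]
  have gi: "integrable lebesgue (\<lambda>x. (norm (c *\<^sub>R g x))\<^sup>2)"
    using integrable_mult_right[OF g(2), of "c\<^sup>2"] by (simp add: power_mult_distrib)
  have "integrable lebesgue (\<lambda>x. \<bar>c\<bar> powr crit_exp DIM('a) * \<bar>u x\<bar> powr crit_exp DIM('a))"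
    using assms by (intro integrable_mult_right) (simp add: D12_def)
  then show "(\<lambda>x. c * u x) \<in> D12"
    using assms gc gi by (auto simp: D12_def abs_mult powr_mult intro!: borel_measurable_times)
  have "(D12_norm (\<lambda>x. c * u x))\<^sup>2 = (\<bar>c\<bar> * D12_norm u)\<^sup>2"
    by (simp add: D12_norm_eq[OF gc] D12_norm_eq[OF g(1)] power_mult_distrib)
  then show "D12_norm (\<lambda>x. c * u x) = \<bar>c\<bar> * D12_norm u"
    using D12_norm_nonneg[of "\<lambda>x. c * u x"] D12_norm_nonneg[of u] by (simp add: power2_eq_iff_nonneg)
qed

text \<open>Only one-sided difference quotients of the energy along the ray through \<open>u\<close> are used:
  convexity of \<open>F\<close> bounds those of \<open>\<integral> F\<close>, so no differentiation under the integral is needed.\<close>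

lemma nehari_bounds:
  fixes u :: "'a::euclidean_space \<Rightarrow> real"
  assumes u: "u \<in> D12" and L: "has_D12_derivative (energy f) L u" "L u = 0"
    and F: "superquadratic F A p q \<theta>" and Fdef: "F = primitive f" and \<theta>: "\<theta> > 0"
    and pq: "p < crit_exp DIM('a)" "crit_exp DIM('a) < q" and A: "A > 0"
  shows "\<theta> * (\<integral>x. F (u x) \<partial>lebesgue) \<le> (D12_norm u)\<^sup>2"
    "(D12_norm u)\<^sup>2 \<le> A * (\<integral>x. two_power p q \<bar>u x\<bar> \<partial>lebesgue)"
    "integrable lebesgue (\<lambda>x. two_power p q \<bar>u x\<bar>)"
proof -
  have Fm[measurable]: "F \<in> borel_measurable borel"
    and even: "\<And>s. F (- s) = F s" and pos: "\<And>s. s \<ge> 0 \<Longrightarrow> F s \<ge> 0"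
    and lower: "\<And>s t. s \<ge> 0 \<Longrightarrow> 0 \<le> t \<Longrightarrow> t \<le> 1 \<Longrightarrow> (1 + t * \<theta>) * F s \<le> F ((1 + t) * s)"
    and upper: "\<And>s t. s \<ge> 0 \<Longrightarrow> 0 \<le> t \<Longrightarrow> t \<le> 1 \<Longrightarrow> F ((1 + t) * s) \<le> F s + t * F (2 * s)"
    and growth: "\<And>s. s \<ge> 0 \<Longrightarrow> F (2 * s) \<le> A * two_power p q s"
    using F by (simp_all add: superquadratic_def)
  define k where "k = (D12_norm u)\<^sup>2"
  define r where "r = D12_norm u"
  have r0: "r \<ge> 0" by (simp add: r_def D12_norm_nonneg)
  have um[measurable]: "u \<in> borel_measurable lebesgue"
    and ui: "integrable lebesgue (\<lambda>x. \<bar>u x\<bar> powr crit_exp DIM('a))"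
    using u by (auto simp: D12_def)
  \<comment> \<open>The conditions in \<open>superquadratic\<close> concern s >= 0; evenness
    transfers them to |u x|.\<close>
  have Fabs: "F (c * u x) = F (c * \<bar>u x\<bar>)" for c x
    using even[of "c * u x"] by (cases "u x \<ge> 0") (auto simp: abs_if)
  have Fcomp[measurable]: "(\<lambda>x. F (c * u x)) \<in> borel_measurable lebesgue" for c
    by (rule measurable_compose[OF _ Fm]) measurable
  have tm[measurable]: "(\<lambda>x. two_power p q \<bar>u x\<bar>) \<in> borel_measurable lebesgue"
    by (rule measurable_compose[OF _ two_power_measurable]) measurable
  show ti: "integrable lebesgue (\<lambda>x. two_power p q \<bar>u x\<bar>)"
  proof (rule Bochner_Integration.integrable_bound[OF ui])
    have "two_power p q s \<le> s powr crit_exp DIM('a)" if "s \<ge> 0" for s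
      using that pq powr_mono'[of "crit_exp DIM('a)" q s] by (auto simp: two_power_def intro: powr_mono)
    then show "AE x in lebesgue. norm (two_power p q \<bar>u x\<bar>) \<le> norm (\<bar>u x\<bar> powr crit_exp DIM('a))"
      using two_power_nonneg by (intro AE_I2) simp
  qed measurable
  have F2i: "integrable lebesgue (\<lambda>x. F (2 * u x))"
  proof (rule Bochner_Integration.integrable_bound[OF integrable_mult_right[OF ti, of A]])
    show "AE x in lebesgue. norm (F (2 * u x)) \<le> norm (A * two_power p q \<bar>u x\<bar>)"
      using growth pos A two_power_nonneg[of p q] by (intro AE_I2) (simp add: Fabs abs_mult)
  qed measurable
  have Fle: "F s \<le> F (2 * s)" if "s \<ge> 0" for s
  proof -
    have "(1 + 1 * \<theta>) * F s \<le> F (2 * s)" using lower[of s 1] that by simp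
    moreover have "1 * F s \<le> (1 + 1 * \<theta>) * F s" using pos[OF that] \<theta> by (intro mult_right_mono) auto
    ultimately show ?thesis by simp
  qed
  have Fi: "integrable lebesgue (\<lambda>x. F ((1 + t) * u x))" if t: "0 \<le> t" "t \<le> 1" for t
  proof (rule Bochner_Integration.integrable_bound[OF integrable_mult_right[OF F2i, of 2]])
    show "AE x in lebesgue. norm (F ((1 + t) * u x)) \<le> norm (2 * F (2 * u x))"
    proof (rule AE_I2)
      fix x
      define s where "s = \<bar>u x\<bar>"
      have s: "s \<ge> 0" by (simp add: s_def)
      have "F ((1 + t) * s) \<le> F (2 * s) + 1 * F (2 * s)"
        using upper[OF s t] Fle[OF s] mult_right_mono[of t 1 "F (2 * s)"] t pos[of "2 * s"] s by simp
      then show "norm (F ((1 + t) * u x)) \<le> norm (2 * F (2 * u x))"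
        using pos[of "(1 + t) * s"] pos[of "2 * s"] s t by (simp add: Fabs s_def)
    qed
  qed measurable
  define \<Phi> where "\<Phi> t = (\<integral>x. F ((1 + t) * u x) \<partial>lebesgue)" for t
  define \<Psi> where "\<Psi> = (\<integral>x. F (2 * u x) \<partial>lebesgue)"
  have F0i: "integrable lebesgue (\<lambda>x. F (u x))" using Fi[of 0] by simp
  have \<Phi>l: "(1 + t * \<theta>) * \<Phi> 0 \<le> \<Phi> t" if t: "0 \<le> t" "t \<le> 1" for t
  proof -
    have "(\<integral>x. (1 + t * \<theta>) * F (u x) \<partial>lebesgue) \<le> \<Phi> t"
      unfolding \<Phi>_def
      using lower[OF _ t] Fabs[of 1] by (intro integral_mono integrable_mult_right F0i Fi t) (simp add: Fabs)
    then show ?thesis by (simp add: \<Phi>_def)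
  qed
  have \<Phi>u: "\<Phi> t \<le> \<Phi> 0 + t * \<Psi>" if t: "0 \<le> t" "t \<le> 1" for t
  proof -
    have "\<Phi> t \<le> (\<integral>x. F (u x) + t * F (2 * u x) \<partial>lebesgue)"
      unfolding \<Phi>_def
      using upper[OF _ t] Fabs[of 1]
      by (intro integral_mono Bochner_Integration.integrable_add integrable_mult_right F0i F2i Fi t) (simp add: Fabs)
    also have "\<dots> = \<Phi> 0 + t * \<Psi>" using F0i F2i by (simp add: \<Phi>_def \<Psi>_def)
    finally show ?thesis .
  qed
  have en: "energy f (\<lambda>x. u x + t * u x) = 1 / 2 * ((1 + t)\<^sup>2 * k) - \<Phi> t" if "t \<ge> 0" for t
  proof -
    have "(\<lambda>x. u x + t * u x) = (\<lambda>x. (1 + t) * u x)" by (simp add: algebra_simps)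
    then show ?thesis
      using D12_scale(2)[OF u, of "1 + t"] that
      by (simp add: energy_def \<Phi>_def Fdef k_def power_mult_distrib)
  qed
  have Lt: "L (\<lambda>x. t * u x) = 0" for t
  proof -
    have "L (\<lambda>x. t * u x + 0 * u x) = t * L u + 0 * L u"
      using L(1) u unfolding has_D12_derivative_def by blast
    then show ?thesis using L(2) by simp
  qed
  \<comment> \<open>The expression in absolute values is the difference quotient of the energy from
    u to (1 + t) u. It is small because L vanishes along the ray.\<close>
  have key: "\<exists>t>0. t \<le> 1 \<and> t \<le> \<epsilon> \<and> \<bar>(1 + t / 2) * k - (\<Phi> t - \<Phi> 0) / t\<bar> \<le> \<epsilon> * r" if \<epsilon>: "\<epsilon> > 0" for \<epsilon>
  proof -
    obtain \<delta> where \<delta>: "\<delta> > 0" "\<And>v. v \<in> D12 \<Longrightarrow> D12_norm v < \<delta> \<Longrightarrow>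
        \<bar>energy f (\<lambda>x. u x + v x) - energy f u - L v\<bar> \<le> \<epsilon> * D12_norm v"
      using L(1) \<epsilon> unfolding has_D12_derivative_def by blast
    \<comment> \<open>The denominator with r + 1 keeps the quotient meaningful for r = 0 and gives t
      * r <= \<delta> / 2.\<close>
    define t where "t = Min {1, \<epsilon>, \<delta> / (2 * (r + 1))}"
    have t: "t > 0" "t \<le> 1" "t \<le> \<epsilon>" "t \<le> \<delta> / (2 * (r + 1))"
      using \<epsilon> \<delta> r0 by (auto simp: t_def)
    have nt: "D12_norm (\<lambda>x. t * u x) = t * r" using D12_scale(2)[OF u, of t] t by (simp add: r_def)
    have "t * r \<le> \<delta> / (2 * (r + 1)) * (r + 1)" using t r0 by (intro mult_mono) auto
    also have "\<delta> / (2 * (r + 1)) * (r + 1) = \<delta> / 2" using r0 by (simp add: field_simps)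
    also have "\<dots> < \<delta>" using \<delta>(1) by simp
    finally have "\<bar>energy f (\<lambda>x. u x + t * u x) - energy f u - L (\<lambda>x. t * u x)\<bar> \<le> \<epsilon> * (t * r)"
      using \<delta>(2)[OF D12_scale(1)[OF u, of t]] nt by simp
    moreover have "energy f u = 1 / 2 * k - \<Phi> 0" using en[of 0] by simp
    moreover have "t * ((1 + t / 2) * k - (\<Phi> t - \<Phi> 0) / t) = 1 / 2 * ((1 + t)\<^sup>2 * k) - \<Phi> t - (1 / 2 * k - \<Phi> 0)"
    proof -
      have "t * ((\<Phi> t - \<Phi> 0) / t) = \<Phi> t - \<Phi> 0" using t(1) by simp
      then show ?thesis unfolding right_diff_distrib by (simp add: power2_eq_square algebra_simps add_divide_distrib)
    qed
    ultimately have "\<bar>t * ((1 + t / 2) * k - (\<Phi> t - \<Phi> 0) / t)\<bar> \<le> \<epsilon> * (t * r)"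
      using en[of t] Lt[of t] t(1) by simp
    then have "t * \<bar>(1 + t / 2) * k - (\<Phi> t - \<Phi> 0) / t\<bar> \<le> t * (\<epsilon> * r)"
      using t(1) by (simp only: abs_mult) (simp add: mult_ac)
    then have "\<bar>(1 + t / 2) * k - (\<Phi> t - \<Phi> 0) / t\<bar> \<le> \<epsilon> * r"
      using t(1) by (simp only: mult_le_cancel_left_pos)
    then show ?thesis using t by blast
  qed
  have k0: "k \<ge> 0" by (simp add: k_def)
  have "\<theta> * \<Phi> 0 \<le> k"
  proof (rule le_from_approx[where c = "k + r"])
    fix \<epsilon> :: real assume \<epsilon>: "\<epsilon> > 0"
    obtain t where t: "t > 0" "t \<le> 1" "t \<le> \<epsilon>" and b: "\<bar>(1 + t / 2) * k - (\<Phi> t - \<Phi> 0) / t\<bar> \<le> \<epsilon> * r"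
      using key[OF \<epsilon>] by blast
    \<comment> \<open>The lower ray inequality bounds the quotient of \<Phi> from below. The extra
      term t / 2 * k is absorbed into \<epsilon> because t <= \<epsilon>.\<close>
    have "\<theta> * \<Phi> 0 \<le> (\<Phi> t - \<Phi> 0) / t" using \<Phi>l[of t] t by (simp add: pos_le_divide_eq algebra_simps)
    moreover have "t / 2 * k \<le> \<epsilon> * k" using t k0 by (intro mult_right_mono) auto
    ultimately show "\<theta> * \<Phi> 0 \<le> k + \<epsilon> * (k + r)" using b by (simp add: algebra_simps abs_le_iff)
  qed (use k0 r0 in simp)
  then show "\<theta> * (\<integral>x. F (u x) \<partial>lebesgue) \<le> (D12_norm u)\<^sup>2" by (simp add: \<Phi>_def k_def)
  have "k \<le> \<Psi>"
  proof (rule le_from_approx[where c = r])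
    fix \<epsilon> :: real assume \<epsilon>: "\<epsilon> > 0"
    obtain t where t: "t > 0" "t \<le> 1" "t \<le> \<epsilon>" and b: "\<bar>(1 + t / 2) * k - (\<Phi> t - \<Phi> 0) / t\<bar> \<le> \<epsilon> * r"
      using key[OF \<epsilon>] by blast
    \<comment> \<open>The upper ray inequality bounds the same quotient from above, and the extra
      term may be dropped as it is nonnegative.\<close>
    have "(\<Phi> t - \<Phi> 0) / t \<le> \<Psi>" using \<Phi>u[of t] t by (simp add: pos_divide_le_eq algebra_simps)
    moreover have "0 \<le> t / 2 * k" using t k0 by simp
    ultimately show "k \<le> \<Psi> + \<epsilon> * r" using b by (simp add: algebra_simps abs_le_iff)
  qed (rule r0)
  also have "\<Psi> \<le> (\<integral>x. A * two_power p q \<bar>u x\<bar> \<partial>lebesgue)"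
    unfolding \<Psi>_def using growth by (intro integral_mono F2i integrable_mult_right ti) (simp add: Fabs)
  finally show "(D12_norm u)\<^sup>2 \<le> A * (\<integral>x. two_power p q \<bar>u x\<bar> \<partial>lebesgue)" by (simp add: k_def)
qed

text \<open>With \<eta> = 1 / (2 A) the smallness estimate would give k <= k / 2 for a Nehari
  element of squared norm k <= K, hence k = 0 and u = 0 almost everywhere. So k > K, and the bound
  on the integral of F makes the energy at least c k with c = 1/2 - 1/\<theta>, which is positive as
  \<theta> > 2.\<close>

lemma ground_energy_Gamma_inf_unbounded:
  fixes f f' :: "real \<Rightarrow> real"
  assumes m: "CARD('m::finite) \<ge> 2"
    and f1: "f1 (CARD('m) + 2) f f'" and f2: "f2 f f'"
  obtains R where "R > 0" 
    "ereal B \<le> ground_energy (odd_ext f) R (Gamma_inf :: (complex \<times> (real^'m) \<Rightarrow> _) set)"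
proof -
  define F where "F = primitive (odd_ext f)"
  have Ndim: "DIM(complex \<times> (real^'m)) = CARD('m) + 2" by simp
  obtain A p q \<theta> where A: "A > 0" and pq: "2 < p" "p < crit_exp (CARD('m) + 2)" "crit_exp (CARD('m) + 2) < q" 
    and \<theta>: "\<theta> > 2" and F: "superquadratic F A p q \<theta>"
    using superquadratic_primitive[OF f1 f2] unfolding F_def by blast
  define c where "c = 1 / 2 - 1 / \<theta>"
  have c: "c > 0" using \<theta> by (simp add: c_def field_simps)
  \<comment> \<open>This choice gives c * K = |B| + c, which exceeds B.\<close>
  define K where "K = \<bar>B\<bar> / c + 1"
  have K: "K > 0" using c by (simp add: K_def add_nonneg_pos)
  have \<eta>: "1 / (2 * A) > 0" using A by simp
  have p0: "0 < p" using pq(1) by simp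
  obtain R where R: "R > 0" and small: "\<And>u :: complex \<times> (real^'m) \<Rightarrow> real. u \<in> D12_0 (ext_domain R) \<Longrightarrow> 
      invariant Gamma_inf u \<Longrightarrow> (D12_norm u)\<^sup>2 \<le> K \<Longrightarrow> 
      (\<integral>\<^sup>+x. ennreal (two_power p q \<bar>u x\<bar>) \<partial>lebesgue) \<le> ennreal (1 / (2 * A) * (D12_norm u)\<^sup>2)"
    using invariant_far_two_power_small[OF m p0 pq(2,3) K \<eta>] by blast
  have "ereal B \<le> ereal (energy (odd_ext f) u)" 
    if un: "u \<in> nehari (odd_ext f) R (Gamma_inf :: (complex \<times> (real^'m) \<Rightarrow> _) set)" for u
  proof -
    obtain L where u: "u \<in> D12_0 (ext_domain R)" "invariant Gamma_inf u" 
      and nz: "\<not> (AE x in lebesgue. u x = 0)" and L: "has_D12_derivative (energy (odd_ext f)) L u" "L u = 0"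
      using un by (auto simp: nehari_def)
    have uD: "u \<in> D12" using u(1) by (simp add: D12_0_def)
    define k where "k = (D12_norm u)\<^sup>2"
    have b: "\<theta> * (\<integral>x. F (u x) \<partial>lebesgue) \<le> k" "k \<le> A * (\<integral>x. two_power p q \<bar>u x\<bar> \<partial>lebesgue)"
      and ti: "integrable lebesgue (\<lambda>x. two_power p q \<bar>u x\<bar>)"
      using nehari_bounds[OF uD L F F_def _ _ _ A] \<theta> pq unfolding k_def by (simp_all add: Ndim)
    have "K < k"
    proof (rule ccontr)
      assume "\<not> K < k"
      then have s: "(\<integral>\<^sup>+x. ennreal (two_power p q \<bar>u x\<bar>) \<partial>lebesgue) \<le> ennreal (1 / (2 * A) * k)"
        using small[OF u] by (simp add: k_def)
      have eq: "(\<integral>\<^sup>+x. ennreal (two_power p q \<bar>u x\<bar>) \<partial>lebesgue) = ennreal (\<integral>x. two_power p q \<bar>u x\<bar> \<partial>lebesgue)"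
        by (rule nn_integral_eq_integral[OF ti]) (simp add: two_power_nonneg)
      have "(\<integral>x. two_power p q \<bar>u x\<bar> \<partial>lebesgue) \<le> 1 / (2 * A) * k"
        using s A unfolding eq by (subst (asm) ennreal_le_iff) (auto simp: k_def)
      then have "A * (\<integral>x. two_power p q \<bar>u x\<bar> \<partial>lebesgue) \<le> A * (1 / (2 * A) * k)"
        using A by (intro mult_left_mono) auto
      also have "\<dots> = k / 2" using A by simp
      finally have "k = 0" using b(2) zero_le_power2[of "D12_norm u"] unfolding k_def by linarith
      \<comment> \<open>The bound proportional to k now reads 0, and \<open>two_power\<close>
        vanishes at s >= 0 only for s = 0.\<close>
      then have "(\<integral>\<^sup>+x. ennreal (two_power p q \<bar>u x\<bar>) \<partial>lebesgue) = 0" using s by simp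
      then have "AE x in lebesgue. ennreal (two_power p q \<bar>u x\<bar>) = 0"
        using borel_measurable_integrable[OF ti] by (subst (asm) nn_integral_0_iff_AE) auto
      then have "AE x in lebesgue. u x = 0"
        by eventually_elim (auto simp: two_power_def ennreal_eq_0_iff split: if_splits)
      then show False using nz by simp
    qed
    have "energy (odd_ext f) u = 1 / 2 * k - (\<integral>x. F (u x) \<partial>lebesgue)"
      by (simp add: energy_def k_def F_def)
    also have "\<dots> \<ge> 1 / 2 * k - k / \<theta>" using b(1) \<theta> by (simp add: field_simps)
    also have "1 / 2 * k - k / \<theta> = c * k" by (simp add: c_def left_diff_distrib)
    finally have "c * k \<le> energy (odd_ext f) u" .
    moreover have "c * K \<le> c * k" using c \<open>K < k\<close> by simp
    moreover have "c * K = \<bar>B\<bar> + c" using c by (simp add: K_def distrib_left)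
    ultimately show ?thesis using c by simp
  qed
  then have "ereal B \<le> ground_energy (odd_ext f) R (Gamma_inf :: (complex \<times> (real^'m) \<Rightarrow> _) set)"
    unfolding ground_energy_def by (rule INF_greatest)
  with R show ?thesis by (rule that)
qed

text \<open>A larger group imposes more conditions, so its Nehari set is smaller and the infimum
  larger. If that set is empty, the infimum is \<infinity>, in accordance with the
  inequality.\<close>

lemma ground_energy_antimono_group:
  assumes "G \<subseteq> H" shows "ground_energy f R G \<le> ground_energy f R H"
  unfolding ground_energy_def
  by (rule INF_superset_mono) (use assms in \<open>auto simp: nehari_def invariant_def\<close>)

theorem corollary5p4:
  fixes f f' :: "real \<Rightarrow> real"
  assumes "DIM(complex \<times> (real^'m)) \<ge> 4"
    and "f1 DIM(complex \<times> (real^'m)) f f'"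
    and "f2 f f'"
  shows "(SUP R\<in>{0<..}. ground_energy (odd_ext f) R (Gamma_inf :: (complex \<times> (real^'m) \<Rightarrow> _) set))
           = (SUP R\<in>{0<..}. ground_energy (odd_ext f) R (orth_group :: (complex \<times> (real^'m) \<Rightarrow> _) set))
       \<and> (SUP R\<in>{0<..}. ground_energy (odd_ext f) R (orth_group :: (complex \<times> (real^'m) \<Rightarrow> _) set)) = \<infinity>"
proof -
  let ?G = "Gamma_inf :: (complex \<times> (real^'m) \<Rightarrow> _) set"
  let ?O = "orth_group :: (complex \<times> (real^'m) \<Rightarrow> _) set"
  have m: "CARD('m) \<ge> 2" and f1: "f1 (CARD('m) + 2) f f'" using assms by simp_all
  have Ginf: "(SUP R\<in>{0<..}. ground_energy (odd_ext f) R ?G) = \<infinity>"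
  proof (rule ereal_top)
    fix B
    obtain R where "R > 0" "ereal B \<le> ground_energy (odd_ext f) R ?G"
      by (rule ground_energy_Gamma_inf_unbounded[OF m f1 assms(3)])
    then show "ereal B \<le> (SUP R\<in>{0<..}. ground_energy (odd_ext f) R ?G)"
      by (intro SUP_upper2[of R]) auto
  qed
  \<comment> \<open>The radial case follows by comparison: radial functions are invariant under the
    smaller group.\<close>
  have "?G \<subseteq> ?O" using Gamma_inf_orthogonal by (auto simp: orth_group_def)
  then have "(SUP R\<in>{0<..}. ground_energy (odd_ext f) R ?G) \<le> (SUP R\<in>{0<..}. ground_energy (odd_ext f) R ?O)"
    by (intro SUP_mono' ground_energy_antimono_group)
  with Ginf show ?thesis by simp
qed

end
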